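(* Suppose that $0<\alpha\le1/2$. Then for any $\eta>0$ the following hold. 1. There exists a unique $\lambda_\infty^{\mathrm{hc}}\in\Pr_1(\mathcal{X}_0)$ such that $\mathcal{T}_\infty^{\mathrm{hc}}(\lambda_\infty^{\mathrm{hc}})=\lambda_\infty^{\mathrm{hc}}$. 2. As $N\to\infty$, $N^{-1}\log\nu^{\otimes N}(\mathfrak{P}_{\mathcal{G}_N})$ converges to $\mathcal{P}_\infty^{\mathrm{hc}}(\lambda_\infty^{\mathrm{hc}})$ in $L^1$.
   Context: **Continuous hardcore model.** For a fugacity $\eta>0$ let $\upsilon_0=\int_0^1\eta^xdx$ and let $\nu$ be the probability measure on $[0,1]$ with $\nu(B)=\upsilon_0^{-1}\int_B\eta^xdx$. Let $\mathcal{G}_N$ be the random graph with vertex set $[N]=\{1,\dots,N\}$ and edges $\{I(k,1),I(k,2)\}$, $k\le\pi(\alpha N)$, where $\pi(\alpha N)$ is Poisson with mean $\alpha N$ and, independently, the pairs $\{I(k,1),I(k,2)\}$ are i.i.d. uniform among the 2-element subsets of $[N]$. Let $$\mathfrak{P}_{\mathcal{G}_N}=\{\sigma\in[0,1]^N:\sigma_u+\sigma_v\le1\text{ for all edges }\{u,v\}\in\mathcal{G}_N\}.$$ **Operator and functional.** Let $\mathcal{X}_0$ be the set of all continuous probability density functions (w.r.t. Lebesgue measure) on $[0,1]$, with the sup norm, and $\Pr_1(\mathcal{X}_0)$ the set of Borel probability measures $\lambda$ on $\mathcal{X}_0$ with $\int\|f\|_\infty\lambda(df)<\infty$. For $\lambda\in\Pr_1(\mathcal{X}_0)$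 let $(f_k)_{k\ge1}$ be i.i.d. with law $\lambda$, $F_k(t)=\int_0^tf_k(x)dx$, and let $\pi(2\alpha)$ be an independent Poisson variable with mean $2\alpha$. Then $\mathcal{T}_\infty^{\mathrm{hc}}(\lambda)$ is the law of $$\Bigl(\frac{\eta^t\prod_{k\le\pi(2\alpha)}F_k(1-t)}{\int_0^1\eta^s\prod_{k\le\pi(2\alpha)}F_k(1-s)\,ds}\Bigr)_{t\in[0,1]},$$ and $$\mathcal{P}_\infty^{\mathrm{hc}}(\lambda)=-\log\upsilon_0+\mathbb{E}\log\int_0^1\eta^t\prod_{k\le\pi(2\alpha)}F_k(1-t)\,dt-\alpha\,\mathbb{E}\log\int_0^1F_1(1-t)f_2(t)\,dt.$$ *)

theory Defs
  imports "HOL-Probability.Probability"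
begin

section \<open>The finite model\<close>

definition upsilon0 :: "real \<Rightarrow> real" where
  "upsilon0 \<eta> = integral {0..1} (\<lambda>x. \<eta> powr x)"

definition hc_nu :: "real \<Rightarrow> real measure" where
  "hc_nu \<eta> = density (restrict_space lborel {0..1}) (\<lambda>x. ennreal (\<eta> powr x / upsilon0 \<eta>))"

definition vertex_pairs :: "nat \<Rightarrow> nat set set" where
  "vertex_pairs N = {e. e \<subseteq> {1..N} \<and> card e = 2}"

text \<open>
  The law of the edge set. There is no 2-element subset of \<open>{1..N}\<close> for \<open>N \<le> 1\<close>, so this
  is meaningful only for \<open>N \<ge> 2\<close>.
\<close>

definition random_graph :: "real \<Rightarrow> nat \<Rightarrow> nat set set pmf" where
  "random_graph \<alpha> N =
     do { m \<leftarrow> poisson_pmf (\<alpha> * real N);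
          I \<leftarrow> Pi_pmf {1..m} {} (\<lambda>_. pmf_of_set (vertex_pairs N));
          return_pmf (I ` {1..m}) }"

definition hc_polytope :: "nat \<Rightarrow> nat set set \<Rightarrow> (nat \<Rightarrow> real) set" where
  "hc_polytope N G =
     {\<sigma> \<in> {1..N} \<rightarrow>\<^sub>E {0..1}. \<forall>u\<in>{1..N}. \<forall>v\<in>{1..N}. {u, v} \<in> G \<longrightarrow> \<sigma> u + \<sigma> v \<le> 1}"

definition hc_log_volume :: "real \<Rightarrow> nat \<Rightarrow> nat set set \<Rightarrow> real" where
  "hc_log_volume \<eta> N G = ln (measure (\<Pi>\<^sub>M i\<in>{1..N}. hc_nu \<eta>) (hc_polytope N G)) / real N"

text \<open>
  Convergence in \<open>L\<^sup>1\<close> to a constant; it depends only on the laws of the random variables,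
  so each may live on a probability space of its own.
\<close>

definition tendsto_L1 :: "(nat \<Rightarrow> 'a measure) \<Rightarrow> (nat \<Rightarrow> 'a \<Rightarrow> real) \<Rightarrow> real \<Rightarrow> bool" where
  "tendsto_L1 M X c \<longleftrightarrow>
     (\<forall>\<^sub>F N in sequentially. integrable (M N) (X N)) \<and>
     (\<lambda>N. \<integral>\<omega>. \<bar>X N \<omega> - c\<bar> \<partial>M N) \<longlonglongrightarrow> 0"


section \<open>Continuous functions on the unit interval\<close>

text \<open>
  A continuous function on \<open>{0..1}\<close> is represented by its unique continuous extension to the
  reals that is constant on \<open>{..0}\<close> and on \<open>{1..}\<close>, as an element of the library's normed
  space of bounded continuous functions. Lemmas \<open>ex1_C01\<close> and \<open>norm_C01\<close> show that this
  identifies \<open>C({0..1})\<close> with a subspace isometrically for the sup norm.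
\<close>

definition C01 :: "(real \<Rightarrow>\<^sub>C real) set" where
  "C01 = {f. \<forall>x. apply_bcontfun f x = apply_bcontfun f (clamp 0 1 x)}"

definition to_C01 :: "(real \<Rightarrow> real) \<Rightarrow> (real \<Rightarrow>\<^sub>C real)" where
  "to_C01 g = Bcontfun (\<lambda>x. g (clamp 0 1 x))"

lemma apply_to_C01:
  assumes "continuous_on {0..1} g"
  shows "apply_bcontfun (to_C01 g) x = g (clamp 0 1 x)"
proof -
  have "(\<lambda>x. g (clamp 0 1 x)) \<in> bcontfun"
    using clamp_continuous_on[of 0 1 g UNIV] clamp_bounded[of g 0 1]
      compact_imp_bounded[OF compact_continuous_image[OF assms compact_Icc]] assms
    by (simp add: bcontfun_def)
  then show ?thesis
    by (simp add: to_C01_def Bcontfun_inverse)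
qed

lemma ex1_C01:
  assumes "continuous_on {0..1} g"
  shows "\<exists>!f. f \<in> C01 \<and> (\<forall>x\<in>{0..1}. apply_bcontfun f x = g x)"
proof (rule ex1I[of _ "to_C01 g"])
  have c: "clamp 0 1 x \<in> {0..1}" for x :: real
    using clamp_in_interval[of 0 1 x] by simp
  have cc: "clamp 0 1 x = x" if "x \<in> {0..1}" for x :: real
    using that by (simp add: clamp_cancel_cbox)
  show "to_C01 g \<in> C01 \<and> (\<forall>x\<in>{0..1}. apply_bcontfun (to_C01 g) x = g x)"
    using c cc by (simp add: C01_def apply_to_C01[OF assms])
  fix f assume f: "f \<in> C01 \<and> (\<forall>x\<in>{0..1}. apply_bcontfun f x = g x)"
  show "f = to_C01 g"
  proof (rule bcontfun_eqI)
    fix x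
    have "apply_bcontfun f x = apply_bcontfun f (clamp 0 1 x)"
      using f by (auto simp: C01_def)
    then show "apply_bcontfun f x = apply_bcontfun (to_C01 g) x"
      using f c[of x] by (simp add: apply_to_C01[OF assms])
  qed
qed

lemma norm_C01:
  assumes "f \<in> C01"
  shows "norm f = (SUP x\<in>{0..1}. \<bar>apply_bcontfun f x\<bar>)"
proof (rule antisym)
  have bdd: "bdd_above ((\<lambda>x. \<bar>apply_bcontfun f x\<bar>) ` {0..1})"
    using norm_bounded[of f] by (intro bdd_aboveI2[of _ _ "norm f"]) simp
  show "norm f \<le> (SUP x\<in>{0..1}. \<bar>apply_bcontfun f x\<bar>)"
  proof (rule norm_bound)
    fix x :: real
    have "apply_bcontfun f x = apply_bcontfun f (clamp 0 1 x)"
      using assms by (auto simp: C01_def)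
    moreover have "clamp 0 1 x \<in> {0..1}"
      using clamp_in_interval[of 0 1 x] by simp
    ultimately show "norm (apply_bcontfun f x) \<le> (SUP x\<in>{0..1}. \<bar>apply_bcontfun f x\<bar>)"
      using bdd by (metis cSUP_upper real_norm_def)
  qed
  show "(SUP x\<in>{0..1}. \<bar>apply_bcontfun f x\<bar>) \<le> norm f"
    using norm_bounded[of f] by (intro cSUP_least) auto
qed


section \<open>The operator and the functional\<close>

definition X0 :: "(real \<Rightarrow>\<^sub>C real) set" where
  "X0 = {f \<in> C01. (\<forall>x\<in>{0..1}. 0 \<le> apply_bcontfun f x) \<and> integral {0..1} (apply_bcontfun f) = 1}"

definition Pr1_X0 :: "(real \<Rightarrow>\<^sub>C real) measure set" where
  "Pr1_X0 = {\<mu>. prob_space \<mu> \<and> sets \<mu> = sets (restrict_space borel X0) \<and>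
                 (\<integral>\<^sup>+f. ennreal (norm f) \<partial>\<mu>) < \<infinity>}"

definition cdf01 :: "(real \<Rightarrow>\<^sub>C real) \<Rightarrow> real \<Rightarrow> real" where
  "cdf01 f t = integral {0..t} (apply_bcontfun f)"

definition hc_weight :: "real \<Rightarrow> nat \<Rightarrow> (nat \<Rightarrow> (real \<Rightarrow>\<^sub>C real)) \<Rightarrow> real \<Rightarrow> real" where
  "hc_weight \<eta> n f t = \<eta> powr t * (\<Prod>k\<in>{1..n}. cdf01 (f k) (1 - t))"

definition hc_norm_const :: "real \<Rightarrow> nat \<Rightarrow> (nat \<Rightarrow> (real \<Rightarrow>\<^sub>C real)) \<Rightarrow> real" where
  "hc_norm_const \<eta> n f = integral {0..1} (hc_weight \<eta> n f)"

definition hc_update :: "real \<Rightarrow> nat \<Rightarrow> (nat \<Rightarrow> (real \<Rightarrow>\<^sub>C real)) \<Rightarrow> (real \<Rightarrow>\<^sub>C real)" where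
  "hc_update \<eta> n f = to_C01 (\<lambda>t. hc_weight \<eta> n f t / hc_norm_const \<eta> n f)"

lemma cdf01_nonneg:
  assumes "f \<in> X0" and "s \<in> {0..1}"
  shows "0 \<le> cdf01 f s"
  unfolding cdf01_def using assms
  by (intro integral_nonneg integrable_continuous_interval) (auto simp: X0_def)

lemma continuous_on_hc_weight:
  assumes "0 < \<eta>"
  shows "continuous_on {0..1} (hc_weight \<eta> n f)"
proof -
  have "continuous_on {0..1} (cdf01 g)" for g
    unfolding cdf01_def
    by (intro indefinite_integral_continuous_1 integrable_continuous_interval) auto
  then have "continuous_on {0..1} (\<lambda>t. cdf01 g (1 - t))" for g
    by (rule continuous_on_compose2) (auto intro!: continuous_intros)
  then show ?thesis
    unfolding hc_weight_def using assms by (intro continuous_intros) auto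
qed

lemma hc_norm_const_pos:
  assumes "0 < \<eta>" and "\<And>k. k \<in> {1..n} \<Longrightarrow> f k \<in> X0"
  shows "0 < hc_norm_const \<eta> n f"
proof -
  have nn: "0 \<le> hc_weight \<eta> n f t" if "t \<in> {0..1}" for t
    unfolding hc_weight_def using assms that
    by (intro mult_nonneg_nonneg prod_nonneg) (auto intro!: cdf01_nonneg)
  have "hc_weight \<eta> n f 0 = 1"
    using assms by (simp add: hc_weight_def cdf01_def X0_def)
  then have "hc_norm_const \<eta> n f \<noteq> 0"
    using integral_eq_0_iff[OF continuous_on_hc_weight[OF assms(1), of n f]] nn
    unfolding hc_norm_const_def by force
  moreover have "0 \<le> hc_norm_const \<eta> n f"
    unfolding hc_norm_const_def using nn continuous_on_hc_weight[OF assms(1)]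
    by (intro integral_nonneg integrable_continuous_interval) auto
  ultimately show ?thesis
    by simp
qed

lemma hc_update_apply:
  assumes "0 < \<eta>" and "\<And>k. k \<in> {1..n} \<Longrightarrow> f k \<in> X0" and "t \<in> {0..1}"
  shows "apply_bcontfun (hc_update \<eta> n f) t =
           \<eta> powr t * (\<Prod>k\<in>{1..n}. cdf01 (f k) (1 - t)) /
           integral {0..1} (\<lambda>s. \<eta> powr s * (\<Prod>k\<in>{1..n}. cdf01 (f k) (1 - s)))"
proof -
  have "continuous_on {0..1} (\<lambda>t. hc_weight \<eta> n f t / hc_norm_const \<eta> n f)"
    using hc_norm_const_pos[of \<eta> n f] assms
    by (intro continuous_intros continuous_on_hc_weight) auto
  then show ?thesis
    using assms(3)
    by (simp add: hc_update_def apply_to_C01 hc_weight_def[abs_def] hc_norm_const_def clamp_cancel_cbox)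
qed

text \<open>
  The joint law of \<open>\<pi>(2\<alpha>)\<close> and of the independent i.i.d. sequence \<open>f\<^sub>1, f\<^sub>2, \<dots>\<close>.
\<close>

definition hc_space :: "real \<Rightarrow> (real \<Rightarrow>\<^sub>C real) measure \<Rightarrow> (nat \<times> (nat \<Rightarrow> (real \<Rightarrow>\<^sub>C real))) measure" where
  "hc_space \<alpha> \<mu> = measure_pmf (poisson_pmf (2 * \<alpha>)) \<Otimes>\<^sub>M (\<Pi>\<^sub>M k\<in>{1..}. \<mu>)"

definition T_hc :: "real \<Rightarrow> real \<Rightarrow> (real \<Rightarrow>\<^sub>C real) measure \<Rightarrow> (real \<Rightarrow>\<^sub>C real) measure" where
  "T_hc \<eta> \<alpha> \<mu> = distr (hc_space \<alpha> \<mu>) (restrict_space borel X0) (\<lambda>(n, f). hc_update \<eta> n f)"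

definition vertex_term :: "real \<Rightarrow> nat \<times> (nat \<Rightarrow> (real \<Rightarrow>\<^sub>C real)) \<Rightarrow> real" where
  "vertex_term \<eta> = (\<lambda>(n, f). ln (hc_norm_const \<eta> n f))"

definition edge_integral :: "(nat \<Rightarrow> (real \<Rightarrow>\<^sub>C real)) \<Rightarrow> real" where
  "edge_integral f = integral {0..1} (\<lambda>t. cdf01 (f 1) (1 - t) * apply_bcontfun (f 2) t)"

definition edge_term :: "nat \<times> (nat \<Rightarrow> (real \<Rightarrow>\<^sub>C real)) \<Rightarrow> real" where
  "edge_term = (\<lambda>(n, f). ln (edge_integral f))"

text \<open>
  Since \<open>ln 0 = 0\<close> and the Bochner integral of a non-integrable function is 0, the number
  \<open>P_hc \<eta> \<alpha> \<mu>\<close> is the intended one exactly when the following condition holds: the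
  logarithms are almost surely finite and the two expectations exist as real numbers.
\<close>

definition P_hc_well_defined :: "real \<Rightarrow> real \<Rightarrow> (real \<Rightarrow>\<^sub>C real) measure \<Rightarrow> bool" where
  "P_hc_well_defined \<eta> \<alpha> \<mu> \<longleftrightarrow>
     (AE (n, f) in hc_space \<alpha> \<mu>. 0 < hc_norm_const \<eta> n f \<and> 0 < edge_integral f) \<and>
     integrable (hc_space \<alpha> \<mu>) (vertex_term \<eta>) \<and>
     integrable (hc_space \<alpha> \<mu>) edge_term"

definition P_hc :: "real \<Rightarrow> real \<Rightarrow> (real \<Rightarrow>\<^sub>C real) measure \<Rightarrow> real" where
  "P_hc \<eta> \<alpha> \<mu> =
     - ln (upsilon0 \<eta>) + (\<integral>\<omega>. vertex_term \<eta> \<omega> \<partial>hc_space \<alpha> \<mu>)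
     - \<alpha> * (\<integral>\<omega>. edge_term \<omega> \<partial>hc_space \<alpha> \<mu>)"

end

theory Submission
  imports Defs "HOL-Real_Asymp.Real_Asymp"
begin

text \<open>
The mean degree \<open>2\<alpha>\<close> of the random graph is at most one. Hence the graph seen from finitely many
roots is, in the limit, a forest of Poisson Galton--Watson trees that die out almost surely, and the
limiting law of the marginal densities is discrete: it charges only the countably many densities
that finite trees produce. The three parts of the proof exploit this.

\<^emph>\<open>The fixed point.\<close> On the weights of the atoms of a law, the operator acts as \<open>gw_op\<close>. Its
iterates from the zero weight increase, and their total masses satisfy
\<open>m\<^sub>r\<^sub>+\<^sub>1 = exp (2\<alpha> (m\<^sub>r - 1))\<close>; they tend to one precisely because \<open>2\<alpha> \<le> 1\<close>. So the limit \<open>gw\<close> is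
the weight of a probability measure. The atoms of any fixed point dominate all iterates
(\<open>T_atoms\<close>), hence dominate \<open>gw\<close>; since both measures have mass one, they agree
(\<open>gw_law_unique\<close>). Applied to the image of \<open>gw_law\<close> this gives existence, applied to an
arbitrary fixed point it gives uniqueness.

\<^emph>\<open>The local limit.\<close> Integrating out one spin at a time (\<open>hc_vol_insert\<close>) shows: if the spins at
the neighbours of a new vertex are independent under the Gibbs measure of the old graph, then the
new spin has the updated density (\<open>factorizes_peel\<close>). Stripping off the roots in this way, and using
Fatou's lemma in the sum over their neighbourhoods, the limiting probability that given roots have
independent spins with prescribed densities is at least the product of their \<open>gw\<close>-weights
(\<open>local_lower_gw\<close>). These lower bounds have total mass one, so nothing else survives in the limit,
and the mean logarithmic cost of inserting a vertex with \<open>k\<close> neighbours converges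
(\<open>mean_loss_tendsto\<close>).

\<^emph>\<open>The free energy.\<close> As a set of edges, the random graph contains every pair independently with the
same probability (\<open>expectation_random_graph\<close>). Going from \<open>N\<close> to \<open>N + 1\<close> vertices inserts a vertex
with a binomial number of neighbours and lowers the edge probability a little. By Russo's formula
the second effect amounts to \<open>\<alpha>\<close> times the mean cost of an additional edge, which is the difference between the
costs of inserting a vertex with \<open>k + 1\<close> and with \<open>k\<close> neighbours. So the increments of the mean log
volume converge (\<open>mean_lnZ_increment_tendsto\<close>), and at the fixed point the limit is the functional
of the theorem (\<open>P_hc_gw_law\<close>), because there the edge integral is a quotient of two normalising
constants (\<open>edge_pair_upd\<close>). Given all other spins, a spin is at most \<open>1/2\<close> with probability at
least \<open>hc_half\<close>; therefore one edge changes the log volume by a bounded amount, and the Efron--Stein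
inequality makes the fluctuations negligible (\<open>Eb_lnZ_tendsto_L1\<close>).
\<close>

section \<open>Independent random subsets\<close>

text \<open>
  Expectation of \<open>f\<close> over a random subset of \<open>E\<close> that contains each element independently with
  probability \<open>p\<close>. As an explicit finite sum it can be differentiated in \<open>p\<close>.
\<close>

definition Eb :: "real \<Rightarrow> 'a set \<Rightarrow> ('a set \<Rightarrow> real) \<Rightarrow> real" where
  "Eb p E f = (\<Sum>A\<in>Pow E. p ^ card A * (1 - p) ^ card (E - A) * f A)"

lemma Eb_empty [simp]: "Eb p {} f = f {}"
  by (simp add: Eb_def)

lemma Eb_insert:
  assumes "finite E" "e \<notin> E"
  shows "Eb p (insert e E) f = (1 - p) * Eb p E f + p * Eb p E (\<lambda>A. f (insert e A))"
proof -
  let ?w = "\<lambda>E A. p ^ card A * (1 - p) ^ card (E - A)"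
  have inj: "inj_on (insert e) (Pow E)"
    using assms by (auto simp: inj_on_def)
  have "Eb p (insert e E) f = (\<Sum>A\<in>Pow E \<union> insert e ` Pow E. ?w (insert e E) A * f A)"
    by (simp add: Eb_def Pow_insert)
  also have "\<dots> = (\<Sum>A\<in>Pow E. ?w (insert e E) A * f A) + (\<Sum>A\<in>insert e ` Pow E. ?w (insert e E) A * f A)"
    using assms by (intro sum.union_disjoint) auto
  also have "(\<Sum>A\<in>insert e ` Pow E. ?w (insert e E) A * f A) =
      (\<Sum>A\<in>Pow E. ?w (insert e E) (insert e A) * f (insert e A))"
    using inj by (simp add: sum.reindex)
  also have "\<dots> = p * Eb p E (\<lambda>A. f (insert e A))"
    unfolding Eb_def sum_distrib_left
  proof (intro sum.cong refl)
    fix A assume A: "A \<in> Pow E"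
    then have "insert e E - insert e A = E - A" "card (insert e A) = Suc (card A)"
      using assms finite_subset[of A E] by (auto simp: card_insert_if)
    then show "?w (insert e E) (insert e A) * f (insert e A) = p * (?w E A * f (insert e A))"
      by simp
  qed
  also have "(\<Sum>A\<in>Pow E. ?w (insert e E) A * f A) = (1 - p) * Eb p E f"
    unfolding Eb_def sum_distrib_left
  proof (intro sum.cong refl)
    fix A assume A: "A \<in> Pow E"
    then have "insert e E - A = insert e (E - A)" "e \<notin> E - A" "finite (E - A)"
      using assms by auto
    then show "?w (insert e E) A * f A = (1 - p) * (?w E A * f A)"
      by simp
  qed
  finally show ?thesis .
qed

lemma Eb_cong:
  "E = E' \<Longrightarrow> (\<And>A. A \<subseteq> E' \<Longrightarrow> f A = g A) \<Longrightarrow> Eb p E f = Eb p E' g"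
  by (auto simp: Eb_def intro!: sum.cong)

lemma Eb_const [simp]: "finite E \<Longrightarrow> Eb p E (\<lambda>_. k) = k"
  by (induction E rule: finite_induct) (auto simp: Eb_insert algebra_simps)

lemma Eb_cmult: "Eb p E (\<lambda>A. k * f A) = k * Eb p E f"
  by (simp add: Eb_def sum_distrib_left mult_ac)

lemma Eb_add: "Eb p E (\<lambda>A. f A + g A) = Eb p E f + Eb p E g"
  by (simp add: Eb_def sum.distrib ring_distribs)

lemma Eb_diff: "Eb p E (\<lambda>A. f A - g A) = Eb p E f - Eb p E g"
  by (simp add: Eb_def sum_subtractf ring_distribs)

lemma Eb_mono:
  assumes "0 \<le> p" "p \<le> 1" "\<And>A. A \<subseteq> E \<Longrightarrow> f A \<le> g A"
  shows "Eb p E f \<le> Eb p E g"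
  unfolding Eb_def using assms by (intro sum_mono mult_left_mono) auto

lemma Eb_nonneg:
  assumes "0 \<le> p" "p \<le> 1" "\<And>A. A \<subseteq> E \<Longrightarrow> 0 \<le> f A"
  shows "0 \<le> Eb p E f"
  unfolding Eb_def using assms by (intro sum_nonneg mult_nonneg_nonneg) auto

lemma Eb_Un:
  assumes "finite E1" "finite E2" "E1 \<inter> E2 = {}"
  shows "Eb p (E1 \<union> E2) f = Eb p E1 (\<lambda>A. Eb p E2 (\<lambda>B. f (A \<union> B)))"
  using assms
proof (induction E1 arbitrary: f rule: finite_induct)
  case (insert e E)
  then have "e \<notin> E \<union> E2" "finite (E \<union> E2)"
    by auto
  then show ?case
    using insert by (simp add: Eb_insert)
qed simp

lemma Eb_swap: "Eb p E (\<lambda>A. Eb q D (\<lambda>B. f A B)) = Eb q D (\<lambda>B. Eb p E (\<lambda>A. f A B))"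
proof -
  have "(\<Sum>A\<in>Pow E. \<Sum>B\<in>Pow D. w A * (v B * f A B)) = (\<Sum>B\<in>Pow D. \<Sum>A\<in>Pow E. v B * (w A * f A B))"
    for w v :: "_ \<Rightarrow> real"
    by (subst sum.swap) (simp add: mult_ac)
  then show ?thesis
    by (simp add: Eb_def sum_distrib_left)
qed

lemma Eb_image:
  assumes "finite E" "inj_on h E"
  shows "Eb p (h ` E) f = Eb p E (\<lambda>A. f (h ` A))"
  using assms
  by (induction E arbitrary: f rule: finite_induct) (auto simp: Eb_insert image_iff)

lemma Eb_card:
  assumes "finite E"
  shows "Eb p E (\<lambda>A. g (card A)) =
    (\<Sum>k\<le>card E. real (card E choose k) * p ^ k * (1 - p) ^ (card E - k) * g k)"
proof -
  have "Eb p E (\<lambda>A. g (card A)) =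
      (\<Sum>A\<in>Pow E. p ^ card A * (1 - p) ^ (card E - card A) * g (card A))"
    unfolding Eb_def using assms
    by (intro sum.cong refl) (auto simp: card_Diff_subset finite_subset)
  also have "\<dots> = (\<Sum>k\<le>card E. \<Sum>A\<in>{A\<in>Pow E. card A = k}. p ^ card A * (1 - p) ^ (card E - card A) * g (card A))"
    using assms by (intro sum.group[symmetric]) (auto simp: card_mono)
  also have "\<dots> = (\<Sum>k\<le>card E. real (card E choose k) * p ^ k * (1 - p) ^ (card E - k) * g k)"
    using assms by (intro sum.cong refl) (simp add: n_subsets)
  finally show ?thesis .
qed

text \<open>
  The probabilities of being contained in \<open>A\<close> determine the law of a random set; they are what is
  easy to compute for the Poisson number of sampled pairs.
\<close>

lemma Eb_of_bool_subset:
  assumes "finite E" "A \<subseteq> E"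
  shows "Eb p E (\<lambda>B. of_bool (B \<subseteq> A)) = (1 - p) ^ card (E - A)"
  using assms
proof (induction E arbitrary: A rule: finite_induct)
  case (insert e E)
  show ?case
  proof (cases "e \<in> A")
    case True
    have "B \<subseteq> A \<longleftrightarrow> B \<subseteq> A - {e}" if "B \<subseteq> E" for B
      using that insert.hyps by auto
    then have "Eb p E (\<lambda>B. of_bool (B \<subseteq> A)) = Eb p E (\<lambda>B. of_bool (B \<subseteq> A - {e}))"
      by (intro Eb_cong) auto
    also have "\<dots> = (1 - p) ^ card (E - (A - {e}))"
      using insert.prems by (intro insert.IH) auto
    also have "E - (A - {e}) = insert e E - A"
      using True insert.hyps by auto
    finally show ?thesis
      using True insert.hyps by (simp add: Eb_insert algebra_simps)
  next
    case False
    then have "insert e E - A = insert e (E - A)" "A \<subseteq> E"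
      using insert.prems by auto
    then show ?thesis
      using False insert.hyps insert.IH[of A] by (simp add: Eb_insert)
  qed
qed simp

text \<open>
  Russo's formula: a small change of \<open>p\<close> acts on each element separately, and the effect of an
  element is the difference between its presence and its absence.
\<close>

lemma Eb_has_derivative_Russo:
  assumes "finite E"
  shows "((\<lambda>p. Eb p E f) has_real_derivative
           (\<Sum>e\<in>E. Eb p E (\<lambda>A. f (insert e A) - f (A - {e})))) (at p)"
  using assms
proof (induction E arbitrary: f rule: finite_induct)
  case (insert e E)
  let ?d = "\<lambda>f e A. f (insert e A) - f (A - {e})"
  have 1: "Eb p (insert e E) (\<lambda>A. ?d f e A) = Eb p E (\<lambda>A. f (insert e A)) - Eb p E f"
  proof -
    have "insert e A - {e} = A" "A - {e} = A" if "A \<subseteq> E" for A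
      using that insert.hyps by auto
    then have "Eb p E (?d f e) = Eb p E (\<lambda>A. f (insert e A) - f A)"
      "Eb p E (\<lambda>A. ?d f e (insert e A)) = Eb p E (\<lambda>A. f (insert e A) - f A)"
      by (auto intro!: Eb_cong)
    then have "Eb p (insert e E) (?d f e) = Eb p E (\<lambda>A. f (insert e A) - f A)"
      unfolding Eb_insert[OF insert.hyps(1,2)] by (simp add: left_diff_distrib)
    then show ?thesis
      by (simp add: Eb_diff)
  qed
  have 2: "(\<Sum>e'\<in>E. Eb p (insert e E) (\<lambda>A. ?d f e' A)) =
     (1 - p) * (\<Sum>e'\<in>E. Eb p E (?d f e')) + p * (\<Sum>e'\<in>E. Eb p E (?d (\<lambda>A. f (insert e A)) e'))"
  proof -
    have "f (insert e' (insert e A)) - f (insert e A - {e'}) = ?d (\<lambda>A. f (insert e A)) e' A"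
      if "e' \<in> E" for e' A
    proof -
      have "insert e A - {e'} = insert e (A - {e'})" "insert e' (insert e A) = insert e (insert e' A)"
        using that insert.hyps by auto
      then show ?thesis by simp
    qed
    then show ?thesis
      using insert.hyps by (simp add: Eb_insert sum.distrib sum_distrib_left)
  qed
  have "((\<lambda>p. (1 - p) * Eb p E f + p * Eb p E (\<lambda>A. f (insert e A))) has_real_derivative
     - Eb p E f + (1 - p) * (\<Sum>e'\<in>E. Eb p E (?d f e'))
     + (Eb p E (\<lambda>A. f (insert e A)) + p * (\<Sum>e'\<in>E. Eb p E (?d (\<lambda>A. f (insert e A)) e')))) (at p)"
    by (auto intro!: derivative_eq_intros insert.IH)
  then have "((\<lambda>p. Eb p (insert e E) f) has_real_derivative
     - Eb p E f + (1 - p) * (\<Sum>e'\<in>E. Eb p E (?d f e'))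
     + (Eb p E (\<lambda>A. f (insert e A)) + p * (\<Sum>e'\<in>E. Eb p E (?d (\<lambda>A. f (insert e A)) e')))) (at p)"
    unfolding Eb_insert[OF insert.hyps(1,2)] .
  then show ?case
    by (rule DERIV_cong) (simp only: sum.insert[OF insert.hyps(1,2)] 1 2)
qed simp

text \<open>
  By induction on \<open>E\<close>: the variance splits into the mean of the conditional variance given all other
  elements, which is at most \<open>p K\<^sup>2\<close>, and the variance of the conditional mean, which again has
  bounded differences.
\<close>

lemma Eb_variance_Efron_Stein:
  assumes "finite E" "0 \<le> p" "p \<le> 1"
    and "\<And>A e. A \<subseteq> E \<Longrightarrow> e \<in> E \<Longrightarrow> e \<notin> A \<Longrightarrow> \<bar>f (insert e A) - f A\<bar> \<le> K"
  shows "Eb p E (\<lambda>A. (f A - Eb p E f)\<^sup>2) \<le> real (card E) * p * K\<^sup>2"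
  using assms
proof (induction E arbitrary: f rule: finite_induct)
  case (insert e E)
  \<comment> \<open>the conditional mean of \<open>f\<close> given the other elements\<close>
  define g where "g A = (1 - p) * f A + p * f (insert e A)" for A
  define m where "m = Eb p E g"
  have m: "Eb p (insert e E) f = m"
    using insert.hyps by (simp add: m_def g_def[abs_def] Eb_insert Eb_add Eb_cmult)
  have "Eb p (insert e E) (\<lambda>A. (f A - m)\<^sup>2) =
      Eb p E (\<lambda>A. (1 - p) * (f A - m)\<^sup>2 + p * (f (insert e A) - m)\<^sup>2)"
    using insert.hyps by (simp add: Eb_insert Eb_add Eb_cmult)
  also have "\<dots> = Eb p E (\<lambda>A. (g A - m)\<^sup>2 + p * (1 - p) * (f (insert e A) - f A)\<^sup>2)"
    by (intro Eb_cong refl) (simp add: g_def power2_eq_square algebra_simps)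
  also have "\<dots> \<le> Eb p E (\<lambda>A. (g A - m)\<^sup>2 + p * K\<^sup>2)"
  proof (intro Eb_mono add_left_mono)
    fix A assume "A \<subseteq> E"
    then have "\<bar>f (insert e A) - f A\<bar> \<le> K"
      using insert.hyps by (intro insert.prems) auto
    then have "(f (insert e A) - f A)\<^sup>2 \<le> K\<^sup>2"
      by (metis abs_ge_zero order_trans power2_abs power_mono)
    moreover have "p * (1 - p) \<le> p" "0 \<le> p * (1 - p)"
      using insert.prems by (auto simp: algebra_simps intro!: mult_left_le)
    ultimately show "p * (1 - p) * (f (insert e A) - f A)\<^sup>2 \<le> p * K\<^sup>2"
      by (intro mult_mono) (auto simp: insert.prems)
  qed (use insert.prems in auto)
  also have "\<dots> = Eb p E (\<lambda>A. (g A - Eb p E g)\<^sup>2) + p * K\<^sup>2"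
    using insert.hyps by (simp add: Eb_add m_def)
  also have "\<dots> \<le> real (card E) * p * K\<^sup>2 + p * K\<^sup>2"
  proof (intro add_right_mono insert.IH)
    fix A e' assume A: "A \<subseteq> E" "e' \<in> E" "e' \<notin> A"
    have b1: "\<bar>f (insert e' A) - f A\<bar> \<le> K"
      using A by (intro insert.prems) auto
    have b2: "\<bar>f (insert e' (insert e A)) - f (insert e A)\<bar> \<le> K"
      using A insert.hyps by (intro insert.prems) auto
    have "g (insert e' A) - g A = (1 - p) * (f (insert e' A) - f A) + p * (f (insert e' (insert e A)) - f (insert e A))"
      by (simp add: g_def algebra_simps insert_commute)
    also have "\<bar>\<dots>\<bar> \<le> (1 - p) * \<bar>f (insert e' A) - f A\<bar> + p * \<bar>f (insert e' (insert e A)) - f (insert e A)\<bar>"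
      using insert.prems by (intro order_trans[OF abs_triangle_ineq]) (simp add: abs_mult)
    also have "\<dots> \<le> (1 - p) * K + p * K"
      using b1 b2 insert.prems by (intro add_mono mult_left_mono) auto
    finally show "\<bar>g (insert e' A) - g A\<bar> \<le> K"
      by (simp add: algebra_simps)
  qed (use insert.prems in auto)
  finally have "Eb p (insert e E) (\<lambda>A. (f A - m)\<^sup>2) \<le> (real (card E) + 1) * p * K\<^sup>2"
    by (simp only: ring_distribs mult_1_left)
  then show ?case
    unfolding m using insert.hyps by (simp add: add.commute)
qed simp

lemma Eb_abs_le_variance:
  assumes "finite E" "0 \<le> p" "p \<le> 1"
  shows "Eb p E (\<lambda>A. \<bar>f A\<bar>) \<le> sqrt (Eb p E (\<lambda>A. (f A)\<^sup>2))"
proof (rule real_le_rsqrt)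
  define m where "m = Eb p E (\<lambda>A. \<bar>f A\<bar>)"
  have "0 \<le> Eb p E (\<lambda>A. (\<bar>f A\<bar> - m)\<^sup>2)"
    using assms by (intro Eb_nonneg) auto
  also have "\<dots> = Eb p E (\<lambda>A. (f A)\<^sup>2 + (m\<^sup>2 - 2 * m * \<bar>f A\<bar>))"
    by (intro Eb_cong refl) (simp add: power2_eq_square algebra_simps)
  also have "\<dots> = Eb p E (\<lambda>A. (f A)\<^sup>2) - m\<^sup>2"
    using assms by (simp add: Eb_add Eb_diff Eb_cmult flip: m_def) (simp add: power2_eq_square)
  finally show "(Eb p E (\<lambda>A. \<bar>f A\<bar>))\<^sup>2 \<le> Eb p E (\<lambda>A. (f A)\<^sup>2)"
    by (simp add: m_def)
qed

text \<open>
  By induction on subsets, the point masses are recovered from the probabilities of \<open>B \<subseteq> A\<close>.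
\<close>

lemma Eb_eq_measure_pmf:
  fixes M :: "'a set pmf"
  assumes "finite E" "set_pmf M \<subseteq> Pow E"
    and P: "\<And>A. A \<subseteq> E \<Longrightarrow> measure_pmf.prob M {B. B \<subseteq> A} = (1 - p) ^ card (E - A)"
  shows "measure_pmf.expectation M f = Eb p E f"
proof -
  define w where "w A = p ^ card A * (1 - p) ^ card (E - A)" for A
  have pmf: "pmf M A = w A" if "A \<subseteq> E" for A
    using finite_subset[OF that assms(1)] that
  proof (induction A rule: finite_psubset_induct)
    case (psubset A)
    have "(\<Sum>B\<in>Pow A. pmf M B) = measure_pmf.prob M {B. B \<subseteq> A}"
      using psubset.hyps by (subst measure_measure_pmf_finite) (auto simp: Pow_def)
    also have "\<dots> = Eb p E (\<lambda>B. of_bool (B \<subseteq> A))"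
      using P psubset.prems assms(1) by (simp add: Eb_of_bool_subset)
    also have "\<dots> = (\<Sum>B\<in>Pow A. w B)"
      unfolding Eb_def w_def using psubset.prems assms(1)
      by (intro sum.mono_neutral_cong_right) auto
    finally have "(\<Sum>B\<in>Pow A. pmf M B) = (\<Sum>B\<in>Pow A. w B)" .
    moreover have "(\<Sum>B\<in>Pow A - {A}. pmf M B) = (\<Sum>B\<in>Pow A - {A}. w B)"
      using psubset by (intro sum.cong refl psubset.IH) auto
    moreover have "(\<Sum>B\<in>Pow A. pmf M B) = pmf M A + (\<Sum>B\<in>Pow A - {A}. pmf M B)"
      using psubset.hyps by (intro sum.remove) auto
    moreover have "(\<Sum>B\<in>Pow A. w B) = w A + (\<Sum>B\<in>Pow A - {A}. w B)"
      using psubset.hyps by (intro sum.remove) auto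
    ultimately show ?case by linarith
  qed
  have "measure_pmf.expectation M f = (\<Sum>A\<in>Pow E. f A * pmf M A)"
    using assms by (intro integral_measure_pmf_real) auto
  also have "\<dots> = Eb p E f"
    unfolding Eb_def using pmf by (intro sum.cong) (auto simp: w_def)
  finally show ?thesis .
qed

lemma poisson_generating_function:
  assumes "0 < r" "0 \<le> x"
  shows "(\<Sum>k. ennreal (pmf (poisson_pmf r) k) * ennreal x ^ k) = ennreal (exp (r * (x - 1)))"
proof -
  have "(\<lambda>k. exp (- r) * ((r * x) ^ k /\<^sub>R fact k)) sums (exp (- r) * exp (r * x))"
    by (intro sums_mult exp_converges)
  moreover have "exp (- r) * exp (r * x) = exp (r * (x - 1))"
    by (simp add: algebra_simps flip: exp_add)
  moreover have "exp (- r) * ((r * x) ^ k /\<^sub>R fact k) = pmf (poisson_pmf r) k * x ^ k" for k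
    using assms(1) by (simp add: power_mult_distrib divide_inverse)
  ultimately have s: "(\<lambda>k. pmf (poisson_pmf r) k * x ^ k) sums exp (r * (x - 1))"
    by simp
  have "(\<Sum>k. ennreal (pmf (poisson_pmf r) k) * ennreal x ^ k) = (\<Sum>k. ennreal (pmf (poisson_pmf r) k * x ^ k))"
    using assms(2) by (simp add: ennreal_mult' ennreal_power)
  also have "\<dots> = ennreal (exp (r * (x - 1)))"
    using s assms(2) by (subst suminf_ennreal2) (auto simp: sums_iff)
  finally show ?thesis .
qed

text \<open>
  Poissonisation: a Poisson number of independent uniform pairs avoids disjoint sets of pairs
  independently, so the set of sampled pairs is a random subset with independent elements.
\<close>

lemma expectation_random_graph:
  assumes "0 < \<alpha>" "2 \<le> N"
  shows "measure_pmf.expectation (random_graph \<alpha> N) f =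
         Eb (1 - exp (- (2 * \<alpha> / (real N - 1)))) (vertex_pairs N) f"
    and "set_pmf (random_graph \<alpha> N) \<subseteq> Pow (vertex_pairs N)"
proof -
  let ?E = "vertex_pairs N"
  have fin: "finite ?E"
    unfolding vertex_pairs_def by (rule finite_subset[of _ "Pow {1..N}"]) auto
  have cardE: "card ?E = N choose 2"
    unfolding vertex_pairs_def using n_subsets[of "{1..N}" 2] by simp
  have cardE': "real (card ?E) = real N * (real N - 1) / 2"
    using cardE assms(2) by (simp add: choose_two real_of_nat_div of_nat_diff)
  have pos: "0 < real (card ?E)"
    using assms by (simp add: cardE')
  then have ne: "?E \<noteq> {}" by auto
  show sub: "set_pmf (random_graph \<alpha> N) \<subseteq> Pow ?E"
    using fin ne by (auto simp: random_graph_def set_Pi_pmf PiE_dflt_def)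
  show "measure_pmf.expectation (random_graph \<alpha> N) f =
         Eb (1 - exp (- (2 * \<alpha> / (real N - 1)))) ?E f"
  proof (rule Eb_eq_measure_pmf[OF fin sub])
    fix A assume A: "A \<subseteq> ?E"
    define r where "r = \<alpha> * real N"
    have r: "0 < r" using assms by (simp add: r_def)
    define x where "x = real (card A) / real (card ?E)"
    have in1: "measure_pmf.prob (Pi_pmf {1..m} {} (\<lambda>_. pmf_of_set ?E)) {I. I ` {1..m} \<subseteq> A} = x ^ m" for m
    proof -
      have "measure_pmf.prob (Pi_pmf {1..m} {} (\<lambda>_. pmf_of_set ?E)) {I. I ` {1..m} \<subseteq> A} =
            measure_pmf.prob (Pi_pmf {1..m} {} (\<lambda>_. pmf_of_set ?E)) (PiE_dflt {1..m} {} (\<lambda>_. A))"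
        by (intro measure_pmf.finite_measure_eq_AE AE_pmfI) (auto simp: set_Pi_pmf PiE_dflt_def image_subset_iff)
      also have "\<dots> = x ^ m"
        using fin ne A by (subst measure_Pi_pmf_PiE_dflt) (auto simp: measure_pmf_of_set x_def Int_absorb1)
      finally show ?thesis .
    qed
    have "emeasure (random_graph \<alpha> N) {B. B \<subseteq> A} = (\<integral>\<^sup>+ m. ennreal (x ^ m) \<partial>poisson_pmf r)"
      unfolding random_graph_def r_def[symmetric]
      unfolding emeasure_bind_pmf map_pmf_def[symmetric] emeasure_map_pmf
      by (simp add: measure_pmf.emeasure_eq_measure vimage_def in1 del: One_nat_def)
    also have "\<dots> = (\<Sum>m. ennreal (pmf (poisson_pmf r) m) * ennreal x ^ m)"
      by (simp add: nn_integral_measure_pmf nn_integral_count_space_nat ennreal_power x_def)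
    also have "\<dots> = ennreal (exp (r * (x - 1)))"
      using r by (intro poisson_generating_function) (auto simp: x_def)
    finally have "measure_pmf.prob (random_graph \<alpha> N) {B. B \<subseteq> A} = exp (r * (x - 1))"
      by (simp add: measure_def)
    also have "r * (x - 1) = real (card (?E - A)) * - (2 * \<alpha> / (real N - 1))"
    proof -
      have "real (card (?E - A)) = real (card ?E) - real (card A)"
        using A fin by (simp add: card_Diff_subset finite_subset card_mono of_nat_diff)
      then have "x - 1 = - real (card (?E - A)) / real (card ?E)"
        using pos by (simp add: x_def diff_divide_distrib)
      moreover have "a * n * (- d / (n * m / 2)) = d * - (2 * a / m)" if "n \<noteq> 0" for a n d m :: real
        using that by (cases "m = 0") (auto simp: field_simps)
      ultimately show ?thesis
        using assms unfolding cardE' r_def by simp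
    qed
    also have "exp \<dots> = (1 - (1 - exp (- (2 * \<alpha> / (real N - 1))))) ^ card (?E - A)"
      by (simp only: exp_of_nat_mult) simp
    finally show "measure_pmf.prob (random_graph \<alpha> N) {B. B \<subseteq> A} = (1 - (1 - exp (- (2 * \<alpha> / (real N - 1))))) ^ card (?E - A)" .
  qed
qed

section \<open>The single-spin measure\<close>

lemma continuous_powr01: "0 < \<eta> \<Longrightarrow> continuous_on S (\<lambda>x. \<eta> powr x :: real)"
  by (intro continuous_intros) auto

lemma upsilon0_pos:
  assumes "0 < \<eta>"
  shows "0 < upsilon0 \<eta>"
proof -
  have "upsilon0 \<eta> \<noteq> 0"
    unfolding upsilon0_def using assms
    using integral_eq_0_iff[OF continuous_powr01[OF assms, of "{0..1}"]] by force
  moreover have "0 \<le> upsilon0 \<eta>"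
    unfolding upsilon0_def using assms
    by (intro integral_nonneg integrable_continuous_interval continuous_powr01) auto
  ultimately show ?thesis by simp
qed

lemma space_hc_nu [simp]: "space (hc_nu \<eta>) = {0..1}"
  by (simp add: hc_nu_def space_restrict_space)

lemma sets_hc_nu [measurable_cong]: "sets (hc_nu \<eta>) = sets (restrict_space borel {0..1})"
  by (simp add: hc_nu_def sets_restrict_space)

lemma hc_nu_id_measurable [measurable]: "(\<lambda>t. t) \<in> borel_measurable (hc_nu \<eta>)"
  unfolding measurable_cong_sets[OF sets_hc_nu refl] by (rule measurable_restrict_space1) simp

lemma borel_measurable_hc_nu:
  "g \<in> borel_measurable borel \<Longrightarrow> g \<in> borel_measurable (hc_nu \<eta>)"
  by (rule measurable_compose[OF hc_nu_id_measurable])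

lemma prob_space_hc_nu:
  assumes "0 < \<eta>"
  shows "prob_space (hc_nu \<eta>)"
proof
  let ?f = "\<lambda>x. indicator {0..1} x * (\<eta> powr x / upsilon0 \<eta>) :: real"
  have pos: "0 < upsilon0 \<eta>"
    using assms by (rule upsilon0_pos)
  have [measurable]: "(\<lambda>x. \<eta> powr x) \<in> borel_measurable borel"
    using continuous_powr01[OF assms] by (rule borel_measurable_continuous_onI)
  have "emeasure (hc_nu \<eta>) (space (hc_nu \<eta>)) =
      (\<integral>\<^sup>+ x. ennreal (\<eta> powr x / upsilon0 \<eta>) \<partial>restrict_space lborel {0..1})"
    unfolding space_hc_nu unfolding hc_nu_def
    by (subst emeasure_density)
       (auto intro!: nn_integral_cong measurable_restrict_space1 simp: space_restrict_space sets_restrict_space indicator_def)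
  also have "\<dots> = (\<integral>\<^sup>+ x. ennreal (?f x) \<partial>lborel)"
    by (subst nn_integral_restrict_space) (auto intro!: nn_integral_cong simp: indicator_def)
  also have "\<dots> = ennreal 1"
  proof (rule nn_integral_has_integral_lborel)
    have "((\<lambda>x. \<eta> powr x) has_integral upsilon0 \<eta>) {0..1}"
      unfolding upsilon0_def using continuous_powr01[OF assms]
      by (intro integrable_integral integrable_continuous_interval)
    then have "((\<lambda>x. \<eta> powr x / upsilon0 \<eta>) has_integral 1) {0..1}"
      using has_integral_divide[of "\<lambda>x. \<eta> powr x" "upsilon0 \<eta>" "{0..1}" "upsilon0 \<eta>"] pos by simp
    then have "((\<lambda>x. if x \<in> {0..1} then \<eta> powr x / upsilon0 \<eta> else 0) has_integral 1) UNIV"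
      by (simp only: has_integral_restrict_UNIV)
    moreover have "?f = (\<lambda>x. if x \<in> {0..1} then \<eta> powr x / upsilon0 \<eta> else 0)"
      by (auto simp: indicator_def fun_eq_iff)
    ultimately show "(?f has_integral 1) UNIV"
      by simp
  qed (use pos in auto)
  finally show "emeasure (hc_nu \<eta>) (space (hc_nu \<eta>)) = 1" by simp
qed

lemma hc_nu_integral:
  assumes "0 < \<eta>" "continuous_on {0..1} g" "0 \<le> x" "x \<le> 1"
  shows "(\<integral>t. indicator {..x} t * g t \<partial>hc_nu \<eta>) = integral {0..x} (\<lambda>t. \<eta> powr t * g t) / upsilon0 \<eta>"
proof -
  have pos: "0 < upsilon0 \<eta>"
    using assms(1) by (rule upsilon0_pos)
  have [measurable]: "(\<lambda>x. \<eta> powr x) \<in> borel_measurable borel"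
    using continuous_powr01[OF assms(1)] by (rule borel_measurable_continuous_onI)
  have [measurable]: "g \<in> borel_measurable (restrict_space borel {0..1})"
    using assms(2) by (rule borel_measurable_continuous_on_restrict)
  have m1: "(\<lambda>x. \<eta> powr x / upsilon0 \<eta>) \<in> borel_measurable (restrict_space lborel {0..1})"
    by (intro measurable_restrict_space1) simp
  have "g \<in> borel_measurable (restrict_space lborel {0..1})"
    by (subst measurable_cong_sets[where M' = "restrict_space borel {0..1}" and N' = borel])
       (auto simp: sets_restrict_space)
  moreover have "(indicator {..x} :: real \<Rightarrow> real) \<in> borel_measurable (restrict_space lborel {0..1})"
    by (intro measurable_restrict_space1) simp
  ultimately have m2: "(\<lambda>t. indicator {..x} t * g t) \<in> borel_measurable (restrict_space lborel {0..1})"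
    by (intro borel_measurable_times)
  have "(\<integral>t. indicator {..x} t * g t \<partial>hc_nu \<eta>) =
      (\<integral>t. (\<eta> powr t / upsilon0 \<eta>) *\<^sub>R (indicator {..x} t * g t) \<partial>restrict_space lborel {0..1})"
    unfolding hc_nu_def using m1 m2 pos by (intro integral_density) auto
  also have "\<dots> = (\<integral>t. indicator {0..1} t *\<^sub>R ((\<eta> powr t / upsilon0 \<eta>) *\<^sub>R (indicator {..x} t * g t)) \<partial>lborel)"
    by (subst integral_restrict_space) (auto simp: set_lebesgue_integral_def)
  also have "\<dots> = (\<integral>t. (indicator {0..x} t *\<^sub>R (\<eta> powr t * g t)) / upsilon0 \<eta> \<partial>lborel)"
    using assms by (intro Bochner_Integration.integral_cong refl) (auto simp: indicator_def)
  also have "\<dots> = (LINT t:{0..x}|lborel. \<eta> powr t * g t) / upsilon0 \<eta>"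
    by (simp add: set_lebesgue_integral_def)
  also have "(LINT t:{0..x}|lborel. \<eta> powr t * g t) = integral {0..x} (\<lambda>t. \<eta> powr t * g t)"
    using assms continuous_powr01[OF assms(1)] unfolding set_lebesgue_integral_def
    by (intro set_borel_integral_eq_integral(2)[unfolded set_lebesgue_integral_def] borel_integrable_atLeastAtMost'
        continuous_on_mult continuous_on_subset[OF assms(2)]) auto
  finally show ?thesis .
qed

text \<open>
  Conditioning on small values can only increase the mean of a decreasing function.
\<close>

lemma hc_nu_chebyshev:
  assumes "0 < \<eta>" "h \<in> borel_measurable (hc_nu \<eta>)" "\<And>s t. 0 \<le> s \<Longrightarrow> s \<le> t \<Longrightarrow> t \<le> 1 \<Longrightarrow> h t \<le> h s"
    and "0 \<le> a" "a \<le> 1"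
  shows "measure (hc_nu \<eta>) {0..a} * (\<integral>t. h t \<partial>hc_nu \<eta>) \<le> (\<integral>t. indicator {..a} t * h t \<partial>hc_nu \<eta>)"
proof -
  interpret prob_space "hc_nu \<eta>" using assms(1) by (rule prob_space_hc_nu)
  define B where "B = max \<bar>h 0\<bar> \<bar>h 1\<bar>"
  have bd: "\<bar>h t\<bar> \<le> B" if "t \<in> {0..1}" for t
    using assms(3)[of 0 t] assms(3)[of t 1] that unfolding B_def by auto
  have B0: "0 \<le> B"
    by (simp add: B_def le_max_iff_disj)
  have int: "integrable (hc_nu \<eta>) h"
    using assms(2) bd by (intro integrable_const_bound[where B = B]) auto
  have [measurable]: "{..a} \<inter> {0..1} \<in> sets (hc_nu \<eta>)"
    by (auto simp: sets_hc_nu sets_restrict_space)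
  have ind: "(indicator {..a} :: real \<Rightarrow> real) \<in> borel_measurable (hc_nu \<eta>)"
    by (rule borel_measurable_hc_nu) simp
  have int2: "integrable (hc_nu \<eta>) (\<lambda>t. indicator {..a} t * h t)"
    using assms(2) bd ind B0 by (intro integrable_const_bound[where B = B]) (auto simp: indicator_def)
  have intind: "integrable (hc_nu \<eta>) (indicator {..a} :: real \<Rightarrow> real)"
    using ind by (intro integrable_const_bound[where B = 1]) (auto simp: indicator_def)
  have eqm: "(\<integral>t. indicator {..a} t \<partial>hc_nu \<eta>) = measure (hc_nu \<eta>) {0..a}"
  proof -
    have "(\<integral>t. indicator {..a} t \<partial>hc_nu \<eta>) = (\<integral>t. indicator ({0..a}) t \<partial>hc_nu \<eta> :: real)"
      using assms by (intro Bochner_Integration.integral_cong refl) (auto simp: indicator_def)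
    also have "\<dots> = measure (hc_nu \<eta>) {0..a}"
      using assms by (simp add: Int_absorb2)
    finally show ?thesis .
  qed
  define c where "c = measure (hc_nu \<eta>) {0..a}"
  have c: "0 \<le> c" "c \<le> 1" by (auto simp: c_def)
  \<comment> \<open>both sides of the cut are compared with the value at the cut\<close>
  have "0 \<le> (\<integral>t. (indicator {..a} t - c) * (h t - h a) \<partial>hc_nu \<eta>)"
  proof (intro integral_nonneg_AE AE_I2)
    fix t assume "t \<in> space (hc_nu \<eta>)"
    then show "0 \<le> (indicator {..a} t - c) * (h t - h a)"
      using assms(3)[of t a] assms(3)[of a t] assms(4,5) c
      by (auto simp: indicator_def mult_nonneg_nonneg mult_nonneg_nonpos mult_nonpos_nonpos)
  qed
  also have "(\<integral>t. (indicator {..a} t - c) * (h t - h a) \<partial>hc_nu \<eta>) =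
      (\<integral>t. (indicator {..a} t * h t - c * h t) - (h a * indicator {..a} t - c * h a) \<partial>hc_nu \<eta>)"
    by (intro Bochner_Integration.integral_cong refl) (simp add: algebra_simps)
  also have "\<dots> = ((\<integral>t. indicator {..a} t * h t \<partial>hc_nu \<eta>) - c * (\<integral>t. h t \<partial>hc_nu \<eta>)) - (h a * c - c * h a)"
    using int int2 intind eqm by (simp add: c_def prob_space[simplified])
  finally show ?thesis by (simp add: c_def)
qed

section \<open>The volume below a profile\<close>

text \<open>
  The volume of the configurations that respect the edges of \<open>G\<close> and lie below the profile \<open>x\<close>. As a
  function of \<open>x\<close> it is the unnormalised joint distribution function of the spins; an edge to a new
  vertex with spin \<open>t\<close> just cuts the profile at \<open>1 - t\<close>, so this family is closed under integrating
  out a vertex.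
\<close>

definition hc_vol :: "real \<Rightarrow> 'v set \<Rightarrow> 'v set set \<Rightarrow> ('v \<Rightarrow> real) \<Rightarrow> real" where
  "hc_vol \<eta> V G x = measure (\<Pi>\<^sub>M u\<in>V. hc_nu \<eta>)
     {\<sigma> \<in> V \<rightarrow>\<^sub>E {0..1}. (\<forall>u\<in>V. \<forall>w\<in>V. {u, w} \<in> G \<longrightarrow> \<sigma> u + \<sigma> w \<le> 1) \<and> (\<forall>u\<in>V. \<sigma> u \<le> x u)}"

definition star :: "'v \<Rightarrow> 'v set \<Rightarrow> 'v set set" where
  "star v S = (\<lambda>u. {v, u}) ` S"

lemma prob_space_PiM_hc_nu: "0 < \<eta> \<Longrightarrow> prob_space (\<Pi>\<^sub>M u\<in>V. hc_nu \<eta>)"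
  by (intro prob_space_PiM prob_space_hc_nu)

lemma hc_vol_sets:
  assumes "finite V"
  shows "{\<sigma> \<in> V \<rightarrow>\<^sub>E {0..1}. (\<forall>u\<in>V. \<forall>w\<in>V. {u, w} \<in> G \<longrightarrow> \<sigma> u + \<sigma> w \<le> 1) \<and> (\<forall>u\<in>V. \<sigma> u \<le> x u)}
     \<in> sets (\<Pi>\<^sub>M u\<in>V. hc_nu \<eta>)"
proof -
  have [measurable]: "(\<lambda>\<sigma>. \<sigma> u) \<in> borel_measurable (\<Pi>\<^sub>M u\<in>V. hc_nu \<eta>)" if "u \<in> V" for u
    by (rule measurable_compose[OF measurable_component_singleton[OF that] hc_nu_id_measurable])
  have eq: "{\<sigma> \<in> V \<rightarrow>\<^sub>E {0..1}. (\<forall>u\<in>V. \<forall>w\<in>V. {u, w} \<in> G \<longrightarrow> \<sigma> u + \<sigma> w \<le> 1) \<and> (\<forall>u\<in>V. \<sigma> u \<le> x u)}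
    = {\<sigma> \<in> space (\<Pi>\<^sub>M u\<in>V. hc_nu \<eta>). (\<forall>u\<in>V. \<forall>w\<in>V. {u, w} \<in> G \<longrightarrow> \<sigma> u + \<sigma> w \<le> 1) \<and> (\<forall>u\<in>V. \<sigma> u \<le> x u)}"
    by (simp add: space_PiM)
  show ?thesis
    unfolding eq using assms
    by (intro sets.sets_Collect_conj sets.sets_Collect_finite_All sets.sets_Collect_imp) auto
qed

lemma hc_vol_nonneg [simp]: "0 \<le> hc_vol \<eta> V G x"
  by (simp add: hc_vol_def)

lemma hc_vol_le_1: "0 < \<eta> \<Longrightarrow> hc_vol \<eta> V G x \<le> 1"
  unfolding hc_vol_def by (intro prob_space.prob_le_1 prob_space_PiM_hc_nu)

lemma hc_vol_mono:
  assumes "0 < \<eta>" "finite V" "\<And>u. u \<in> V \<Longrightarrow> x u \<le> y u"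
  shows "hc_vol \<eta> V G x \<le> hc_vol \<eta> V G y"
proof -
  interpret prob_space "\<Pi>\<^sub>M u\<in>V. hc_nu \<eta>" by (rule prob_space_PiM_hc_nu[OF assms(1)])
  show ?thesis unfolding hc_vol_def
    using assms hc_vol_sets[OF assms(2)] by (intro finite_measure_mono) (auto intro: order_trans)
qed

lemma hc_vol_cong:
  assumes "\<And>u. u \<in> V \<Longrightarrow> x u = y u"
  shows "hc_vol \<eta> V G x = hc_vol \<eta> V G y"
  unfolding hc_vol_def using assms by (intro arg_cong[where f = "measure _"]) auto

lemma hc_vol_antimono_measurable:
  assumes "0 < \<eta>" "finite V" "\<And>s t u. u \<in> V \<Longrightarrow> s \<le> t \<Longrightarrow> y t u \<le> y s u"
  shows "(\<lambda>t::real. hc_vol \<eta> V G (y t)) \<in> borel_measurable borel"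
proof -
  have "mono (\<lambda>t. - hc_vol \<eta> V G (y t))"
    using assms by (intro monoI) (auto intro!: hc_vol_mono)
  from borel_measurable_uminus[OF borel_measurable_mono[OF this]] show ?thesis by simp
qed

lemma hc_vol_empty [simp]: "hc_vol \<eta> {} G x = 1"
  by (simp add: hc_vol_def PiM_empty measure_def)

text \<open>
  Fubini's theorem, with the new spin as the outer variable.
\<close>

lemma hc_vol_insert:
  assumes "0 < \<eta>" "finite V" "v \<notin> V" "G \<subseteq> Pow V" "S \<subseteq> V"
  shows "hc_vol \<eta> (insert v V) (G \<union> star v S) x =
    (\<integral>t. indicator {..x v} t * hc_vol \<eta> V G (\<lambda>u. if u \<in> S then min (x u) (1 - t) else x u) \<partial>hc_nu \<eta>)"
proof -
  interpret product_sigma_finite "\<lambda>_. hc_nu \<eta>"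
    using prob_space_hc_nu[OF assms(1)] by (simp add: product_sigma_finite_def prob_space_imp_sigma_finite)
  interpret nu: prob_space "hc_nu \<eta>" using assms(1) by (rule prob_space_hc_nu)
  interpret PV: prob_space "\<Pi>\<^sub>M u\<in>V. hc_nu \<eta>" by (rule prob_space_PiM_hc_nu[OF assms(1)])
  interpret PI: prob_space "\<Pi>\<^sub>M u\<in>insert v V. hc_nu \<eta>" by (rule prob_space_PiM_hc_nu[OF assms(1)])
  let ?y = "\<lambda>t u. if u \<in> S then min (x u) (1 - t) else x u"
  define A where "A = {\<sigma> \<in> insert v V \<rightarrow>\<^sub>E {0..1}. (\<forall>u\<in>insert v V. \<forall>w\<in>insert v V. {u, w} \<in> G \<union> star v S \<longrightarrow> \<sigma> u + \<sigma> w \<le> 1)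
    \<and> (\<forall>u\<in>insert v V. \<sigma> u \<le> x u)}"
  define B where "B t = {\<sigma> \<in> V \<rightarrow>\<^sub>E {0..1}. (\<forall>u\<in>V. \<forall>w\<in>V. {u, w} \<in> G \<longrightarrow> \<sigma> u + \<sigma> w \<le> 1) \<and> (\<forall>u\<in>V. \<sigma> u \<le> ?y t u)}" for t
  have A: "A \<in> sets (\<Pi>\<^sub>M u\<in>insert v V. hc_nu \<eta>)"
    unfolding A_def using assms(2) by (intro hc_vol_sets) simp
  have B: "B t \<in> sets (\<Pi>\<^sub>M u\<in>V. hc_nu \<eta>)" for t
    unfolding B_def using assms(2) by (intro hc_vol_sets)
  have e1: "{u, w} \<in> G \<union> star v S \<longleftrightarrow> {u, w} \<in> G" if "u \<in> V" "w \<in> V" for u w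
    using that assms by (auto simp: star_def doubleton_eq_iff)
  have e2: "{v, w} \<in> G \<union> star v S \<longleftrightarrow> w \<in> S" "{w, v} \<in> G \<union> star v S \<longleftrightarrow> w \<in> S" if "w \<in> V" for w
    using that assms by (auto simp: star_def doubleton_eq_iff)
  have e3: "{v, v} \<notin> G \<union> star v S"
    using assms by (auto simp: star_def doubleton_eq_iff)
  have key: "\<sigma>(v := t) \<in> A \<longleftrightarrow> t \<le> x v \<and> \<sigma> \<in> B t" if "t \<in> {0..1}" "\<sigma> \<in> V \<rightarrow>\<^sub>E {0..1}" for t \<sigma>
  proof -
    have f1: "\<sigma>(v := t) \<in> insert v V \<rightarrow>\<^sub>E {0..1}"
      using that by (auto simp: PiE_def extensional_def)
    have f2: "(\<forall>u\<in>insert v V. (\<sigma>(v := t)) u \<le> x u) \<longleftrightarrow> t \<le> x v \<and> (\<forall>u\<in>V. \<sigma> u \<le> x u)"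
      using assms(3) by auto
    have f3: "(\<forall>u\<in>insert v V. \<forall>w\<in>insert v V. {u, w} \<in> G \<union> star v S \<longrightarrow> (\<sigma>(v := t)) u + (\<sigma>(v := t)) w \<le> 1)
      \<longleftrightarrow> (\<forall>u\<in>V. \<forall>w\<in>V. {u, w} \<in> G \<longrightarrow> \<sigma> u + \<sigma> w \<le> 1) \<and> (\<forall>u\<in>S. \<sigma> u + t \<le> 1)" (is "?l \<longleftrightarrow> ?r")
    proof
      assume l: ?l
      show ?r
      proof (intro conjI ballI impI)
        fix u w assume "u \<in> V" "w \<in> V" "{u, w} \<in> G"
        then show "\<sigma> u + \<sigma> w \<le> 1"
          using l[rule_format, of u w] assms(3) by (auto split: if_splits)
      next
        fix u assume "u \<in> S"
        then show "\<sigma> u + t \<le> 1"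
          using l[rule_format, of u v] assms(3,5) e2[of u] by (auto split: if_splits)
      qed
    next
      assume r: ?r
      show ?l
      proof (intro ballI impI)
        fix u w assume uw: "u \<in> insert v V" "w \<in> insert v V" "{u, w} \<in> G \<union> star v S"
        consider "u \<in> V" "w \<in> V" | "u = v" "w \<in> V" | "u \<in> V" "w = v" | "u = v" "w = v"
          using uw by auto
        then show "(\<sigma>(v := t)) u + (\<sigma>(v := t)) w \<le> 1"
        proof cases
          case 1
          then show ?thesis using r uw(3) e1[of u w] assms(3) by auto
        next
          case 2
          then show ?thesis using r uw(3) e2(1)[of w] assms(3) by (auto simp: add.commute)
        next
          case 3
          then show ?thesis using r uw(3) e2(2)[of u] assms(3) by auto
        next
          case 4
          then show ?thesis using uw(3) e3 by simp
        qed
      qed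
    qed
    have f4: "(\<forall>u\<in>V. \<sigma> u \<le> ?y t u) \<longleftrightarrow> (\<forall>u\<in>V. \<sigma> u \<le> x u) \<and> (\<forall>u\<in>S. \<sigma> u + t \<le> 1)"
      using assms(5) by (auto simp: le_diff_eq)
    show ?thesis
      unfolding A_def B_def mem_Collect_eq f2 f3 f4 using f1 that(2) by blast
  qed
  have meas: "(\<lambda>t. indicator {..x v} t * hc_vol \<eta> V G (?y t)) \<in> borel_measurable (hc_nu \<eta>)"
    by (intro borel_measurable_hc_nu borel_measurable_times hc_vol_antimono_measurable assms) auto
  have "ennreal (hc_vol \<eta> (insert v V) (G \<union> star v S) x) = emeasure (\<Pi>\<^sub>M u\<in>insert v V. hc_nu \<eta>) A"
    unfolding hc_vol_def A_def[symmetric] by (simp add: PI.emeasure_eq_measure)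
  also have "\<dots> = (\<integral>\<^sup>+\<sigma>. indicator A \<sigma> \<partial>(\<Pi>\<^sub>M u\<in>insert v V. hc_nu \<eta>))"
    using A by simp
  also have "\<dots> = (\<integral>\<^sup>+t. \<integral>\<^sup>+\<sigma>. indicator A (\<sigma>(v := t)) \<partial>(\<Pi>\<^sub>M u\<in>V. hc_nu \<eta>) \<partial>hc_nu \<eta>)"
    using A assms by (intro product_nn_integral_insert_rev) auto
  also have "\<dots> = (\<integral>\<^sup>+t. ennreal (indicator {..x v} t * hc_vol \<eta> V G (?y t)) \<partial>hc_nu \<eta>)"
  proof (intro nn_integral_cong)
    fix t assume t: "t \<in> space (hc_nu \<eta>)"
    have "(\<integral>\<^sup>+\<sigma>. indicator A (\<sigma>(v := t)) \<partial>(\<Pi>\<^sub>M u\<in>V. hc_nu \<eta>)) =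
        (\<integral>\<^sup>+\<sigma>. indicator {..x v} t * indicator (B t) \<sigma> \<partial>(\<Pi>\<^sub>M u\<in>V. hc_nu \<eta>))"
      using key t by (intro nn_integral_cong) (auto simp: space_PiM indicator_def)
    also have "\<dots> = indicator {..x v} t * emeasure (\<Pi>\<^sub>M u\<in>V. hc_nu \<eta>) (B t)"
      using B by (subst nn_integral_cmult) auto
    also have "\<dots> = ennreal (indicator {..x v} t * hc_vol \<eta> V G (?y t))"
      unfolding hc_vol_def B_def[symmetric] by (simp add: PV.emeasure_eq_measure indicator_def)
    finally show "(\<integral>\<^sup>+\<sigma>. indicator A (\<sigma>(v := t)) \<partial>(\<Pi>\<^sub>M u\<in>V. hc_nu \<eta>)) =
      ennreal (indicator {..x v} t * hc_vol \<eta> V G (?y t))" .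
  qed
  also have "\<dots> = ennreal (\<integral>t. indicator {..x v} t * hc_vol \<eta> V G (?y t) \<partial>hc_nu \<eta>)"
    using meas hc_vol_le_1[OF assms(1)]
    by (intro nn_integral_eq_integral nu.integrable_const_bound[where B = 1]) (auto simp: indicator_def)
  finally show ?thesis
    by (subst (asm) ennreal_inj) (auto intro!: integral_nonneg_AE)
qed

section \<open>Graphs and relabelling\<close>

definition pairs :: "'v set \<Rightarrow> 'v set set" where
  "pairs V = {e. e \<subseteq> V \<and> card e = 2}"

lemma finite_pairs: "finite V \<Longrightarrow> finite (pairs V)"
  unfolding pairs_def by (rule finite_subset[of _ "Pow V"]) auto

lemma card_pairs: "finite V \<Longrightarrow> card (pairs V) = card V choose 2"
  unfolding pairs_def using n_subsets[of V 2] by simp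

lemma pairs_subset_Pow: "G \<subseteq> pairs V \<Longrightarrow> G \<subseteq> Pow V"
  by (auto simp: pairs_def)

lemma pairs_empty [simp]: "pairs {} = {}"
  by (auto simp: pairs_def)

lemma doubleton_in_pairs: "{u, w} \<in> pairs V \<longleftrightarrow> u \<in> V \<and> w \<in> V \<and> u \<noteq> w"
  by (auto simp: pairs_def card_2_iff doubleton_eq_iff)

lemma pairs_insert:
  assumes "v \<notin> V"
  shows "pairs (insert v V) = pairs V \<union> star v V" "pairs V \<inter> star v V = {}"
proof -
  show "pairs (insert v V) = pairs V \<union> star v V"
  proof (intro equalityI subsetI)
    fix e assume e: "e \<in> pairs (insert v V)"
    then obtain a b where ab: "e = {a, b}" "a \<noteq> b"
      by (auto simp: pairs_def card_2_iff)
    then have "a \<in> insert v V" "b \<in> insert v V"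
      using e by (auto simp: pairs_def)
    then show "e \<in> pairs V \<union> star v V"
      using ab by (auto simp: star_def doubleton_in_pairs insert_commute)
  next
    fix e assume "e \<in> pairs V \<union> star v V"
    then show "e \<in> pairs (insert v V)"
      using assms by (auto simp: star_def doubleton_in_pairs) (auto simp: pairs_def)
  qed
  show "pairs V \<inter> star v V = {}"
    using assms by (auto simp: pairs_def star_def)
qed

lemma inj_on_star: "inj_on (\<lambda>u. {v, u}) V"
  by (auto simp: inj_on_def doubleton_eq_iff)

lemma star_insert: "star v (insert u S) = insert {v, u} (star v S)"
  by (simp add: star_def)

lemma pairs_insertE:
  assumes "v \<notin> V" "G \<subseteq> pairs (insert v V)"
  obtains G' S where "G' \<subseteq> pairs V" "S \<subseteq> V" "G = G' \<union> star v S"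
proof
  show "G \<inter> pairs V \<subseteq> pairs V" "{u \<in> V. {v, u} \<in> G} \<subseteq> V" by auto
  show "G = G \<inter> pairs V \<union> star v {u \<in> V. {v, u} \<in> G}"
    using assms pairs_insert(1)[OF assms(1)] by (auto simp: star_def)
qed

lemma Eb_pairs_insert:
  assumes "finite V" "v \<notin> V"
  shows "Eb p (pairs (insert v V)) f = Eb p (pairs V) (\<lambda>G. Eb p V (\<lambda>S. f (G \<union> star v S)))"
proof -
  have "Eb p (pairs (insert v V)) f = Eb p (pairs V) (\<lambda>G. Eb p (star v V) (\<lambda>B. f (G \<union> B)))"
    unfolding pairs_insert(1)[OF assms(2)] using assms pairs_insert(2)[OF assms(2)]
    by (intro Eb_Un) (auto simp: finite_pairs star_def)
  also have "\<dots> = Eb p (pairs V) (\<lambda>G. Eb p V (\<lambda>S. f (G \<union> star v S)))"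
    unfolding star_def using assms by (subst Eb_image) (auto simp: inj_on_star)
  finally show ?thesis .
qed

lemma pairs_image:
  assumes "inj_on \<pi> V"
  shows "pairs (\<pi> ` V) = (`) \<pi> ` pairs V"
proof (intro equalityI subsetI)
  fix e assume e: "e \<in> pairs (\<pi> ` V)"
  then obtain e' where e': "e' \<subseteq> V" "e = \<pi> ` e'"
    by (auto simp: pairs_def subset_image_iff)
  then have "card e' = 2"
    using e assms by (auto simp: pairs_def card_image inj_on_subset)
  then show "e \<in> (`) \<pi> ` pairs V"
    using e' by (auto simp: pairs_def)
next
  fix e assume "e \<in> (`) \<pi> ` pairs V"
  then show "e \<in> pairs (\<pi> ` V)"
    using assms by (auto simp: pairs_def card_image inj_on_subset)
qed

lemma Eb_pairs_image:
  assumes "finite V" "inj_on \<pi> V"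
  shows "Eb p (pairs (\<pi> ` V)) f = Eb p (pairs V) (\<lambda>G. f ((`) \<pi> ` G))"
proof -
  have "inj_on ((`) \<pi>) (pairs V)"
    using assms(2) by (auto simp: inj_on_def pairs_def) (metis inj_on_image_eq_iff inj_onI)+
  then show ?thesis
    unfolding pairs_image[OF assms(2)] using assms by (intro Eb_image finite_pairs)
qed

lemma star_image: "(`) \<pi> ` star v S = star (\<pi> v) (\<pi> ` S)"
  by (auto simp: star_def image_image)

text \<open>
  The volume depends on the labels only through the graph structure, by induction on the vertex set
  with the recursion for an additional vertex.
\<close>

lemma hc_vol_image:
  assumes "0 < \<eta>" "finite V" "inj_on \<pi> V" "G \<subseteq> pairs V"
  shows "hc_vol \<eta> (\<pi> ` V) ((`) \<pi> ` G) x = hc_vol \<eta> V G (\<lambda>u. x (\<pi> u))"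
  using assms(2-)
proof (induction V arbitrary: G x rule: finite_induct)
  case (insert v V)
  obtain G' S where G: "G' \<subseteq> pairs V" "S \<subseteq> V" "G = G' \<union> star v S"
    using pairs_insertE[OF insert.hyps(2) insert.prems(2)] .
  have inj: "inj_on \<pi> V" "\<pi> v \<notin> \<pi> ` V"
    using insert by auto
  have im: "\<pi> u \<in> \<pi> ` S \<longleftrightarrow> u \<in> S" if "u \<in> V" for u
    using that G(2) inj(1) by (auto simp: inj_on_def)
  have "(`) \<pi> ` G' \<subseteq> pairs (\<pi> ` V)"
    unfolding pairs_image[OF inj(1)] using G(1) by auto
  then have "hc_vol \<eta> (insert (\<pi> v) (\<pi> ` V)) ((`) \<pi> ` G' \<union> star (\<pi> v) (\<pi> ` S)) x =
     (\<integral>t. indicator {..x (\<pi> v)} t * hc_vol \<eta> (\<pi> ` V) ((`) \<pi> ` G') (\<lambda>u. if u \<in> \<pi> ` S then min (x u) (1 - t) else x u) \<partial>hc_nu \<eta>)"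
    using insert.hyps inj G(2) assms(1) by (intro hc_vol_insert pairs_subset_Pow) auto
  also have "\<dots> = (\<integral>t. indicator {..x (\<pi> v)} t * hc_vol \<eta> V G' (\<lambda>u. if u \<in> S then min (x (\<pi> u)) (1 - t) else x (\<pi> u)) \<partial>hc_nu \<eta>)"
    unfolding insert.IH[OF inj(1) G(1)] using im
    by (intro Bochner_Integration.integral_cong refl arg_cong[where f = "(*) _"] hc_vol_cong) auto
  also have "\<dots> = hc_vol \<eta> (insert v V) G (\<lambda>u. x (\<pi> u))"
    unfolding G(3) using insert.hyps G assms(1)
    by (intro hc_vol_insert[symmetric] pairs_subset_Pow) auto
  finally show ?case
    by (simp only: G(3) image_Un star_image image_insert)
qed simp

section \<open>The cost of vertices and edges\<close>

definition hc_half :: "real \<Rightarrow> real" where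
  "hc_half \<eta> = measure (hc_nu \<eta>) {0..1/2}"

lemma hc_half_pos:
  assumes "0 < \<eta>"
  shows "0 < hc_half \<eta>"
proof -
  interpret prob_space "hc_nu \<eta>" using assms by (rule prob_space_hc_nu)
  have "{0..1/2} \<inter> {0..1} = {0..1/2::real}" by auto
  then have "hc_half \<eta> = (\<integral>t. indicator {0..1/2} t \<partial>hc_nu \<eta>)"
    by (simp add: hc_half_def)
  also have "\<dots> = (\<integral>t. indicator {..1/2} t * (1::real) \<partial>hc_nu \<eta>)"
    by (intro Bochner_Integration.integral_cong refl) (auto simp: indicator_def)
  also have "\<dots> = integral {0..1/2} (\<lambda>t. \<eta> powr t * 1) / upsilon0 \<eta>"
    using assms by (intro hc_nu_integral) auto
  finally have eq: "hc_half \<eta> = integral {0..1/2} (\<lambda>t. \<eta> powr t) / upsilon0 \<eta>" by simp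
  have "integral {0..1/2} (\<lambda>t. \<eta> powr t) \<noteq> 0"
    using integral_eq_0_iff[OF continuous_powr01[OF assms, of "{0..1/2}"]] assms by force
  moreover have "0 \<le> hc_half \<eta>" by (simp add: hc_half_def)
  ultimately show ?thesis
    using eq upsilon0_pos[OF assms] by (simp add: order_less_le)
qed

lemma hc_half_le_1: "0 < \<eta> \<Longrightarrow> hc_half \<eta> \<le> 1"
  unfolding hc_half_def by (rule prob_space.prob_le_1[OF prob_space_hc_nu])

text \<open>
  Given the other spins, the spin at \<open>u\<close> has law \<open>\<nu>\<close> conditioned to lie below some level, so it is at
  most \<open>1/2\<close> with probability at least \<open>hc_half\<close>. The bounds on logarithms of volumes rest on this.
\<close>

lemma hc_vol_half:
  assumes "0 < \<eta>" "finite V" "u \<in> V" "G \<subseteq> pairs V"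
  shows "hc_half \<eta> * hc_vol \<eta> V G x \<le> hc_vol \<eta> V G (x(u := min (x u) (1/2)))"
proof -
  define V' where "V' = V - {u}"
  have V: "V = insert u V'" "u \<notin> V'" "finite V'"
    using assms by (auto simp: V'_def)
  obtain G' S where G: "G' \<subseteq> pairs V'" "S \<subseteq> V'" "G = G' \<union> star u S"
    using pairs_insertE[OF V(2)] assms(4) V(1) by metis
  define h where "h t = indicator {..x u} t * hc_vol \<eta> V' G' (\<lambda>w. if w \<in> S then min (x w) (1 - t) else x w)" for t :: real
  have "h \<in> borel_measurable borel"
    unfolding h_def[abs_def] by (intro borel_measurable_times hc_vol_antimono_measurable assms V) auto
  then have m: "h \<in> borel_measurable (hc_nu \<eta>)"
    by (rule borel_measurable_hc_nu)
  have "hc_half \<eta> * hc_vol \<eta> V G x = hc_half \<eta> * (\<integral>t. h t \<partial>hc_nu \<eta>)"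
    unfolding G(3) V(1) h_def using assms V G by (subst hc_vol_insert) (auto dest: pairs_subset_Pow)
  also have "\<dots> \<le> (\<integral>t. indicator {..1/2} t * h t \<partial>hc_nu \<eta>)"
    unfolding hc_half_def
  proof (rule hc_nu_chebyshev[OF assms(1) m])
    fix s t :: real assume "s \<le> t"
    then have "hc_vol \<eta> V' G' (\<lambda>w. if w \<in> S then min (x w) (1 - t) else x w) \<le>
        hc_vol \<eta> V' G' (\<lambda>w. if w \<in> S then min (x w) (1 - s) else x w)"
      using assms V by (intro hc_vol_mono) auto
    then show "h t \<le> h s"
      using \<open>s \<le> t\<close> by (auto simp: h_def indicator_def)
  qed auto
  also have "\<dots> = (\<integral>t. indicator {..(x(u := min (x u) (1/2))) u} t * hc_vol \<eta> V' G'
        (\<lambda>w. if w \<in> S then min ((x(u := min (x u) (1/2))) w) (1 - t) else (x(u := min (x u) (1/2))) w) \<partial>hc_nu \<eta>)"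
  proof (intro Bochner_Integration.integral_cong refl)
    fix t
    have "hc_vol \<eta> V' G' (\<lambda>w. if w \<in> S then min ((x(u := min (x u) (1/2))) w) (1 - t) else (x(u := min (x u) (1/2))) w) =
      hc_vol \<eta> V' G' (\<lambda>w. if w \<in> S then min (x w) (1 - t) else x w)"
      using V(2) by (intro hc_vol_cong) auto
    then show "indicator {..1/2} t * h t = indicator {..(x(u := min (x u) (1/2))) u} t * hc_vol \<eta> V' G'
        (\<lambda>w. if w \<in> S then min ((x(u := min (x u) (1/2))) w) (1 - t) else (x(u := min (x u) (1/2))) w)"
      by (auto simp: h_def indicator_def)
  qed
  also have "\<dots> = hc_vol \<eta> V G (x(u := min (x u) (1/2)))"
    unfolding G(3) V(1) using assms V G by (intro hc_vol_insert[symmetric]) (auto dest: pairs_subset_Pow)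
  finally show ?thesis .
qed

lemma hc_vol_half_set:
  assumes "0 < \<eta>" "finite V" "S \<subseteq> V" "G \<subseteq> pairs V"
  shows "hc_half \<eta> ^ card S * hc_vol \<eta> V G x \<le> hc_vol \<eta> V G (\<lambda>u. if u \<in> S then min (x u) (1/2) else x u)"
  using finite_subset[OF assms(3,2)] assms(3)
proof (induction S rule: finite_induct)
  case (insert u S)
  let ?y = "\<lambda>w. if w \<in> S then min (x w) (1/2) else x w"
  have "hc_half \<eta> ^ card (insert u S) * hc_vol \<eta> V G x = hc_half \<eta> * (hc_half \<eta> ^ card S * hc_vol \<eta> V G x)"
    using insert by simp
  also have "\<dots> \<le> hc_half \<eta> * hc_vol \<eta> V G ?y"
    using insert hc_half_pos[OF assms(1)] by (intro mult_left_mono) auto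
  also have "\<dots> \<le> hc_vol \<eta> V G (?y(u := min (?y u) (1/2)))"
    using insert assms by (intro hc_vol_half) auto
  also have "?y(u := min (?y u) (1/2)) = (\<lambda>w. if w \<in> insert u S then min (x w) (1/2) else x w)"
    using insert.hyps by auto
  finally show ?case .
qed simp

text \<open>
  The volume after insertion of a vertex whose neighbourhood is \<open>S\<close>; compare \<open>hc_Z_insert\<close>.
\<close>

definition hc_ins :: "real \<Rightarrow> 'v set \<Rightarrow> 'v set set \<Rightarrow> 'v set \<Rightarrow> real" where
  "hc_ins \<eta> V G S = (\<integral>t. hc_vol \<eta> V G (\<lambda>u. if u \<in> S then 1 - t else 1) \<partial>hc_nu \<eta>)"

abbreviation "hc_Z \<eta> V G \<equiv> hc_vol \<eta> V G (\<lambda>_. 1)"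

lemma hc_Z_insert:
  assumes "0 < \<eta>" "finite V" "v \<notin> V" "G \<subseteq> pairs V" "S \<subseteq> V"
  shows "hc_Z \<eta> (insert v V) (G \<union> star v S) = hc_ins \<eta> V G S"
  unfolding hc_ins_def using assms
  by (subst hc_vol_insert) (auto dest: pairs_subset_Pow intro!: Bochner_Integration.integral_cong hc_vol_cong simp: indicator_def)

lemma hc_ins_integrable:
  assumes "0 < \<eta>" "finite V"
  shows "integrable (hc_nu \<eta>) (\<lambda>t. hc_vol \<eta> V G (\<lambda>u. if u \<in> S then 1 - t else 1))"
    and "integrable (hc_nu \<eta>) (\<lambda>t. indicator {..1/2} t * hc_vol \<eta> V G (\<lambda>u. if u \<in> S then 1 - t else 1))"
proof -
  interpret prob_space "hc_nu \<eta>" using assms(1) by (rule prob_space_hc_nu)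
  have m: "(\<lambda>t. hc_vol \<eta> V G (\<lambda>u. if u \<in> S then 1 - t else 1)) \<in> borel_measurable borel"
    using assms by (intro hc_vol_antimono_measurable) auto
  show "integrable (hc_nu \<eta>) (\<lambda>t. hc_vol \<eta> V G (\<lambda>u. if u \<in> S then 1 - t else 1))"
    using hc_vol_le_1[OF assms(1)]
    by (intro integrable_const_bound[where B = 1] borel_measurable_hc_nu m) auto
  show "integrable (hc_nu \<eta>) (\<lambda>t. indicator {..1/2} t * hc_vol \<eta> V G (\<lambda>u. if u \<in> S then 1 - t else 1))"
    using hc_vol_le_1[OF assms(1)]
    by (intro integrable_const_bound[where B = 1] borel_measurable_hc_nu borel_measurable_times m)
       (auto simp: indicator_def)
qed

lemma hc_ins_half:
  assumes "0 < \<eta>" "finite V"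
  shows "hc_half \<eta> * hc_ins \<eta> V G S \<le> (\<integral>t. indicator {..1/2} t * hc_vol \<eta> V G (\<lambda>u. if u \<in> S then 1 - t else 1) \<partial>hc_nu \<eta>)"
  unfolding hc_half_def hc_ins_def
  using assms by (intro hc_nu_chebyshev borel_measurable_integrable hc_ins_integrable hc_vol_mono) auto

lemma hc_ins_mono:
  assumes "0 < \<eta>" "finite V" "S' \<subseteq> S"
  shows "hc_ins \<eta> V G S \<le> hc_ins \<eta> V G S'"
  unfolding hc_ins_def
  using assms by (intro integral_mono_AE hc_ins_integrable AE_I2 hc_vol_mono) auto

lemma hc_ins_empty: "0 < \<eta> \<Longrightarrow> hc_ins \<eta> V G {} = hc_Z \<eta> V G"
  using prob_space.prob_space[OF prob_space_hc_nu, of \<eta>] by (simp add: hc_ins_def)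

lemma hc_ins_le: "0 < \<eta> \<Longrightarrow> finite V \<Longrightarrow> hc_ins \<eta> V G S \<le> hc_Z \<eta> V G"
  using hc_ins_mono[of \<eta> V "{}" S G] by (simp add: hc_ins_empty)

text \<open>
  An additional edge is respected as soon as both of its ends are at most \<open>1/2\<close>. The bound does not
  depend on the degrees, which is what the concentration argument needs.
\<close>

lemma hc_ins_add_lower:
  assumes "0 < \<eta>" "finite V" "u \<in> V" "G \<subseteq> pairs V"
  shows "hc_half \<eta> ^ 2 * hc_ins \<eta> V G S \<le> hc_ins \<eta> V G (insert u S)"
proof -
  let ?h = "\<lambda>S t. hc_vol \<eta> V G (\<lambda>u. if u \<in> S then 1 - t else 1)"
  have "hc_half \<eta> ^ 2 * hc_ins \<eta> V G S = hc_half \<eta> * (hc_half \<eta> * hc_ins \<eta> V G S)"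
    by (simp add: power2_eq_square)
  also have "\<dots> \<le> hc_half \<eta> * (\<integral>t. indicator {..1/2} t * ?h S t \<partial>hc_nu \<eta>)"
    using assms hc_half_pos[of \<eta>] by (intro mult_left_mono hc_ins_half) auto
  also have "\<dots> = (\<integral>t. hc_half \<eta> * (indicator {..1/2} t * ?h S t) \<partial>hc_nu \<eta>)"
    by simp
  also have "\<dots> \<le> hc_ins \<eta> V G (insert u S)"
    unfolding hc_ins_def
  proof (intro integral_mono_AE integrable_mult_right hc_ins_integrable assms AE_I2)
    fix t :: real
    show "hc_half \<eta> * (indicator {..1/2} t * ?h S t) \<le> ?h (insert u S) t"
    proof (cases "t \<le> 1/2")
      case True
      let ?x = "\<lambda>u. if u \<in> S then 1 - t else 1"
      have "hc_half \<eta> * hc_vol \<eta> V G ?x \<le> hc_vol \<eta> V G (?x(u := min (?x u) (1/2)))"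
        using assms by (intro hc_vol_half)
      also have "\<dots> \<le> ?h (insert u S) t"
        using assms True by (intro hc_vol_mono) auto
      finally show ?thesis using True by simp
    qed auto
  qed
  finally show ?thesis .
qed

text \<open>
  The new vertex fits if its spin and those of its neighbours are all at most \<open>1/2\<close>.
\<close>

lemma hc_ins_lower:
  assumes "0 < \<eta>" "finite V" "S \<subseteq> V" "G \<subseteq> pairs V"
  shows "hc_half \<eta> ^ (card S + 1) * hc_Z \<eta> V G \<le> hc_ins \<eta> V G S"
proof -
  let ?h = "\<lambda>S t. hc_vol \<eta> V G (\<lambda>u. if u \<in> S then 1 - t else 1)"
  interpret prob_space "hc_nu \<eta>" using assms(1) by (rule prob_space_hc_nu)
  have "{0..1/2} \<inter> {0..1} = {0..1/2::real}" by auto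
  then have "hc_half \<eta> = (\<integral>t. indicator {0..1/2} t \<partial>hc_nu \<eta>)"
    by (simp add: hc_half_def)
  also have "\<dots> = (\<integral>t. indicator {..1/2} t \<partial>hc_nu \<eta>)"
    by (intro Bochner_Integration.integral_cong refl) (auto simp: indicator_def)
  finally have c: "hc_half \<eta> = (\<integral>t. indicator {..1/2} t \<partial>hc_nu \<eta>)" .
  have i: "integrable (hc_nu \<eta>) (indicator {..1/2} :: real \<Rightarrow> real)"
    by (intro integrable_const_bound[where B = 1] borel_measurable_hc_nu) auto
  have "hc_half \<eta> ^ (card S + 1) * hc_Z \<eta> V G = (\<integral>t. indicator {..1/2} t * (hc_half \<eta> ^ card S * hc_Z \<eta> V G) \<partial>hc_nu \<eta>)"
    using i c by simp
  also have "\<dots> \<le> hc_ins \<eta> V G S"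
    unfolding hc_ins_def
  proof (intro integral_mono_AE integrable_mult_left hc_ins_integrable assms i AE_I2)
    fix t :: real
    show "indicator {..1/2} t * (hc_half \<eta> ^ card S * hc_Z \<eta> V G) \<le> ?h S t"
    proof (cases "t \<le> 1/2")
      case True
      have "hc_half \<eta> ^ card S * hc_Z \<eta> V G \<le> hc_vol \<eta> V G (\<lambda>u. if u \<in> S then min 1 (1/2) else 1)"
        using assms by (intro hc_vol_half_set)
      also have "\<dots> \<le> ?h S t"
        using assms True by (intro hc_vol_mono) auto
      finally show ?thesis using True by simp
    qed auto
  qed
  finally show ?thesis .
qed

lemma hc_Z_pos:
  assumes "0 < \<eta>" "finite V" "G \<subseteq> pairs V"
  shows "0 < hc_Z \<eta> V G"
  using assms(2-)
proof (induction V arbitrary: G rule: finite_induct)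
  case (insert v V)
  obtain G' S where G: "G' \<subseteq> pairs V" "S \<subseteq> V" "G = G' \<union> star v S"
    using pairs_insertE[OF insert.hyps(2) insert.prems] .
  have "0 < hc_half \<eta> ^ (card S + 1) * hc_Z \<eta> V G'"
    using insert.IH[OF G(1)] hc_half_pos[OF assms(1)] by simp
  also have "\<dots> \<le> hc_Z \<eta> (insert v V) G"
    unfolding G(3) hc_Z_insert[OF assms(1) insert.hyps G(1,2)]
    by (rule hc_ins_lower[OF assms(1) insert.hyps(1) G(2,1)])
  finally show ?case .
qed simp

lemma hc_ins_pos:
  assumes "0 < \<eta>" "finite V" "S \<subseteq> V" "G \<subseteq> pairs V"
  shows "0 < hc_ins \<eta> V G S"
proof -
  have "0 < hc_half \<eta> ^ (card S + 1) * hc_Z \<eta> V G"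
    using hc_half_pos[OF assms(1)] hc_Z_pos[OF assms(1,2,4)] by simp
  then show ?thesis using hc_ins_lower[OF assms] by linarith
qed

definition hc_kappa :: "real \<Rightarrow> real" where
  "hc_kappa \<eta> = - ln (hc_half \<eta>)"

lemma hc_kappa_nonneg: "0 < \<eta> \<Longrightarrow> 0 \<le> hc_kappa \<eta>"
  using hc_half_pos[of \<eta>] hc_half_le_1[of \<eta>] by (simp add: hc_kappa_def)

definition hc_loss :: "real \<Rightarrow> 'v set \<Rightarrow> 'v set set \<Rightarrow> 'v set \<Rightarrow> real" where
  "hc_loss \<eta> V G S = - ln (hc_ins \<eta> V G S / hc_Z \<eta> V G)"

lemma hc_loss_bounds:
  assumes "0 < \<eta>" "finite V" "S \<subseteq> V" "G \<subseteq> pairs V"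
  shows "0 \<le> hc_loss \<eta> V G S" "hc_loss \<eta> V G S \<le> (real (card S) + 1) * hc_kappa \<eta>"
proof -
  note z = hc_Z_pos[OF assms(1,2,4)] and i = hc_ins_pos[OF assms] and h = hc_half_pos[OF assms(1)]
  have "hc_ins \<eta> V G S / hc_Z \<eta> V G \<le> 1"
    using z hc_ins_le[OF assms(1,2), of G S] by simp
  moreover have "0 < hc_ins \<eta> V G S / hc_Z \<eta> V G"
    using z i by simp
  ultimately show "0 \<le> hc_loss \<eta> V G S"
    by (simp add: hc_loss_def)
  have "hc_half \<eta> ^ (card S + 1) \<le> hc_ins \<eta> V G S / hc_Z \<eta> V G"
    using hc_ins_lower[OF assms] z by (simp add: field_simps)
  then have "ln (hc_half \<eta> ^ (card S + 1)) \<le> ln (hc_ins \<eta> V G S / hc_Z \<eta> V G)"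
    using h by (subst ln_le_cancel_iff) (auto simp: z i)
  also have "ln (hc_half \<eta> ^ (card S + 1)) = - ((real (card S) + 1) * hc_kappa \<eta>)"
    using h by (subst ln_realpow) (auto simp: hc_kappa_def)
  finally show "hc_loss \<eta> V G S \<le> (real (card S) + 1) * hc_kappa \<eta>"
    by (simp add: hc_loss_def)
qed

lemma ln_hc_Z_insert:
  assumes "0 < \<eta>" "finite V" "v \<notin> V" "G \<subseteq> pairs V" "S \<subseteq> V"
  shows "ln (hc_Z \<eta> (insert v V) (G \<union> star v S)) = ln (hc_Z \<eta> V G) - hc_loss \<eta> V G S"
  using hc_Z_pos[OF assms(1,2,4)] hc_ins_pos[OF assms(1,2,5,4)]
  by (simp add: hc_Z_insert[OF assms] hc_loss_def ln_div)

lemma hc_loss_insert: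
  assumes "0 < \<eta>" "finite V" "u \<in> V" "G \<subseteq> pairs V" "S \<subseteq> V"
  shows "\<bar>hc_loss \<eta> V G (insert u S) - hc_loss \<eta> V G S\<bar> \<le> 2 * hc_kappa \<eta>"
proof -
  note z = hc_Z_pos[OF assms(1,2,4)] and h = hc_half_pos[OF assms(1)]
  have i: "0 < hc_ins \<eta> V G S" "0 < hc_ins \<eta> V G (insert u S)"
    using assms by (auto intro!: hc_ins_pos)
  have "ln (hc_half \<eta> ^ 2 * hc_ins \<eta> V G S) \<le> ln (hc_ins \<eta> V G (insert u S))"
    using hc_ins_add_lower[OF assms(1-4)] h i by (subst ln_le_cancel_iff) auto
  then have "- 2 * hc_kappa \<eta> + ln (hc_ins \<eta> V G S) \<le> ln (hc_ins \<eta> V G (insert u S))"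
    using h i by (simp add: ln_mult ln_realpow hc_kappa_def)
  moreover have "ln (hc_ins \<eta> V G (insert u S)) \<le> ln (hc_ins \<eta> V G S)"
    using hc_ins_mono[OF assms(1,2), of S "insert u S" G] i by (subst ln_le_cancel_iff) auto
  ultimately show ?thesis
    using z i hc_kappa_nonneg[OF assms(1)] by (simp add: hc_loss_def ln_div)
qed

lemma ln_hc_Z_add_edge:
  assumes "0 < \<eta>" "finite V" "G \<subseteq> pairs V" "e \<in> pairs V"
  shows "\<bar>ln (hc_Z \<eta> V (insert e G)) - ln (hc_Z \<eta> V G)\<bar> \<le> 2 * hc_kappa \<eta>"
proof -
  obtain v u where e: "e = {v, u}" "v \<noteq> u"
    using assms(4) by (auto simp: pairs_def card_2_iff)
  define V' where "V' = V - {v}"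
  have V: "V = insert v V'" "v \<notin> V'" "finite V'" "u \<in> V'"
    using assms e by (auto simp: V'_def pairs_def)
  obtain G' S where G: "G' \<subseteq> pairs V'" "S \<subseteq> V'" "G = G' \<union> star v S"
    using pairs_insertE[OF V(2)] assms(3) V(1) by metis
  have "insert e G = G' \<union> star v (insert u S)"
    by (simp add: G(3) e star_insert)
  then have "ln (hc_Z \<eta> V (insert e G)) - ln (hc_Z \<eta> V G) = hc_loss \<eta> V' G' S - hc_loss \<eta> V' G' (insert u S)"
    unfolding G(3) V(1) using assms V G by (simp only:) (subst (1 2) ln_hc_Z_insert, auto)
  then show ?thesis
    using hc_loss_insert[OF assms(1) V(3,4) G(1,2)] by (simp add: abs_minus_commute)
qed

lemma hc_loss_image:
  assumes "0 < \<eta>" "finite V" "inj_on \<pi> V" "G \<subseteq> pairs V" "S \<subseteq> V"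
  shows "hc_loss \<eta> (\<pi> ` V) ((`) \<pi> ` G) (\<pi> ` S) = hc_loss \<eta> V G S"
proof -
  have "\<pi> u \<in> \<pi> ` S \<longleftrightarrow> u \<in> S" if "u \<in> V" for u
    using that assms(3,5) by (auto simp: inj_on_def)
  then have "hc_ins \<eta> (\<pi> ` V) ((`) \<pi> ` G) (\<pi> ` S) = hc_ins \<eta> V G S"
    unfolding hc_ins_def hc_vol_image[OF assms(1-4)]
    by (intro Bochner_Integration.integral_cong refl hc_vol_cong) auto
  then show ?thesis
    by (simp add: hc_loss_def hc_vol_image[OF assms(1-4)])
qed

text \<open>
  Any two vertex sets of the same size can be identified such that given lists of distinct roots
  correspond. This is the exchangeability of the vertices of the random graph.
\<close>

lemma relabel_roots:
  assumes "finite V" "distinct us" "set us \<subseteq> V"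
  obtains \<pi> where "bij_betw \<pi> {..<card V} V" "\<And>i. i < length us \<Longrightarrow> \<pi> i = us ! i"
proof -
  obtain ys where ys: "set ys = V - set us" "distinct ys"
    using finite_distinct_list[of "V - set us"] assms(1) by auto
  have d: "distinct (us @ ys)" "set (us @ ys) = V"
    using ys assms by auto
  then have "length (us @ ys) = card V"
    using distinct_card by metis
  then have "bij_betw ((!) (us @ ys)) {..<card V} V"
    using d by (intro bij_betw_nth) auto
  then show ?thesis
    by (rule that) (simp add: nth_append)
qed

definition mean_loss :: "real \<Rightarrow> nat \<Rightarrow> real \<Rightarrow> nat \<Rightarrow> real" where
  "mean_loss \<eta> N p k = Eb p (pairs {..<N}) (\<lambda>G. hc_loss \<eta> {..<N} G {..<k})"

lemma Eb_loss_eq_mean_loss: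
  fixes V :: "'v set"
  assumes "0 < \<eta>" "finite V" "S \<subseteq> V"
  shows "Eb p (pairs V) (\<lambda>G. hc_loss \<eta> V G S) = mean_loss \<eta> (card V) p (card S)"
proof -
  obtain us where us: "set us = S" "distinct us"
    using finite_distinct_list[of S] finite_subset assms by blast
  obtain \<pi> where \<pi>: "bij_betw \<pi> {..<card V} V" "\<And>i. i < length us \<Longrightarrow> \<pi> i = us ! i"
    using relabel_roots[of V us] us assms by auto
  have k: "card S = length us"
    using us distinct_card by metis
  have S: "\<pi> ` {..<card S} = S"
    using \<pi>(2) us(1) by (auto simp: k in_set_conv_nth image_iff)
  have inj: "inj_on \<pi> {..<card V}" and im: "\<pi> ` {..<card V} = V"
    using \<pi>(1) by (auto simp: bij_betw_def)
  have "Eb p (pairs V) (\<lambda>G. hc_loss \<eta> V G S) =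
     Eb p (pairs {..<card V}) (\<lambda>G. hc_loss \<eta> (\<pi> ` {..<card V}) ((`) \<pi> ` G) (\<pi> ` {..<card S}))"
    unfolding im S using Eb_pairs_image[OF _ inj, of p] im by simp
  also have "\<dots> = mean_loss \<eta> (card V) p (card S)"
    unfolding mean_loss_def using assms inj card_mono[OF assms(2,3)]
    by (intro Eb_cong refl hc_loss_image) auto
  finally show ?thesis .
qed

lemma mean_loss_bounds:
  assumes "0 < \<eta>" "0 \<le> p" "p \<le> 1" "k \<le> N"
  shows "0 \<le> mean_loss \<eta> N p k" "mean_loss \<eta> N p k \<le> (real k + 1) * hc_kappa \<eta>"
proof -
  have f: "finite (pairs {..<N})" by (simp add: finite_pairs)
  show "0 \<le> mean_loss \<eta> N p k"
    unfolding mean_loss_def using assms by (intro Eb_nonneg hc_loss_bounds) auto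
  have "mean_loss \<eta> N p k \<le> Eb p (pairs {..<N}) (\<lambda>_. (real k + 1) * hc_kappa \<eta>)"
    unfolding mean_loss_def using assms hc_loss_bounds(2)[of \<eta> "{..<N}" "{..<k}"]
    by (intro Eb_mono) auto
  then show "mean_loss \<eta> N p k \<le> (real k + 1) * hc_kappa \<eta>"
    using f by simp
qed

section \<open>Densities and their update\<close>

lemma X0_nonneg: "f \<in> X0 \<Longrightarrow> 0 \<le> apply_bcontfun f x"
proof -
  assume f: "f \<in> X0"
  have "apply_bcontfun f x = apply_bcontfun f (clamp 0 1 x)"
    using f by (auto simp: X0_def C01_def)
  moreover have "clamp 0 1 x \<in> {0..1}"
    using clamp_in_interval[of 0 1 x] by simp
  ultimately show ?thesis
    using f by (auto simp: X0_def)
qed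

lemma bcontfun_integrable: "apply_bcontfun (f :: real \<Rightarrow>\<^sub>C real) integrable_on {a..b}"
  by (intro integrable_continuous_interval) auto

lemma cdf01_mono:
  assumes "f \<in> X0" "s \<le> t"
  shows "cdf01 f s \<le> cdf01 f t"
  unfolding cdf01_def using assms
  by (intro integral_subset_le bcontfun_integrable) (auto simp: X0_nonneg)

lemma cdf01_1: "f \<in> X0 \<Longrightarrow> cdf01 f 1 = 1"
  by (simp add: cdf01_def X0_def)

lemma cdf01_le_1: "f \<in> X0 \<Longrightarrow> t \<le> 1 \<Longrightarrow> cdf01 f t \<le> 1"
  using cdf01_mono[of f t 1] by (simp add: cdf01_1)

lemma cdf01_ge_0: "f \<in> X0 \<Longrightarrow> 0 \<le> cdf01 f t"
  unfolding cdf01_def by (intro integral_nonneg bcontfun_integrable) (auto simp: X0_nonneg)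

lemma continuous_on_cdf01: "continuous_on {0..1} (cdf01 f)"
  unfolding cdf01_def by (intro indefinite_integral_continuous_1 bcontfun_integrable)

lemma continuous_on_cdf01_flip: "continuous_on {0..1} (\<lambda>t. cdf01 f (1 - t))"
  by (rule continuous_on_compose2[OF continuous_on_cdf01]) (auto intro!: continuous_intros)

text \<open>
  A continuous density is the derivative of its distribution function.
\<close>

lemma cdf01_eq_imp_eq:
  assumes "f \<in> X0" "g \<in> X0" "\<And>t. t \<in> {0..1} \<Longrightarrow> cdf01 f t = cdf01 g t"
  shows "f = g"
proof -
  have eq: "apply_bcontfun f x = apply_bcontfun g x" if x: "x \<in> {0..1}" for x
  proof -
    have "(cdf01 h has_vector_derivative apply_bcontfun h x) (at x within {0..1})" for h
      unfolding cdf01_def using x by (intro integral_has_vector_derivative) auto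
    note d = this
    have "(cdf01 f has_vector_derivative apply_bcontfun g x) (at x within {0..1})"
      by (rule has_vector_derivative_transform[OF x _ d[of g]]) (simp add: assms(3))
    with d[of f] have "(cdf01 f has_vector_derivative apply_bcontfun f x) (at x within {0..1})"
      "(cdf01 f has_vector_derivative apply_bcontfun g x) (at x within {0..1})"
      by auto
    then show ?thesis
      using x by (intro vector_derivative_unique_within_closed_interval[of 0 1 x "cdf01 f"]) auto
  qed
  show ?thesis
  proof (rule bcontfun_eqI)
    fix x
    have "clamp 0 1 x \<in> {0..1::real}"
      using clamp_in_interval[of 0 1 x] by simp
    then show "apply_bcontfun f x = apply_bcontfun g x"
      using eq[of "clamp 0 1 x"] assms(1,2) by (auto simp: X0_def C01_def)
  qed
qed

definition cdf_prod :: "(real \<Rightarrow>\<^sub>C real) list \<Rightarrow> real \<Rightarrow> real" where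
  "cdf_prod cs t = (\<Prod>c\<leftarrow>cs. cdf01 c t)"

text \<open>
  Lists are used for the incoming densities because concatenating them corresponds to uniting
  neighbourhoods. The index shift accounts for the sequences of the operator starting at \<open>1\<close>.
\<close>

definition hc_upd :: "real \<Rightarrow> (real \<Rightarrow>\<^sub>C real) list \<Rightarrow> (real \<Rightarrow>\<^sub>C real)" where
  "hc_upd \<eta> cs = hc_update \<eta> (length cs) (\<lambda>k. cs ! (k - 1))"

definition hc_nrm :: "real \<Rightarrow> (real \<Rightarrow>\<^sub>C real) list \<Rightarrow> real" where
  "hc_nrm \<eta> cs = hc_norm_const \<eta> (length cs) (\<lambda>k. cs ! (k - 1))"

lemma hc_weight_list:
  assumes "\<And>i. i < length cs \<Longrightarrow> f (Suc i) = cs ! i"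
  shows "hc_weight \<eta> (length cs) f = (\<lambda>t. \<eta> powr t * cdf_prod cs (1 - t))"
proof
  fix t
  have "(\<Prod>k\<in>{1..length cs}. cdf01 (f k) (1 - t)) = (\<Prod>i<length cs. cdf01 (f (Suc i)) (1 - t))"
    by (simp add: prod.atLeast1_atMost_eq)
  also have "\<dots> = cdf_prod cs (1 - t)"
    using assms by (auto simp: cdf_prod_def prod.list_conv_set_nth atLeast0LessThan)
  finally show "hc_weight \<eta> (length cs) f t = \<eta> powr t * cdf_prod cs (1 - t)"
    by (simp add: hc_weight_def)
qed

lemma hc_norm_const_list:
  assumes "\<And>i. i < length cs \<Longrightarrow> f (Suc i) = cs ! i"
  shows "hc_norm_const \<eta> (length cs) f = hc_nrm \<eta> cs"
  unfolding hc_norm_const_def hc_nrm_def by (simp add: hc_weight_list[of cs] assms)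

lemma hc_update_list:
  assumes "\<And>i. i < length cs \<Longrightarrow> f (Suc i) = cs ! i"
  shows "hc_update \<eta> (length cs) f = hc_upd \<eta> cs"
  unfolding hc_update_def hc_upd_def hc_norm_const_def by (simp add: hc_weight_list[of cs] assms)

lemma hc_nrm_eq: "hc_nrm \<eta> cs = integral {0..1} (\<lambda>t. \<eta> powr t * cdf_prod cs (1 - t))"
  unfolding hc_nrm_def hc_norm_const_def by (simp add: hc_weight_list)

lemma cdf_prod_simps [simp]:
  "cdf_prod [] t = 1" "cdf_prod (c # cs) t = cdf01 c t * cdf_prod cs t"
  by (auto simp: cdf_prod_def)

lemma cdf_prod_ge_0: "set cs \<subseteq> X0 \<Longrightarrow> 0 \<le> cdf_prod cs t"
  by (induction cs) (auto simp: cdf01_ge_0)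

lemma cdf_prod_le_1: "set cs \<subseteq> X0 \<Longrightarrow> t \<le> 1 \<Longrightarrow> cdf_prod cs t \<le> 1"
  by (induction cs) (auto simp: cdf01_ge_0 cdf01_le_1 cdf_prod_ge_0 intro!: mult_le_one)

lemma cdf_prod_mono: "set cs \<subseteq> X0 \<Longrightarrow> s \<le> t \<Longrightarrow> cdf_prod cs s \<le> cdf_prod cs t"
  by (induction cs) (auto simp: cdf01_ge_0 cdf_prod_ge_0 intro!: mult_mono cdf01_mono)

lemma continuous_on_cdf_prod: "continuous_on {0..1} (\<lambda>t. cdf_prod cs (1 - t))"
  by (induction cs) (auto intro!: continuous_intros continuous_on_cdf01_flip)

lemma continuous_on_weight:
  "0 < \<eta> \<Longrightarrow> continuous_on {0..1} (\<lambda>t. \<eta> powr t * cdf_prod cs (1 - t))"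
  by (intro continuous_on_mult continuous_powr01 continuous_on_cdf_prod)

lemma hc_nu_cdf_prod:
  assumes "0 < \<eta>" "0 \<le> x" "x \<le> 1"
  shows "(\<integral>t. indicator {..x} t * cdf_prod cs (1 - t) \<partial>hc_nu \<eta>) =
    integral {0..x} (\<lambda>t. \<eta> powr t * cdf_prod cs (1 - t)) / upsilon0 \<eta>"
  using assms by (intro hc_nu_integral continuous_on_cdf_prod)

lemma hc_nu_cdf_prod_1:
  assumes "0 < \<eta>"
  shows "(\<integral>t. cdf_prod cs (1 - t) \<partial>hc_nu \<eta>) = hc_nrm \<eta> cs / upsilon0 \<eta>"
proof -
  have "(\<integral>t. cdf_prod cs (1 - t) \<partial>hc_nu \<eta>) = (\<integral>t. indicator {..1} t * cdf_prod cs (1 - t) \<partial>hc_nu \<eta>)"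
    by (intro Bochner_Integration.integral_cong) auto
  then show ?thesis
    using hc_nu_cdf_prod[OF assms, of 1 cs] by (simp add: hc_nrm_eq)
qed

lemma cdf_prod_measurable: "(\<lambda>t. cdf_prod cs (1 - t)) \<in> borel_measurable (hc_nu \<eta>)"
  unfolding measurable_cong_sets[OF sets_hc_nu refl]
  by (rule borel_measurable_continuous_on_restrict[OF continuous_on_cdf_prod])

lemma hc_nrm_pos:
  assumes "0 < \<eta>" "set cs \<subseteq> X0"
  shows "0 < hc_nrm \<eta> cs"
  unfolding hc_nrm_def using assms by (intro hc_norm_const_pos) (auto intro!: subsetD[OF assms(2)] nth_mem)

lemma hc_upd_apply:
  assumes "0 < \<eta>" "set cs \<subseteq> X0"
  shows "apply_bcontfun (hc_upd \<eta> cs) t = \<eta> powr clamp 0 1 t * cdf_prod cs (1 - clamp 0 1 t) / hc_nrm \<eta> cs"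
proof -
  have "hc_upd \<eta> cs = to_C01 (\<lambda>t. \<eta> powr t * cdf_prod cs (1 - t) / hc_nrm \<eta> cs)"
    unfolding hc_upd_def hc_update_def by (simp add: hc_weight_list hc_nrm_def)
  moreover have "continuous_on {0..1} (\<lambda>t. \<eta> powr t * cdf_prod cs (1 - t) / hc_nrm \<eta> cs)"
    using hc_nrm_pos[OF assms] assms by (intro continuous_on_divide continuous_on_weight) auto
  ultimately show ?thesis
    by (simp add: apply_to_C01)
qed

lemma clamp01: "t \<in> {0..1} \<Longrightarrow> clamp 0 1 t = (t::real)"
  by (simp add: clamp_cancel_cbox)

lemma clamp01_bounds: "0 \<le> clamp 0 1 (t::real)" "clamp 0 1 (t::real) \<le> 1"
  using clamp_in_interval[of 0 1 t] by simp_all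

lemma cdf01_hc_upd:
  assumes "0 < \<eta>" "set cs \<subseteq> X0" "0 \<le> s" "s \<le> 1"
  shows "cdf01 (hc_upd \<eta> cs) s = integral {0..s} (\<lambda>t. \<eta> powr t * cdf_prod cs (1 - t)) / hc_nrm \<eta> cs"
proof -
  have "cdf01 (hc_upd \<eta> cs) s = integral {0..s} (\<lambda>t. \<eta> powr t * cdf_prod cs (1 - t) / hc_nrm \<eta> cs)"
    unfolding cdf01_def using assms by (intro integral_cong) (auto simp: hc_upd_apply clamp01)
  then show ?thesis by simp
qed

lemma hc_upd_X0:
  assumes "0 < \<eta>" "set cs \<subseteq> X0"
  shows "hc_upd \<eta> cs \<in> X0"
proof -
  have "clamp 0 1 (clamp 0 1 x) = clamp 0 1 (x::real)" for x
    using clamp01_bounds by (intro clamp01) auto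
  then have "hc_upd \<eta> cs \<in> C01"
    using assms by (simp add: C01_def hc_upd_apply)
  moreover have "0 \<le> apply_bcontfun (hc_upd \<eta> cs) x" for x
    using assms hc_nrm_pos[OF assms] by (simp add: hc_upd_apply cdf_prod_ge_0)
  moreover have "integral {0..1} (apply_bcontfun (hc_upd \<eta> cs)) = 1"
    using cdf01_hc_upd[OF assms, of 1] hc_nrm_pos[OF assms] by (simp add: cdf01_def hc_nrm_eq)
  ultimately show ?thesis
    by (simp add: X0_def)
qed

text \<open>
  The range of the update lies in this set. For a given number of incoming densities from it, the
  normalising constants are bounded away from zero, whereas for \<open>X0\<close> they can be arbitrarily small.
\<close>

definition X1 :: "real \<Rightarrow> (real \<Rightarrow>\<^sub>C real) set" where
  "X1 \<eta> = {f \<in> X0. hc_half \<eta> \<le> cdf01 f (1/2)}"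

text \<open>
  The updated density is \<open>\<eta>\<^sup>t\<close> times a decreasing function, so it puts at least as much mass on \<open>[0, 1/2]\<close>
  as \<open>\<nu>\<close> does.
\<close>

lemma hc_upd_X1:
  assumes "0 < \<eta>" "set cs \<subseteq> X0"
  shows "hc_upd \<eta> cs \<in> X1 \<eta>"
proof -
  have "hc_half \<eta> * (\<integral>t. cdf_prod cs (1 - t) \<partial>hc_nu \<eta>) \<le> (\<integral>t. indicator {..1/2} t * cdf_prod cs (1 - t) \<partial>hc_nu \<eta>)"
    unfolding hc_half_def using assms by (intro hc_nu_chebyshev cdf_prod_measurable cdf_prod_mono) auto
  then have "hc_half \<eta> * hc_nrm \<eta> cs \<le> integral {0..1/2} (\<lambda>t. \<eta> powr t * cdf_prod cs (1 - t))"
    using upsilon0_pos[OF assms(1)] by (simp add: hc_nu_cdf_prod_1[OF assms(1)] hc_nu_cdf_prod[OF assms(1)] divide_le_cancel)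
  then have "hc_half \<eta> \<le> cdf01 (hc_upd \<eta> cs) (1/2)"
    using hc_nrm_pos[OF assms] by (simp add: cdf01_hc_upd[OF assms] le_divide_eq)
  then show ?thesis
    using hc_upd_X0[OF assms] by (simp add: X1_def)
qed

lemma hc_nrm_le:
  assumes "0 < \<eta>" "set cs \<subseteq> X0"
  shows "hc_nrm \<eta> cs \<le> upsilon0 \<eta>"
  unfolding hc_nrm_eq upsilon0_def using assms
  by (intro integral_le integrable_continuous_interval continuous_on_weight continuous_powr01)
     (auto intro!: mult_left_le cdf_prod_le_1)

lemma hc_nrm_ge:
  assumes "0 < \<eta>" "set cs \<subseteq> X1 \<eta>"
  shows "upsilon0 \<eta> * hc_half \<eta> ^ (length cs + 1) \<le> hc_nrm \<eta> cs"
proof -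
  interpret prob_space "hc_nu \<eta>" using assms(1) by (rule prob_space_hc_nu)
  have X0: "set cs \<subseteq> X0" using assms(2) by (auto simp: X1_def)
  have P: "hc_half \<eta> ^ length cs \<le> cdf_prod cs (1/2)"
    using assms(2)
  proof (induction cs)
    case (Cons c cs)
    then show ?case
      using hc_half_pos[OF assms(1)] by (auto simp: X1_def intro!: mult_mono cdf01_ge_0)
  qed simp
  have m: "(\<lambda>t. indicator {..1/2} t * cdf_prod cs (1/2)) \<in> borel_measurable (hc_nu \<eta>)"
    by (intro borel_measurable_hc_nu) simp
  have "hc_half \<eta> * hc_half \<eta> ^ length cs \<le> hc_half \<eta> * cdf_prod cs (1/2)"
    using P hc_half_pos[OF assms(1)] by (intro mult_left_mono) auto
  also have "\<dots> = hc_half \<eta> * (\<integral>t. cdf_prod cs (1/2) \<partial>hc_nu \<eta>)"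
    by (simp add: prob_space[simplified])
  also have "\<dots> \<le> (\<integral>t. indicator {..1/2} t * cdf_prod cs (1/2) \<partial>hc_nu \<eta>)"
    unfolding hc_half_def using assms by (intro hc_nu_chebyshev) auto
  also have "\<dots> \<le> (\<integral>t. cdf_prod cs (1 - t) \<partial>hc_nu \<eta>)"
  proof (intro integral_mono_AE AE_I2)
    show "integrable (hc_nu \<eta>) (\<lambda>t. indicator {..1/2} t * cdf_prod cs (1/2))"
      using cdf_prod_ge_0[OF X0] cdf_prod_le_1[OF X0] m
      by (intro integrable_const_bound[where B = 1]) (auto simp: indicator_def)
    show "integrable (hc_nu \<eta>) (\<lambda>t. cdf_prod cs (1 - t))"
      using cdf_prod_ge_0[OF X0] cdf_prod_le_1[OF X0]
      by (intro integrable_const_bound[where B = 1] cdf_prod_measurable) auto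
    show "indicator {..1/2} t * cdf_prod cs (1/2) \<le> cdf_prod cs (1 - t)" for t
      using cdf_prod_ge_0[OF X0] cdf_prod_mono[OF X0] by (auto simp: indicator_def)
  qed
  finally show ?thesis
    using upsilon0_pos[OF assms(1)] by (simp add: hc_nu_cdf_prod_1[OF assms(1)] field_simps)
qed

lemma norm_hc_upd_le:
  assumes "0 < \<eta>" "set cs \<subseteq> X0"
  shows "norm (hc_upd \<eta> cs) \<le> max 1 \<eta> / hc_nrm \<eta> cs"
proof (rule norm_bound)
  fix x :: real
  define t where "t = clamp 0 1 x"
  have t: "0 \<le> t" "t \<le> 1" using clamp01_bounds by (auto simp: t_def)
  have "\<eta> powr t \<le> max 1 \<eta> powr t"
    using assms t by (intro powr_mono2) auto
  also have "\<dots> \<le> max 1 \<eta> powr 1"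
    using t by (intro powr_mono) auto
  finally have "\<eta> powr t \<le> max 1 \<eta>" by simp
  then have "\<eta> powr t * cdf_prod cs (1 - t) \<le> max 1 \<eta> * 1"
    using cdf_prod_ge_0[OF assms(2)] cdf_prod_le_1[OF assms(2)] t by (intro mult_mono) auto
  then show "norm (apply_bcontfun (hc_upd \<eta> cs) x) \<le> max 1 \<eta> / hc_nrm \<eta> cs"
    using hc_nrm_pos[OF assms] cdf_prod_ge_0[OF assms(2)]
    by (simp add: hc_upd_apply[OF assms] divide_right_mono flip: t_def)
qed

text \<open>
  The cost of inserting a vertex whose neighbours are independent with densities \<open>cs\<close>; see
  \<open>factorizes_loss\<close>.
\<close>

definition hc_psi :: "real \<Rightarrow> (real \<Rightarrow>\<^sub>C real) list \<Rightarrow> real" where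
  "hc_psi \<eta> cs = - ln (hc_nrm \<eta> cs / upsilon0 \<eta>)"

section \<open>Independent roots\<close>

text \<open>
  Under the Gibbs measure of \<open>G\<close> the spins at the roots \<open>us\<close> are independent with densities \<open>fs\<close>. The
  condition is on the joint distribution function, so the profile is \<open>1\<close> away from the roots.
\<close>

definition factorizes :: "real \<Rightarrow> 'v set \<Rightarrow> 'v set set \<Rightarrow> 'v list \<Rightarrow> (real \<Rightarrow>\<^sub>C real) list \<Rightarrow> bool" where
  "factorizes \<eta> V G us fs \<longleftrightarrow> length us = length fs \<and> set fs \<subseteq> X0 \<and>
     (\<forall>x. (\<forall>u\<in>V. 0 \<le> x u \<and> x u \<le> 1) \<and> (\<forall>u\<in>V - set us. x u = 1) \<longrightarrow>
        hc_vol \<eta> V G x = hc_Z \<eta> V G * (\<Prod>(u, f)\<leftarrow>zip us fs. cdf01 f (x u)))"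

lemma factorizesD:
  assumes "factorizes \<eta> V G us fs" "\<And>u. u \<in> V \<Longrightarrow> 0 \<le> x u \<and> x u \<le> 1" "\<And>u. u \<in> V - set us \<Longrightarrow> x u = 1"
  shows "hc_vol \<eta> V G x = hc_Z \<eta> V G * (\<Prod>(u, f)\<leftarrow>zip us fs. cdf01 f (x u))"
  using assms(1)[unfolded factorizes_def, THEN conjunct2, THEN conjunct2, rule_format, of x] assms(2,3) by blast

lemma factorizes_length: "factorizes \<eta> V G us fs \<Longrightarrow> length us = length fs"
  unfolding factorizes_def by blast

lemma factorizes_X0: "factorizes \<eta> V G us fs \<Longrightarrow> set fs \<subseteq> X0"
  unfolding factorizes_def by blast

lemma prod_zip_const:
  "length us = length fs \<Longrightarrow> (\<And>u. u \<in> set us \<Longrightarrow> x u = t) \<Longrightarrow>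
     (\<Prod>(u, f)\<leftarrow>zip us fs. cdf01 f (x u)) = cdf_prod fs t"
  by (induction us fs rule: list_induct2) auto

lemma prod_zip_cong:
  "length us = length fs \<Longrightarrow> (\<And>u. u \<in> set us \<Longrightarrow> x u = y u) \<Longrightarrow>
     (\<Prod>(u, f)\<leftarrow>zip us fs. cdf01 f (x u)) = (\<Prod>(u, f)\<leftarrow>zip us fs. cdf01 f (y u))"
  by (induction us fs rule: list_induct2) auto

lemma cdf_prod_at_1: "set fs \<subseteq> X0 \<Longrightarrow> cdf_prod fs 1 = 1"
  by (induction fs) (auto simp: cdf01_1)

lemma factorizes_Nil: "factorizes \<eta> V G [] []"
  by (auto simp: factorizes_def intro!: hc_vol_cong)

lemma factorizes_peel_integral:
  assumes "0 < \<eta>" "finite V" "v \<notin> V" "G \<subseteq> pairs V"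
    and "factorizes \<eta> V G (ss @ us) (cs @ fs)" "length ss = length cs" "distinct (ss @ us)" "set (ss @ us) \<subseteq> V"
    and "\<And>u. u \<in> insert v V \<Longrightarrow> 0 \<le> x u \<and> x u \<le> 1" "\<And>u. u \<in> V - set us \<Longrightarrow> x u = 1"
  shows "hc_vol \<eta> (insert v V) (G \<union> star v (set ss)) x =
    hc_Z \<eta> V G * (\<Prod>(u, f)\<leftarrow>zip us fs. cdf01 f (x u)) *
      (integral {0..x v} (\<lambda>t. \<eta> powr t * cdf_prod cs (1 - t)) / upsilon0 \<eta>)"
proof -
  let ?P = "\<Prod>(u, f)\<leftarrow>zip us fs. cdf01 f (x u)"
  let ?y = "\<lambda>t u. if u \<in> set ss then min (x u) (1 - t) else x u"
  have len: "length us = length fs"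
    using factorizes_length[OF assms(5)] assms(6) by simp
  have "hc_vol \<eta> (insert v V) (G \<union> star v (set ss)) x =
    (\<integral>t. indicator {..x v} t * hc_vol \<eta> V G (?y t) \<partial>hc_nu \<eta>)"
    using assms by (intro hc_vol_insert pairs_subset_Pow) auto
  also have "\<dots> = (\<integral>t. (hc_Z \<eta> V G * ?P) * (indicator {..x v} t * cdf_prod cs (1 - t)) \<partial>hc_nu \<eta>)"
  proof (intro Bochner_Integration.integral_cong refl)
    fix t assume t: "t \<in> space (hc_nu \<eta>)"
    have 1: "?y t u = 1 - t" if "u \<in> set ss" for u
    proof -
      have "u \<in> V - set us"
        using that assms(7,8) by auto
      then show ?thesis
        using assms(10)[of u] that t by simp
    qed
    have 2: "?y t u = x u" if "u \<in> set us" for u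
      using that assms(7) by auto
    have "hc_vol \<eta> V G (?y t) = hc_Z \<eta> V G * (\<Prod>(u, f)\<leftarrow>zip (ss @ us) (cs @ fs). cdf01 f (?y t u))"
      using assms(9,10) t by (intro factorizesD[OF assms(5)]) auto
    also have "(\<Prod>(u, f)\<leftarrow>zip (ss @ us) (cs @ fs). cdf01 f (?y t u)) =
        (\<Prod>(u, f)\<leftarrow>zip ss cs. cdf01 f (?y t u)) * (\<Prod>(u, f)\<leftarrow>zip us fs. cdf01 f (?y t u))"
      using assms(6) by simp
    also have "(\<Prod>(u, f)\<leftarrow>zip ss cs. cdf01 f (?y t u)) = cdf_prod cs (1 - t)"
      using assms(6) 1 by (rule prod_zip_const)
    also have "(\<Prod>(u, f)\<leftarrow>zip us fs. cdf01 f (?y t u)) = ?P"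
      using len 2 by (rule prod_zip_cong)
    finally show "indicator {..x v} t * hc_vol \<eta> V G (?y t) = (hc_Z \<eta> V G * ?P) * (indicator {..x v} t * cdf_prod cs (1 - t))"
      by simp
  qed
  also have "\<dots> = (hc_Z \<eta> V G * ?P) * (\<integral>t. indicator {..x v} t * cdf_prod cs (1 - t) \<partial>hc_nu \<eta>)"
    by simp
  also have "(\<integral>t. indicator {..x v} t * cdf_prod cs (1 - t) \<partial>hc_nu \<eta>) =
      integral {0..x v} (\<lambda>t. \<eta> powr t * cdf_prod cs (1 - t)) / upsilon0 \<eta>"
    using assms(1) assms(9)[of v] by (intro hc_nu_cdf_prod) auto
  finally show ?thesis .
qed

text \<open>
  Belief propagation for one vertex. The neighbours \<open>ss\<close> of the new vertex are replaced by the vertex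
  itself in the list of roots; integrating its spin against the product of the distribution
  functions of the neighbours gives the updated density.
\<close>

lemma factorizes_peel:
  assumes "0 < \<eta>" "finite V" "v \<notin> V" "G \<subseteq> pairs V"
    and "factorizes \<eta> V G (ss @ us) (cs @ fs)" "length ss = length cs" "distinct (ss @ us)" "set (ss @ us) \<subseteq> V"
  shows "factorizes \<eta> (insert v V) (G \<union> star v (set ss)) (us @ [v]) (fs @ [hc_upd \<eta> cs])"
proof -
  have X0: "set cs \<subseteq> X0" "set fs \<subseteq> X0" and len: "length us = length fs"
    using factorizes_length[OF assms(5)] factorizes_X0[OF assms(5)] assms(6) by auto
  note pos = hc_nrm_pos[OF assms(1) X0(1)] upsilon0_pos[OF assms(1)]
  have "(\<Prod>(u, f)\<leftarrow>zip us fs. cdf01 f 1) = cdf_prod fs 1"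
    using len by (intro prod_zip_const) auto
  then have one: "hc_Z \<eta> (insert v V) (G \<union> star v (set ss)) = hc_Z \<eta> V G * (hc_nrm \<eta> cs / upsilon0 \<eta>)"
    using factorizes_peel_integral[OF assms, of "\<lambda>_. 1"] X0 by (simp add: hc_nrm_eq cdf_prod_at_1)
  show ?thesis
    unfolding factorizes_def
  proof (intro conjI allI impI, goal_cases)
    case (3 x)
    have x: "\<And>u. u \<in> insert v V \<Longrightarrow> 0 \<le> x u \<and> x u \<le> 1" "\<And>u. u \<in> V - set us \<Longrightarrow> x u = 1"
      using 3 assms(3) by auto
    have "hc_vol \<eta> (insert v V) (G \<union> star v (set ss)) x =
        hc_Z \<eta> V G * (\<Prod>(u, f)\<leftarrow>zip us fs. cdf01 f (x u)) *
          (integral {0..x v} (\<lambda>t. \<eta> powr t * cdf_prod cs (1 - t)) / upsilon0 \<eta>)"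
      by (rule factorizes_peel_integral[OF assms x])
    then show ?case
      unfolding one using len pos cdf01_hc_upd[OF assms(1) X0(1), of "x v"] x(1)[of v] by simp
  qed (use len X0 hc_upd_X0[OF assms(1) X0(1)] in auto)
qed

text \<open>
  For independent neighbours the cost of inserting a vertex is the logarithm of the normalising
  constant in the update.
\<close>

lemma factorizes_loss:
  assumes "0 < \<eta>" "finite V" "G \<subseteq> pairs V" "factorizes \<eta> V G ss cs"
  shows "hc_loss \<eta> V G (set ss) = hc_psi \<eta> cs"
proof -
  have len: "length ss = length cs"
    by (rule factorizes_length[OF assms(4)])
  have "hc_ins \<eta> V G (set ss) = (\<integral>t. hc_Z \<eta> V G * cdf_prod cs (1 - t) \<partial>hc_nu \<eta>)"
    unfolding hc_ins_def
  proof (intro Bochner_Integration.integral_cong refl)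
    fix t assume t: "t \<in> space (hc_nu \<eta>)"
    let ?y = "\<lambda>u. if u \<in> set ss then 1 - t else 1"
    have "hc_vol \<eta> V G ?y = hc_Z \<eta> V G * (\<Prod>(u, f)\<leftarrow>zip ss cs. cdf01 f (?y u))"
      using t by (intro factorizesD[OF assms(4)]) auto
    also have "(\<Prod>(u, f)\<leftarrow>zip ss cs. cdf01 f (?y u)) = cdf_prod cs (1 - t)"
      using len by (intro prod_zip_const) auto
    finally show "hc_vol \<eta> V G ?y = hc_Z \<eta> V G * cdf_prod cs (1 - t)" .
  qed
  also have "\<dots> = hc_Z \<eta> V G * (hc_nrm \<eta> cs / upsilon0 \<eta>)"
    by (simp add: hc_nu_cdf_prod_1[OF assms(1)])
  finally show ?thesis
    using hc_Z_pos[OF assms(1-3)] by (simp add: hc_loss_def hc_psi_def)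
qed

text \<open>
  Letting one coordinate of the profile vary recovers the distribution function of one root. So the
  events \<open>factorizes V G us fs\<close> for different \<open>fs\<close> are disjoint.
\<close>

lemma factorizes_unique:
  assumes "0 < \<eta>" "finite V" "G \<subseteq> pairs V" "distinct us" "set us \<subseteq> V"
    and "factorizes \<eta> V G us fs" "factorizes \<eta> V G us gs"
  shows "fs = gs"
proof (rule nth_equalityI)
  show len: "length fs = length gs"
    using factorizes_length[OF assms(6)] factorizes_length[OF assms(7)] by simp
  have val: "hc_vol \<eta> V G (\<lambda>u. if u = us ! i then t else 1) = hc_Z \<eta> V G * cdf01 (hs ! i) t"
    if i: "i < length hs" and t: "t \<in> {0..1}" and F: "factorizes \<eta> V G us hs" for hs t i
  proof -
    let ?x = "\<lambda>u. if u = us ! i then t else 1"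
    have lh: "length us = length hs" and X0: "set hs \<subseteq> X0"
      using factorizes_length[OF F] factorizes_X0[OF F] by auto
    have "us ! i \<in> set us"
      using i lh by simp
    then have "hc_vol \<eta> V G ?x = hc_Z \<eta> V G * (\<Prod>(u, f)\<leftarrow>zip us hs. cdf01 f (?x u))"
      using t by (intro factorizesD[OF F]) auto
    also have "(\<Prod>(u, f)\<leftarrow>zip us hs. cdf01 f (?x u)) = (\<Prod>j<length hs. cdf01 (hs ! j) (?x (us ! j)))"
      using lh by (simp add: prod.list_conv_set_nth atLeast0LessThan)
    also have "\<dots> = (\<Prod>j<length hs. if j = i then cdf01 (hs ! i) t else 1)"
      using i lh X0 assms(4) by (intro prod.cong refl) (auto simp: nth_eq_iff_index_eq intro!: cdf01_1 subsetD[OF X0] nth_mem)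
    also have "\<dots> = cdf01 (hs ! i) t"
      using i by simp
    finally show ?thesis .
  qed
  fix i assume i: "i < length fs"
  have "cdf01 (fs ! i) t = cdf01 (gs ! i) t" if "t \<in> {0..1}" for t
    using val[OF i that assms(6)] val[OF _ that assms(7), of i] i len hc_Z_pos[OF assms(1-3)] by simp
  then show "fs ! i = gs ! i"
    using factorizes_X0[OF assms(6)] factorizes_X0[OF assms(7)] i len
    by (intro cdf01_eq_imp_eq) (auto dest: nth_mem)
qed

lemma factorizes_image:
  assumes "0 < \<eta>" "finite V" "inj_on \<pi> V" "G \<subseteq> pairs V" "set us \<subseteq> V"
  shows "factorizes \<eta> (\<pi> ` V) ((`) \<pi> ` G) (map \<pi> us) fs \<longleftrightarrow> factorizes \<eta> V G us fs"
proof -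
  note vol = hc_vol_image[OF assms(1-4)]
  have zip: "(\<Prod>(u, f)\<leftarrow>zip (map \<pi> us) fs. cdf01 f (x u)) = (\<Prod>(u, f)\<leftarrow>zip us fs. cdf01 f (x (\<pi> u)))" for x
    by (simp add: zip_map1 case_prod_unfold comp_def)
  have off: "\<pi> ` V - set (map \<pi> us) = \<pi> ` (V - set us)"
    using assms(3,5) by (auto simp: inj_on_def)
  show ?thesis
  proof
    assume L: "factorizes \<eta> (\<pi> ` V) ((`) \<pi> ` G) (map \<pi> us) fs"
    show "factorizes \<eta> V G us fs"
      unfolding factorizes_def
    proof (intro conjI allI impI)
      show len: "length us = length fs" "set fs \<subseteq> X0"
        using factorizes_length[OF L] factorizes_X0[OF L] by auto
      fix x :: "_ \<Rightarrow> real" assume x: "(\<forall>u\<in>V. 0 \<le> x u \<and> x u \<le> 1) \<and> (\<forall>u\<in>V - set us. x u = 1)"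
      define x' where "x' w = x (inv_into V \<pi> w)" for w
      have x': "x' (\<pi> u) = x u" if "u \<in> V" for u
        using that assms(3) by (simp add: x'_def)
      have "hc_vol \<eta> (\<pi> ` V) ((`) \<pi> ` G) x' = hc_Z \<eta> (\<pi> ` V) ((`) \<pi> ` G) * (\<Prod>(u, f)\<leftarrow>zip (map \<pi> us) fs. cdf01 f (x' u))"
        using x x' by (intro factorizesD[OF L]) (auto simp: off)
      moreover have "hc_vol \<eta> V G (\<lambda>u. x' (\<pi> u)) = hc_vol \<eta> V G x"
        using x' by (intro hc_vol_cong) auto
      moreover have "(\<Prod>(u, f)\<leftarrow>zip us fs. cdf01 f (x' (\<pi> u))) = (\<Prod>(u, f)\<leftarrow>zip us fs. cdf01 f (x u))"
        using len x' assms(5) by (intro prod_zip_cong) auto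
      ultimately show "hc_vol \<eta> V G x = hc_Z \<eta> V G * (\<Prod>(u, f)\<leftarrow>zip us fs. cdf01 f (x u))"
        unfolding vol zip by simp
    qed
  next
    assume R: "factorizes \<eta> V G us fs"
    show "factorizes \<eta> (\<pi> ` V) ((`) \<pi> ` G) (map \<pi> us) fs"
      unfolding factorizes_def
    proof (intro conjI allI impI)
      fix x :: "_ \<Rightarrow> real" assume x: "(\<forall>u\<in>\<pi> ` V. 0 \<le> x u \<and> x u \<le> 1) \<and> (\<forall>u\<in>\<pi> ` V - set (map \<pi> us). x u = 1)"
      show "hc_vol \<eta> (\<pi> ` V) ((`) \<pi> ` G) x = hc_Z \<eta> (\<pi> ` V) ((`) \<pi> ` G) * (\<Prod>(u, f)\<leftarrow>zip (map \<pi> us) fs. cdf01 f (x u))"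
        using x[unfolded off] unfolding vol zip by (intro factorizesD[OF R]) auto
    qed (use factorizes_length[OF R] factorizes_X0[OF R] in auto)
  qed
qed

text \<open>
  The vertices \<open>0, 1, \<dots>\<close> serve as roots; by exchangeability any other choice gives the same number.
\<close>

definition factor_prob :: "real \<Rightarrow> nat \<Rightarrow> real \<Rightarrow> (real \<Rightarrow>\<^sub>C real) list \<Rightarrow> real" where
  "factor_prob \<eta> N p fs = Eb p (pairs {..<N}) (\<lambda>G. of_bool (factorizes \<eta> {..<N} G [0..<length fs] fs))"

lemma Eb_factorizes_eq_factor_prob:
  fixes V :: "'v set"
  assumes "0 < \<eta>" "finite V" "distinct us" "set us \<subseteq> V" "length us = length fs"
  shows "Eb p (pairs V) (\<lambda>G. of_bool (factorizes \<eta> V G us fs)) = factor_prob \<eta> (card V) p fs"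
proof -
  obtain \<pi> where \<pi>: "bij_betw \<pi> {..<card V} V" "\<And>i. i < length us \<Longrightarrow> \<pi> i = us ! i"
    using relabel_roots[OF assms(2-4)] by blast
  have us: "map \<pi> [0..<length fs] = us"
    using \<pi>(2) assms(5) by (intro nth_equalityI) auto
  have inj: "inj_on \<pi> {..<card V}" and im: "\<pi> ` {..<card V} = V"
    using \<pi>(1) by (auto simp: bij_betw_def)
  have le: "length fs \<le> card V"
    using assms distinct_card[of us] card_mono[of V "set us"] by simp
  have "Eb p (pairs V) (\<lambda>G. of_bool (factorizes \<eta> V G us fs)) =
     Eb p (pairs {..<card V}) (\<lambda>G. of_bool (factorizes \<eta> (\<pi> ` {..<card V}) ((`) \<pi> ` G) (map \<pi> [0..<length fs]) fs))"
    unfolding im us using Eb_pairs_image[OF _ inj, of p] im by simp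
  also have "\<dots> = factor_prob \<eta> (card V) p fs"
    unfolding factor_prob_def using assms(1) inj le
    by (intro Eb_cong refl) (subst factorizes_image, auto)
  finally show ?thesis .
qed

section \<open>The Galton--Watson weights\<close>

text \<open>
  Sums of nonnegative terms over arbitrary index types, here mostly over densities and lists of
  densities. As integrals they admit monotone convergence, Fatou's lemma and interchange.
\<close>

abbreviation esum :: "('a \<Rightarrow> ennreal) \<Rightarrow> ennreal" (binder "\<Sum>\<^sup>+" 10) where
  "esum h \<equiv> integral\<^sup>N (count_space UNIV) h"

lemma nn_integral_list_split:
  "(\<Sum>\<^sup>+cs. F cs) = F [] + (\<Sum>\<^sup>+b. \<Sum>\<^sup>+bs. F (b # bs))"
  for F :: "'a list \<Rightarrow> ennreal"
proof -
  let ?R = "range (\<lambda>(b::'a, bs). b # bs)"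
  have "(\<Sum>\<^sup>+cs. F cs) =
      (\<Sum>\<^sup>+cs. F [] * indicator {[]} cs + F cs * indicator ?R cs)"
  proof (intro nn_integral_cong)
    fix cs :: "'a list"
    show "F cs = F [] * indicator {[]} cs + F cs * indicator ?R cs"
      by (cases cs) (auto simp: indicator_def image_iff)
  qed
  also have "\<dots> = F [] + (\<Sum>\<^sup>+cs. F cs * indicator ?R cs)"
    by (subst nn_integral_add) (auto simp: nn_integral_cmult)
  also have "(\<Sum>\<^sup>+cs. F cs * indicator ?R cs) = (\<integral>\<^sup>+cs. F cs \<partial>count_space ?R)"
    by (subst nn_integral_count_space_indicator) auto
  also have "\<dots> = (\<Sum>\<^sup>+x. F ((\<lambda>(b, bs). b # bs) x))"
    by (intro nn_integral_bij_count_space[symmetric]) (auto simp: bij_betw_def inj_on_def)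
  also have "\<dots> = (\<Sum>\<^sup>+b. \<Sum>\<^sup>+bs. F (b # bs))"
    by (subst nn_integral_fst_count_space[symmetric]) simp
  finally show ?thesis .
qed

lemma nn_integral_list_length:
  "(\<Sum>\<^sup>+cs. F cs) = (\<Sum>n. \<Sum>\<^sup>+cs. (if length cs = n then F cs else 0))"
  for F :: "'a list \<Rightarrow> ennreal"
proof -
  have "F cs = (\<Sum>n. if length cs = n then F cs else 0)" for cs
    using sums_single[of "length cs" "\<lambda>_. F cs"] by (simp add: sums_iff eq_commute cong: if_cong)
  then have "(\<Sum>\<^sup>+cs. F cs) = (\<Sum>\<^sup>+cs. (\<Sum>n. if length cs = n then F cs else 0))"
    by simp
  also have "\<dots> = (\<Sum>n. \<Sum>\<^sup>+cs. (if length cs = n then F cs else 0))"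
    by (intro nn_integral_suminf) auto
  finally show ?thesis .
qed

lemma nn_integral_list_power:
  "(\<Sum>\<^sup>+cs. (if length cs = n then prod_list (map w cs) else 0)) =
     (\<Sum>\<^sup>+x. w x) ^ n"
  for w :: "'a \<Rightarrow> ennreal"
proof (induction n)
  case 0
  show ?case
    by (subst nn_integral_list_split) auto
next
  case (Suc n)
  have "(\<Sum>\<^sup>+cs. (if length cs = Suc n then prod_list (map w cs) else 0)) =
     (\<Sum>\<^sup>+b. \<Sum>\<^sup>+bs. w b * (if length bs = n then prod_list (map w bs) else 0))"
    by (subst nn_integral_list_split) (auto intro!: nn_integral_cong)
  also have "\<dots> = (\<Sum>\<^sup>+b. w b) ^ Suc n"
    by (simp add: nn_integral_cmult nn_integral_multc Suc)
  finally show ?case .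
qed

lemma nn_integral_push:
  fixes U :: "'b \<Rightarrow> 'a" and g :: "'b \<Rightarrow> ennreal"
  shows "(\<Sum>\<^sup>+f. h f * (\<Sum>\<^sup>+cs. (if U cs = f then g cs else 0))) =
    (\<Sum>\<^sup>+cs. h (U cs) * g cs)"
proof -
  let ?F = "\<lambda>(f, cs). h f * (if U cs = f then g cs else 0)"
  have "(\<Sum>\<^sup>+f. h f * (\<Sum>\<^sup>+cs. (if U cs = f then g cs else 0))) =
     (\<Sum>\<^sup>+f. \<Sum>\<^sup>+cs. ?F (f, cs))"
    by (simp add: nn_integral_cmult)
  also have "\<dots> = (\<Sum>\<^sup>+cs. \<Sum>\<^sup>+f. ?F (f, cs))"
    unfolding nn_integral_fst_count_space nn_integral_snd_count_space ..
  also have "\<dots> = (\<Sum>\<^sup>+cs. h (U cs) * g cs)"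
  proof (intro nn_integral_cong)
    fix cs
    have "(\<Sum>\<^sup>+f. ?F (f, cs)) = (\<Sum>\<^sup>+f. h (U cs) * g cs * indicator {U cs} f)"
      by (intro nn_integral_cong) (auto simp: indicator_def)
    then show "(\<Sum>\<^sup>+f. ?F (f, cs)) = h (U cs) * g cs"
      by (simp add: nn_integral_cmult)
  qed
  finally show ?thesis .
qed

lemma prod_list_mono_ennreal:
  "(\<And>c. c \<in> set cs \<Longrightarrow> w c \<le> w' c) \<Longrightarrow> prod_list (map w cs) \<le> (prod_list (map w' cs) :: ennreal)"
  by (induction cs) (auto intro!: mult_mono)

lemma prod_list_eq_0_ennreal: "prod_list xs = (0::ennreal) \<longleftrightarrow> 0 \<in> set xs"
  by (induction xs) auto

text \<open>
  The operator of the theorem on weights of atoms: the number of incoming densities is Poisson with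
  mean \<open>c\<close>, and they are drawn independently with weight \<open>w\<close>.
\<close>

definition gw_op :: "real \<Rightarrow> real \<Rightarrow> ((real \<Rightarrow>\<^sub>C real) \<Rightarrow> ennreal) \<Rightarrow> (real \<Rightarrow>\<^sub>C real) \<Rightarrow> ennreal" where
  "gw_op \<eta> c w f = (\<Sum>\<^sup>+cs. (if hc_upd \<eta> cs = f
      then ennreal (pmf (poisson_pmf c) (length cs)) * prod_list (map w cs) else 0))"

text \<open>
  The weights contributed by Galton--Watson trees of depth less than \<open>r\<close>.
\<close>

definition gw_iter :: "real \<Rightarrow> real \<Rightarrow> nat \<Rightarrow> (real \<Rightarrow>\<^sub>C real) \<Rightarrow> ennreal" where
  "gw_iter \<eta> c r = (gw_op \<eta> c ^^ r) (\<lambda>_. 0)"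

definition gw :: "real \<Rightarrow> real \<Rightarrow> (real \<Rightarrow>\<^sub>C real) \<Rightarrow> ennreal" where
  "gw \<eta> c f = (SUP r. gw_iter \<eta> c r f)"

lemma gw_iter_simps [simp]: "gw_iter \<eta> c 0 = (\<lambda>_. 0)" "gw_iter \<eta> c (Suc r) = gw_op \<eta> c (gw_iter \<eta> c r)"
  by (auto simp: gw_iter_def)

lemma gw_op_mono: "(\<And>f. w f \<le> w' f) \<Longrightarrow> gw_op \<eta> c w f \<le> gw_op \<eta> c w' f"
  unfolding gw_op_def by (intro nn_integral_mono) (auto intro!: mult_left_mono prod_list_mono_ennreal)

lemma incseq_gw_iter: "incseq (\<lambda>r. gw_iter \<eta> c r)"
proof (rule incseq_SucI)
  show "gw_iter \<eta> c r \<le> gw_iter \<eta> c (Suc r)" for r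
  proof (induction r)
    case (Suc r)
    then show ?case
      by (auto simp: le_fun_def intro!: gw_op_mono)
  qed (simp add: le_fun_def)
qed

lemma gw_iter_le: "gw_iter \<eta> c r f \<le> gw \<eta> c f"
  unfolding gw_def by (rule SUP_upper) simp

text \<open>
  The generating function of the Poisson offspring law.
\<close>

lemma mass_gw_op:
  assumes "0 < c" "0 \<le> m" "(\<Sum>\<^sup>+f. w f) = ennreal m"
  shows "(\<Sum>\<^sup>+f. gw_op \<eta> c w f) = ennreal (exp (c * (m - 1)))"
proof -
  let ?p = "\<lambda>n. ennreal (pmf (poisson_pmf c) n)"
  have "(\<Sum>\<^sup>+f. gw_op \<eta> c w f) = (\<Sum>\<^sup>+cs. ?p (length cs) * prod_list (map w cs))"
    using nn_integral_push[of "\<lambda>_. 1" "hc_upd \<eta>" "\<lambda>cs. ?p (length cs) * prod_list (map w cs)"]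
    by (simp add: gw_op_def)
  also have "\<dots> = (\<Sum>n. \<Sum>\<^sup>+cs. (if length cs = n then ?p (length cs) * prod_list (map w cs) else 0))"
    by (rule nn_integral_list_length)
  also have "\<dots> = (\<Sum>n. \<Sum>\<^sup>+cs. ?p n * (if length cs = n then prod_list (map w cs) else 0))"
    by (intro suminf_cong nn_integral_cong) auto
  also have "\<dots> = (\<Sum>n. ?p n * ennreal m ^ n)"
    by (simp only: nn_integral_cmult borel_measurable_count_space nn_integral_list_power assms(3))
  also have "\<dots> = ennreal (exp (c * (m - 1)))"
    using assms by (intro poisson_generating_function)
  finally show ?thesis .
qed

fun extinction :: "real \<Rightarrow> nat \<Rightarrow> real" where
  "extinction c 0 = 0"
| "extinction c (Suc r) = exp (c * (extinction c r - 1))"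

lemma extinction_nonneg: "0 \<le> extinction c r"
  by (cases r) auto

lemma mass_gw_iter:
  "0 < c \<Longrightarrow> (\<Sum>\<^sup>+f. gw_iter \<eta> c r f) = ennreal (extinction c r)"
  by (induction r) (auto intro!: mass_gw_op extinction_nonneg)

lemma one_plus_less_exp: "x < 0 \<Longrightarrow> -1 \<le> x \<Longrightarrow> 1 + x < exp (x::real)"
proof -
  assume x: "x < 0" "-1 \<le> x"
  have "1 + x < 1 + x + x\<^sup>2 / 4" using x by simp
  also have "\<dots> = (1 + x / 2)\<^sup>2" by (simp add: power2_eq_square algebra_simps)
  also have "\<dots> \<le> (exp (x / 2))\<^sup>2"
    using x exp_ge_add_one_self[of "x/2"] by (intro power_mono) auto
  also have "\<dots> = exp x" by (simp add: power2_eq_square flip: exp_add)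
  finally show ?thesis .
qed

text \<open>
  A Poisson branching process with mean offspring at most one dies out: \<open>1\<close> is the only solution of
  \<open>L = exp (c (L - 1))\<close> in \<open>[0, 1]\<close>, since the exponential lies strictly above its tangent at \<open>0\<close>.
\<close>

lemma extinction_LIMSEQ:
  assumes "0 < c" "c \<le> 1"
  shows "extinction c \<longlonglongrightarrow> 1"
proof -
  have le: "extinction c r \<le> 1" for r
    by (induction r) (use assms in \<open>auto simp: mult_le_0_iff\<close>)
  have "incseq (extinction c)"
  proof (rule incseq_SucI)
    show "extinction c r \<le> extinction c (Suc r)" for r
      by (induction r) (use assms in auto)
  qed
  then obtain L where L: "extinction c \<longlonglongrightarrow> L" "\<And>r. extinction c r \<le> L"
    using incseq_convergent[of "extinction c" 1] le by auto
  have "0 \<le> L" "L \<le> 1"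
    using L(2)[of 0] LIMSEQ_le_const2[OF L(1)] le by auto
  have "(\<lambda>r. extinction c (Suc r)) \<longlonglongrightarrow> exp (c * (L - 1))"
    by (auto intro!: tendsto_intros L(1))
  then have eq: "L = exp (c * (L - 1))"
    using LIMSEQ_Suc[OF L(1)] LIMSEQ_unique by blast
  have "L = 1"
  proof (rule ccontr)
    assume "L \<noteq> 1"
    then have "L < 1" using \<open>L \<le> 1\<close> by simp
    have "c * (1 - L) \<le> 1 * (1 - L)"
      using assms \<open>L < 1\<close> by (intro mult_right_mono) auto
    moreover have "0 < c * (1 - L)"
      using assms \<open>L < 1\<close> by simp
    ultimately have "L < exp (c * (L - 1))"
      using one_plus_less_exp[of "c * (L - 1)"] \<open>0 \<le> L\<close> by (simp add: algebra_simps)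
    then show False using eq by simp
  qed
  then show ?thesis using L(1) by simp
qed

lemma mass_gw:
  assumes "0 < c" "c \<le> 1"
  shows "(\<Sum>\<^sup>+f. gw \<eta> c f) = 1"
proof -
  have "(\<Sum>\<^sup>+f. gw \<eta> c f) = (SUP r. \<Sum>\<^sup>+f. gw_iter \<eta> c r f)"
    unfolding gw_def by (intro nn_integral_monotone_convergence_SUP incseq_gw_iter) auto
  also have "\<dots> = (SUP r. ennreal (extinction c r))"
    using assms by (simp add: mass_gw_iter)
  also have "\<dots> = ennreal 1"
  proof (rule LIMSEQ_unique[OF LIMSEQ_SUP])
    have "extinction c r \<le> extinction c (Suc r)" for r
      by (induction r) (use assms in auto)
    then show "incseq (\<lambda>r. ennreal (extinction c r))"
      by (intro incseq_SucI ennreal_leI)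
    show "(\<lambda>r. ennreal (extinction c r)) \<longlonglongrightarrow> ennreal 1"
      using extinction_LIMSEQ[OF assms] by (rule tendsto_ennrealI)
  qed
  finally show ?thesis by simp
qed

lemma nn_integral_eq_imp_eq_count_space:
  fixes f g :: "'a \<Rightarrow> ennreal"
  assumes "\<And>x. g x \<le> f x" "(\<Sum>\<^sup>+x. f x) \<le> (\<Sum>\<^sup>+x. g x)"
    "(\<Sum>\<^sup>+x. g x) < \<infinity>"
  shows "f = g"
proof
  fix x
  have "(\<Sum>\<^sup>+x. f x - g x) = (\<Sum>\<^sup>+x. f x) - (\<Sum>\<^sup>+x. g x)"
    using assms by (intro nn_integral_diff) auto
  also have "\<dots> = 0"
    using assms by (simp add: diff_eq_0_iff_ennreal)
  finally have "f x - g x = 0"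
    by (subst (asm) nn_integral_0_iff_AE) (auto simp: AE_count_space)
  moreover have "g x < \<infinity>"
    using nn_integral_ge_point[of x UNIV g] assms(3) by (auto intro: order_le_less_trans)
  ultimately show "f x = g x"
    using assms(1)[of x] by (auto simp: diff_eq_0_iff_ennreal intro: antisym)
qed

text \<open>
  One inequality is monotonicity. Both sides have mass one, which forces equality.
\<close>

lemma gw_op_gw:
  assumes "0 < c" "c \<le> 1"
  shows "gw_op \<eta> c (gw \<eta> c) = gw \<eta> c"
proof (rule nn_integral_eq_imp_eq_count_space)
  fix f
  show "gw \<eta> c f \<le> gw_op \<eta> c (gw \<eta> c) f"
    unfolding gw_def[of _ _ f]
  proof (rule SUP_least)
    fix r
    have "gw_iter \<eta> c r f \<le> gw_iter \<eta> c (Suc r) f"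
      using incseq_SucD[OF incseq_gw_iter] by (simp add: le_fun_def)
    also have "\<dots> \<le> gw_op \<eta> c (gw \<eta> c) f"
      by (auto intro!: gw_op_mono gw_iter_le)
    finally show "gw_iter \<eta> c r f \<le> gw_op \<eta> c (gw \<eta> c) f" .
  qed
next
  show "(\<Sum>\<^sup>+f. gw_op \<eta> c (gw \<eta> c) f) \<le> (\<Sum>\<^sup>+f. gw \<eta> c f)"
    using mass_gw_op[of c 1 "gw \<eta> c" \<eta>] mass_gw[OF assms, of \<eta>] assms by simp
  show "(\<Sum>\<^sup>+f. gw \<eta> c f) < \<infinity>"
    using mass_gw[OF assms, of \<eta>] by simp
qed

lemma gw_op_nonzeroE:
  assumes "gw_op \<eta> c w f \<noteq> 0"
  obtains cs where "hc_upd \<eta> cs = f" "\<And>b. b \<in> set cs \<Longrightarrow> w b \<noteq> 0"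
proof -
  have "\<exists>cs. hc_upd \<eta> cs = f \<and> prod_list (map w cs) \<noteq> 0"
  proof (rule ccontr)
    assume "\<not> ?thesis"
    then have "gw_op \<eta> c w f = (\<Sum>\<^sup>+(cs::(real \<Rightarrow>\<^sub>C real) list). 0)"
      unfolding gw_op_def by (intro nn_integral_cong) auto
    then show False using assms by simp
  qed
  then show ?thesis
    using that by (auto simp: prod_list_eq_0_ennreal image_iff)
qed

lemma gw_X1:
  assumes "0 < \<eta>" "0 < c" "c \<le> 1" "gw \<eta> c f \<noteq> 0"
  shows "f \<in> X1 \<eta>"
proof -
  have it: "gw_iter \<eta> c r f \<noteq> 0 \<Longrightarrow> f \<in> X0" for r f
  proof (induction r arbitrary: f)
    case (Suc r)
    then obtain cs where "hc_upd \<eta> cs = f" "\<And>b. b \<in> set cs \<Longrightarrow> gw_iter \<eta> c r b \<noteq> 0"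
      by (auto elim: gw_op_nonzeroE)
    then show ?case
      using hc_upd_X0[OF assms(1)] Suc.IH by auto
  qed simp
  have X0: "f \<in> X0" if "gw \<eta> c f \<noteq> 0" for f
  proof -
    have "\<exists>r. gw_iter \<eta> c r f \<noteq> 0"
      using that unfolding gw_def by (metis SUP_eq_const UNIV_not_empty)
    then show ?thesis using it by blast
  qed
  have "gw_op \<eta> c (gw \<eta> c) f \<noteq> 0"
    using assms(4) gw_op_gw[OF assms(2,3)] by simp
  then obtain cs where "hc_upd \<eta> cs = f" "\<And>b. b \<in> set cs \<Longrightarrow> gw \<eta> c b \<noteq> 0"
    by (auto elim: gw_op_nonzeroE)
  then show ?thesis
    using hc_upd_X1[OF assms(1)] X0 by auto
qed

lemma gw_le_1: "0 < c \<Longrightarrow> c \<le> 1 \<Longrightarrow> gw \<eta> c f \<le> 1"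
  using nn_integral_ge_point[of f UNIV "gw \<eta> c"] mass_gw[of c \<eta>] by simp

section \<open>Local convergence\<close>

text \<open>
  Disjoint events, indexed by an arbitrary type, have total probability at most one. The random
  object ranges over the finite set \<open>I\<close>, so the interchange of sums is elementary.
\<close>

lemma nn_integral_sum_at_most_one:
  fixes w :: "'i \<Rightarrow> real" and P :: "'i \<Rightarrow> 'x \<Rightarrow> bool"
  assumes "finite I" "\<And>i. i \<in> I \<Longrightarrow> 0 \<le> w i"
    and "\<And>i x y. i \<in> I \<Longrightarrow> P i x \<Longrightarrow> P i y \<Longrightarrow> x = y"
  shows "(\<Sum>\<^sup>+x. ennreal (\<Sum>i\<in>I. w i * of_bool (P i x))) =
    ennreal (\<Sum>i\<in>I. w i * of_bool (\<exists>x. P i x))"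
proof -
  have one: "(\<Sum>\<^sup>+x. ennreal (w i * of_bool (P i x))) = ennreal (w i * of_bool (\<exists>x. P i x))"
    if i: "i \<in> I" for i
  proof (cases "\<exists>x. P i x")
    case True
    then obtain x0 where x0: "P i x0" by blast
    have Px: "P i x \<longleftrightarrow> x = x0" for x
      using assms(3)[OF i] x0 by blast
    have "(\<Sum>\<^sup>+x. ennreal (w i * of_bool (P i x))) =
        (\<Sum>\<^sup>+x. ennreal (w i) * indicator {x0} x)"
      by (intro nn_integral_cong) (simp add: Px indicator_def)
    then show ?thesis
      using True by (simp add: nn_integral_cmult)
  qed simp
  have "(\<Sum>\<^sup>+x. ennreal (\<Sum>i\<in>I. w i * of_bool (P i x))) =
     (\<Sum>\<^sup>+x. (\<Sum>i\<in>I. ennreal (w i * of_bool (P i x))))"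
    using assms(2) by (intro nn_integral_cong) (subst sum_ennreal, auto)
  also have "\<dots> = (\<Sum>i\<in>I. ennreal (w i * of_bool (\<exists>x. P i x)))"
    by (subst nn_integral_sum) (auto simp: one)
  also have "\<dots> = ennreal (\<Sum>i\<in>I. w i * of_bool (\<exists>x. P i x))"
    using assms(2) by (subst sum_ennreal) auto
  finally show ?thesis .
qed

text \<open>
  Probability that \<open>k\<close> out of \<open>N\<close> vertices are the neighbours of a new vertex, when \<open>n\<close> vertices must not
  be neighbours and \<open>N - m\<close> absent edges are counted. The Poisson limit is the same for all fixed \<open>n\<close>
  and \<open>m\<close>.
\<close>

definition bcoef :: "nat \<Rightarrow> nat \<Rightarrow> nat \<Rightarrow> real \<Rightarrow> nat \<Rightarrow> real" where
  "bcoef N n m p k = real ((N - n) choose k) * p ^ k * (1 - p) ^ (N - m)"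

lemma factor_prob_nonneg: "0 \<le> p \<Longrightarrow> p \<le> 1 \<Longrightarrow> 0 \<le> factor_prob \<eta> N p fs"
  unfolding factor_prob_def by (intro Eb_nonneg) auto

text \<open>
  The last root is added to a graph on \<open>N\<close> vertices with a random neighbourhood that avoids the other
  roots. By \<open>factorizes_peel\<close> it suffices that the neighbours and the other roots are independent with
  suitable densities. For every neighbourhood and graph at most one list \<open>cs\<close> qualifies.
\<close>

lemma factor_prob_peel_le:
  assumes "0 < \<eta>" "0 \<le> p" "p \<le> 1" "length fs \<le> N"
  shows "(\<Sum>\<^sup>+cs. (if hc_upd \<eta> cs = a
            then ennreal (bcoef N (length fs) (length cs) p (length cs) * factor_prob \<eta> N p (cs @ fs)) else 0))
         \<le> ennreal (factor_prob \<eta> (Suc N) p (fs @ [a]))"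
proof -
  define V where "V = {..<N}"
  define n where "n = length fs"
  define us where "us = [0..<n]"
  define bG where "bG G = p ^ card G * (1 - p) ^ card (pairs V - G)" for G
  define bS where "bS S = p ^ card S * (1 - p) ^ card (V - S)" for S
  have bpos: "0 \<le> bG G" "0 \<le> bS S" for G S
    using assms by (auto simp: bG_def bS_def)
  have V: "finite V" "N \<notin> V" "card V = N" "{..<Suc N} = insert N V"
    by (auto simp: V_def)
  have us: "distinct us" "set us \<subseteq> V" "length us = n"
    using assms(4) by (auto simp: us_def V_def n_def)
  define D where "D = Pow (V - set us)"
  define I where "I = Pow (pairs V) \<times> D"
  have fin: "finite I" "finite D" "finite (Pow (pairs V))" "D \<subseteq> Pow V"
    using V by (auto simp: I_def D_def finite_pairs)
  define P where "P = (\<lambda>(G, S) cs. hc_upd \<eta> cs = a \<and> length cs = card S \<and>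
     factorizes \<eta> V G (sorted_list_of_set S @ us) (cs @ fs))"
  have dist: "distinct (sorted_list_of_set S @ us)" "set (sorted_list_of_set S @ us) \<subseteq> V"
    "length (sorted_list_of_set S) = card S" "set (sorted_list_of_set S) = S" if "S \<in> D" for S
  proof -
    have "finite S" "S \<subseteq> V - set us"
      using that V(1) by (auto simp: D_def intro: finite_subset)
    then show "distinct (sorted_list_of_set S @ us)" "set (sorted_list_of_set S @ us) \<subseteq> V"
      "length (sorted_list_of_set S) = card S" "set (sorted_list_of_set S) = S"
      using us by auto
  qed
  have lhs: "(if hc_upd \<eta> cs = a then ennreal (bcoef N n (length cs) p (length cs) * factor_prob \<eta> N p (cs @ fs)) else 0)
      = ennreal (\<Sum>i\<in>I. (case i of (G, S) \<Rightarrow> bG G * bS S) * of_bool (P i cs))" for cs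
  proof (cases "hc_upd \<eta> cs = a")
    case True
    let ?k = "length cs"
    have "(\<Sum>i\<in>I. (case i of (G, S) \<Rightarrow> bG G * bS S) * of_bool (P i cs)) =
       (\<Sum>G\<in>Pow (pairs V). \<Sum>S\<in>D. bG G * bS S * of_bool (P (G, S) cs))"
      unfolding I_def by (simp add: sum.cartesian_product case_prod_unfold)
    also have "\<dots> = (\<Sum>S\<in>D. \<Sum>G\<in>Pow (pairs V). bG G * bS S * of_bool (P (G, S) cs))"
      by (rule sum.swap)
    also have "\<dots> = (\<Sum>S\<in>D. if card S = ?k then p ^ ?k * (1 - p) ^ (N - ?k) * factor_prob \<eta> N p (cs @ fs) else 0)"
    proof (intro sum.cong refl)
      fix S assume S: "S \<in> D"
      show "(\<Sum>G\<in>Pow (pairs V). bG G * bS S * of_bool (P (G, S) cs)) =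
         (if card S = ?k then p ^ ?k * (1 - p) ^ (N - ?k) * factor_prob \<eta> N p (cs @ fs) else 0)"
      proof (cases "card S = ?k")
        case k: True
        have "finite S" "S \<subseteq> V"
          using S V(1) by (auto simp: D_def intro: finite_subset)
        then have "bS S = p ^ ?k * (1 - p) ^ (N - ?k)"
          using V(3) k by (simp add: bS_def card_Diff_subset)
        moreover have "(\<Sum>G\<in>Pow (pairs V). bG G * bS S * of_bool (P (G, S) cs)) =
          bS S * Eb p (pairs V) (\<lambda>G. of_bool (factorizes \<eta> V G (sorted_list_of_set S @ us) (cs @ fs)))"
          unfolding Eb_def sum_distrib_left using True k by (intro sum.cong refl) (simp add: P_def bG_def)
        moreover have "Eb p (pairs V) (\<lambda>G. of_bool (factorizes \<eta> V G (sorted_list_of_set S @ us) (cs @ fs))) =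
            factor_prob \<eta> N p (cs @ fs)"
          using Eb_factorizes_eq_factor_prob[OF assms(1) V(1) dist(1,2)[OF S], of "cs @ fs" p] dist(3)[OF S] us(3) k V(3)
          by (simp add: n_def)
        ultimately show ?thesis using k by simp
      next
        case False
        then have "P (G, S) cs = False" for G
          by (auto simp: P_def)
        then show ?thesis using False by simp
      qed
    qed
    also have "\<dots> = (\<Sum>S\<in>{S\<in>D. card S = ?k}. p ^ ?k * (1 - p) ^ (N - ?k) * factor_prob \<eta> N p (cs @ fs))"
      by (rule sum.inter_filter[symmetric]) (rule fin)
    also have "\<dots> = real (card {S\<in>D. card S = ?k}) * (p ^ ?k * (1 - p) ^ (N - ?k) * factor_prob \<eta> N p (cs @ fs))"
      by simp
    also have "card {S\<in>D. card S = ?k} = (N - n) choose ?k"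
    proof -
      have "card (V - set us) = N - n"
        using us V distinct_card[OF us(1)] by (simp add: card_Diff_subset)
      then show ?thesis
        using n_subsets[of "V - set us" ?k] V by (simp add: D_def)
    qed
    finally show ?thesis
      using True by (simp add: bcoef_def mult_ac)
  qed (simp add: P_def case_prod_unfold)
  have "(\<Sum>\<^sup>+cs. (if hc_upd \<eta> cs = a then ennreal (bcoef N n (length cs) p (length cs) * factor_prob \<eta> N p (cs @ fs)) else 0))
    = (\<Sum>\<^sup>+cs. ennreal (\<Sum>i\<in>I. (case i of (G, S) \<Rightarrow> bG G * bS S) * of_bool (P i cs)))"
    by (simp only: lhs)
  also have "\<dots> = ennreal (\<Sum>i\<in>I. (case i of (G, S) \<Rightarrow> bG G * bS S) * of_bool (\<exists>cs. P i cs))"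
  proof (rule nn_integral_sum_at_most_one)
    fix i cs cs' assume i: "i \<in> I" "P i cs" "P i cs'"
    obtain G S where GS: "i = (G, S)" by force
    have "cs @ fs = cs' @ fs"
      using i dist GS V by (intro factorizes_unique[OF assms(1) V(1), of G "sorted_list_of_set S @ us"]) (auto simp: I_def P_def)
    then show "cs = cs'" by simp
  qed (use fin bpos in auto)
  also have "\<dots> \<le> ennreal (factor_prob \<eta> (Suc N) p (fs @ [a]))"
  proof (rule ennreal_leI)
    let ?Q = "\<lambda>G S. factorizes \<eta> (insert N V) (G \<union> star N S) (us @ [N]) (fs @ [a])"
    have "(\<Sum>i\<in>I. (case i of (G, S) \<Rightarrow> bG G * bS S) * of_bool (\<exists>cs. P i cs)) =
       (\<Sum>G\<in>Pow (pairs V). \<Sum>S\<in>D. bG G * bS S * of_bool (\<exists>cs. P (G, S) cs))"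
      unfolding I_def by (simp add: sum.cartesian_product case_prod_unfold)
    also have "\<dots> \<le> (\<Sum>G\<in>Pow (pairs V). \<Sum>S\<in>D. bG G * bS S * of_bool (?Q G S))"
    proof (intro sum_mono mult_left_mono)
      fix G S assume GS: "G \<in> Pow (pairs V)" "S \<in> D"
      have "?Q G S" if "P (G, S) cs" for cs
        using that factorizes_peel[OF assms(1) V(1,2), of G "sorted_list_of_set S" us cs fs] dist[OF GS(2)] GS(1)
        by (auto simp: P_def)
      then show "(of_bool (\<exists>cs. P (G, S) cs) :: real) \<le> of_bool (?Q G S)"
        by auto
    qed (use bpos in auto)
    also have "\<dots> \<le> (\<Sum>G\<in>Pow (pairs V). \<Sum>S\<in>Pow V. bG G * bS S * of_bool (?Q G S))"
      using fin V bpos by (intro sum_mono sum_mono2) auto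
    also have "\<dots> = Eb p (pairs V) (\<lambda>G. Eb p V (\<lambda>S. of_bool (?Q G S)))"
      unfolding Eb_def bG_def bS_def by (simp add: sum_distrib_left mult_ac)
    also have "\<dots> = Eb p (pairs (insert N V)) (\<lambda>G. of_bool (factorizes \<eta> (insert N V) G (us @ [N]) (fs @ [a])))"
      by (rule Eb_pairs_insert[symmetric, OF V(1,2)])
    also have "\<dots> = factor_prob \<eta> (Suc N) p (fs @ [a])"
    proof -
      have "N \<notin> set us" "set us \<subseteq> insert N V"
        using us V(2) by auto
      then show ?thesis
        using Eb_factorizes_eq_factor_prob[OF assms(1), of "insert N V" "us @ [N]" "fs @ [a]" p] us V(1-3)
        by (simp add: n_def)
    qed
    finally show "(\<Sum>i\<in>I. (case i of (G, S) \<Rightarrow> bG G * bS S) * of_bool (\<exists>cs. P i cs)) \<le> factor_prob \<eta> (Suc N) p (fs @ [a])" .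
  qed
  finally show ?thesis unfolding n_def .
qed

lemma sparse_tendsto_0:
  assumes "(\<lambda>N. real N * p N) \<longlonglongrightarrow> c"
  shows "p \<longlonglongrightarrow> 0"
proof -
  have "(\<lambda>N. (real N * p N) * inverse (real N)) \<longlonglongrightarrow> c * 0"
    by (intro tendsto_mult assms lim_inverse_n)
  then have "(\<lambda>N. (real N * p N) * inverse (real N)) \<longlonglongrightarrow> 0" by simp
  then show ?thesis
    by (rule Lim_transform_eventually) (auto intro!: eventually_mono[OF eventually_gt_at_top[of 0]])
qed

lemma sparse_Suc:
  assumes "(\<lambda>N. real N * p N) \<longlonglongrightarrow> c"
  shows "(\<lambda>N. real N * p (Suc N)) \<longlonglongrightarrow> c"
proof -
  have "(\<lambda>N. real (Suc N) * p (Suc N) - p (Suc N)) \<longlonglongrightarrow> c - 0"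
    using LIMSEQ_Suc[OF assms] LIMSEQ_Suc[OF sparse_tendsto_0[OF assms]] by (rule tendsto_diff)
  then show ?thesis by (simp add: algebra_simps)
qed

lemma tendsto_power_exp:
  assumes "(\<lambda>N. real N * p N) \<longlonglongrightarrow> c" "\<And>N. 0 \<le> p N"
  shows "(\<lambda>N. (1 - p N) ^ (N - m)) \<longlonglongrightarrow> exp (- c)"
proof -
  have p0: "p \<longlonglongrightarrow> 0" by (rule sparse_tendsto_0[OF assms(1)])
  have lim: "(\<lambda>N. real (N - m) * p N) \<longlonglongrightarrow> c"
  proof -
    have "(\<lambda>N. real N * p N - real m * p N) \<longlonglongrightarrow> c - real m * 0"
      by (intro tendsto_intros assms p0)
    then have "(\<lambda>N. real N * p N - real m * p N) \<longlonglongrightarrow> c" by simp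
    then show ?thesis
      by (rule Lim_transform_eventually)
        (auto intro!: eventually_mono[OF eventually_ge_at_top[of m]] simp: of_nat_diff algebra_simps)
  qed
  have ev: "\<forall>\<^sub>F N in sequentially. p N < 1"
    using p0 by (rule order_tendstoD) simp
  \<comment> \<open>\<open>ln (1 - p)\<close> lies between \<open>- p / (1 - p)\<close> and \<open>- p\<close>\<close>
  have "(\<lambda>N. real (N - m) * ln (1 - p N)) \<longlonglongrightarrow> - c"
  proof (rule tendsto_sandwich[where f = "\<lambda>N. - (real (N - m) * p N / (1 - p N))" and h = "\<lambda>N. - (real (N - m) * p N)"])
    show "(\<lambda>N. - (real (N - m) * p N)) \<longlonglongrightarrow> - c"
      by (intro tendsto_intros lim)
    have "(\<lambda>N. - (real (N - m) * p N / (1 - p N))) \<longlonglongrightarrow> - (c / (1 - 0))"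
      by (intro tendsto_intros lim p0) auto
    then show "(\<lambda>N. - (real (N - m) * p N / (1 - p N))) \<longlonglongrightarrow> - c" by simp
    show "\<forall>\<^sub>F N in sequentially. real (N - m) * ln (1 - p N) \<le> - (real (N - m) * p N)"
      using ev
    proof eventually_elim
      case (elim N)
      have "real (N - m) * ln (1 - p N) \<le> real (N - m) * (- p N)"
        using ln_add_one_self_le_self2[of "- p N"] elim by (intro mult_left_mono) auto
      then show ?case by simp
    qed
    show "\<forall>\<^sub>F N in sequentially. - (real (N - m) * p N / (1 - p N)) \<le> real (N - m) * ln (1 - p N)"
      using ev
    proof eventually_elim
      case (elim N)
      have "ln (1 + p N / (1 - p N)) \<le> p N / (1 - p N)"
        using assms(2)[of N] elim by (intro ln_add_one_self_le_self) auto
      moreover have "1 + p N / (1 - p N) = inverse (1 - p N)"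
        using elim by (simp add: field_simps)
      ultimately have "- (p N / (1 - p N)) \<le> ln (1 - p N)"
        using elim by (simp add: ln_inverse)
      then have "real (N - m) * (- (p N / (1 - p N))) \<le> real (N - m) * ln (1 - p N)"
        by (intro mult_left_mono) auto
      then show ?case by simp
    qed
  qed
  then have "(\<lambda>N. exp (real (N - m) * ln (1 - p N))) \<longlonglongrightarrow> exp (- c)"
    by (rule tendsto_exp)
  then show ?thesis
  proof (rule Lim_transform_eventually)
    show "\<forall>\<^sub>F N in sequentially. exp (real (N - m) * ln (1 - p N)) = (1 - p N) ^ (N - m)"
      using ev by eventually_elim (simp add: exp_of_nat_mult)
  qed
qed

lemma bcoef_tendsto:
  assumes "0 < c" "(\<lambda>N. real N * p N) \<longlonglongrightarrow> c" "\<And>N. 0 \<le> p N"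
  shows "(\<lambda>N. bcoef N n m (p N) k) \<longlonglongrightarrow> pmf (poisson_pmf c) k"
proof -
  have p0: "p \<longlonglongrightarrow> 0" by (rule sparse_tendsto_0[OF assms(2)])
  have "(\<lambda>N. \<Prod>i=0..<k. (real N * p N - real (n + i) * p N) / real (k - i)) \<longlonglongrightarrow> (\<Prod>i=0..<k. (c - real (n + i) * 0) / real (k - i))"
    by (intro tendsto_intros assms p0) auto
  moreover have "(\<Prod>i=0..<k. (c - real (n + i) * 0) / real (k - i)) = c ^ k / fact k"
    by (simp add: prod_dividef fact_prod_rev)
  moreover have "\<forall>\<^sub>F N in sequentially. (\<Prod>i=0..<k. (real N * p N - real (n + i) * p N) / real (k - i)) = real ((N - n) choose k) * p N ^ k"
    using eventually_ge_at_top[of "n + k"]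
  proof eventually_elim
    case (elim N)
    have "real ((N - n) choose k) * p N ^ k = (\<Prod>i=0..<k. real (N - n - i) / real (k - i)) * (\<Prod>i=0..<k. p N)"
      using elim by (subst binomial_altdef_of_nat) auto
    also have "\<dots> = (\<Prod>i=0..<k. (real N * p N - real (n + i) * p N) / real (k - i))"
      unfolding prod.distrib[symmetric] using elim
      by (intro prod.cong refl) (auto simp: of_nat_diff algebra_simps)
    finally show ?case by simp
  qed
  ultimately have "(\<lambda>N. real ((N - n) choose k) * p N ^ k) \<longlonglongrightarrow> c ^ k / fact k"
    using Lim_transform_eventually by fastforce
  from tendsto_mult[OF this tendsto_power_exp[OF assms(2,3), of m]] show ?thesis
    using assms(1) by (simp add: bcoef_def)
qed

text \<open>
  Only a lower bound is available for the second factor, and \<open>L\<close> is kept as an extended number to fit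
  with Fatou's lemma.
\<close>

lemma liminf_mult_lower:
  assumes "a \<longlonglongrightarrow> a0" "0 \<le> a0" "\<And>N. 0 \<le> a N" "\<And>N. 0 \<le> b N" "L \<le> liminf (\<lambda>N. ennreal (b N))"
  shows "ennreal a0 * L \<le> liminf (\<lambda>N. ennreal (a N * b N))"
proof (cases "a0 = 0")
  case False
  then have a0: "0 < a0" using assms(2) by simp
  show ?thesis
    unfolding le_Liminf_iff
  proof (intro allI impI)
    fix y assume y: "y < ennreal a0 * L"
    then obtain yr where yr: "0 \<le> yr" "y = ennreal yr"
      by (cases y) auto
    have "ennreal (yr / a0) < L"
    proof (rule ccontr)
      assume "\<not> ?thesis"
      then have "ennreal a0 * L \<le> ennreal a0 * ennreal (yr / a0)"
        by (intro mult_left_mono) auto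
      also have "\<dots> = y"
        using a0 yr by (simp flip: ennreal_mult')
      finally show False using y by simp
    qed
    then obtain z where z: "ennreal (yr / a0) < z" "z < L"
      using dense by blast
    then obtain zr where zr: "0 \<le> zr" "z = ennreal zr"
      by (cases z) auto
    have "yr / a0 < zr"
      using z(1) zr a0 yr by (simp add: ennreal_less_iff)
    then have "yr < a0 * zr"
      using a0 by (simp add: field_simps)
    moreover have "(\<lambda>N. a N * zr) \<longlonglongrightarrow> a0 * zr"
      by (intro tendsto_intros assms)
    ultimately have "\<forall>\<^sub>F N in sequentially. yr < a N * zr"
      by (rule order_tendstoD(1)[rotated])
    moreover have "\<forall>\<^sub>F N in sequentially. z < ennreal (b N)"
      using assms(5) z(2) by (auto simp: le_Liminf_iff)
    ultimately show "\<forall>\<^sub>F N in sequentially. y < ennreal (a N * b N)"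
    proof eventually_elim
      case (elim N)
      have "a N * zr \<le> a N * b N"
        using elim(2) zr assms(3,4)[of N] by (intro mult_left_mono) (auto simp: ennreal_less_iff)
      then show ?case
        using elim(1) yr by (auto simp: ennreal_less_iff)
    qed
  qed
qed simp

text \<open>
  Asymptotically, roots have independent spins with densities \<open>fs\<close> with at least the product
  probability. All sequences \<open>p\<close> with \<open>N p\<^sub>N \<longlonglongrightarrow> c\<close> are admitted, because removing a vertex
  shifts the sequence and Russo's formula evaluates it at intermediate points.
\<close>

definition local_lower :: "real \<Rightarrow> real \<Rightarrow> ((real \<Rightarrow>\<^sub>C real) \<Rightarrow> ennreal) \<Rightarrow> bool" where
  "local_lower \<eta> c w \<longleftrightarrow> (\<forall>p fs. (\<forall>N. 0 \<le> p N \<and> p N \<le> 1) \<longrightarrow> (\<lambda>N. real N * p N) \<longlonglongrightarrow> c \<longrightarrow>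
     prod_list (map w fs) \<le> liminf (\<lambda>N. ennreal (factor_prob \<eta> N (p N) fs)))"

lemma local_lowerD:
  "local_lower \<eta> c w \<Longrightarrow> (\<And>N. 0 \<le> p N) \<Longrightarrow> (\<And>N. p N \<le> 1) \<Longrightarrow> (\<lambda>N. real N * p N) \<longlonglongrightarrow> c \<Longrightarrow>
   prod_list (map w fs) \<le> liminf (\<lambda>N. ennreal (factor_prob \<eta> N (p N) fs))"
  unfolding local_lower_def by blast

lemma local_lower_0: "local_lower \<eta> c (\<lambda>_. 0)"
proof -
  have "factor_prob \<eta> N p [] = 1" for N p
    unfolding factor_prob_def using factorizes_Nil[of \<eta> "{..<N}"] by (simp add: finite_pairs)
  then have "prod_list (map (\<lambda>_. 0) fs) \<le> liminf (\<lambda>N. ennreal (factor_prob \<eta> N (p N) fs))"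
    for p and fs :: "(real \<Rightarrow>\<^sub>C real) list"
    by (cases fs) (simp_all add: Liminf_const)
  then show ?thesis
    unfolding local_lower_def by blast
qed

text \<open>
  The roots are stripped off one at a time, so lists occur in which some roots (\<open>as\<close>) still carry the
  new weight and the others (\<open>bs\<close>) already the old one; stripping the last of \<open>as\<close> puts its neighbours
  in front of \<open>bs\<close>.
\<close>

lemma local_lower_gw_op:
  assumes "0 < \<eta>" "0 < c" "local_lower \<eta> c w"
  shows "local_lower \<eta> c (gw_op \<eta> c w)"
proof -
  have "prod_list (map w bs) * prod_list (map (gw_op \<eta> c w) as) \<le> liminf (\<lambda>N. ennreal (factor_prob \<eta> N (p N) (bs @ as)))"
    if p: "\<And>N. 0 \<le> p N" "\<And>N. p N \<le> 1" "(\<lambda>N. real N * p N) \<longlonglongrightarrow> c" for p bs as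
    using p
  proof (induction as arbitrary: bs p rule: rev_induct)
    case Nil
    then show ?case using local_lowerD[OF assms(3), of p bs] by simp
  next
    case (snoc a as)
    define fs where "fs = bs @ as"
    define p' where "p' N = p (Suc N)" for N
    have p': "\<And>N. 0 \<le> p' N" "\<And>N. p' N \<le> 1" "(\<lambda>N. real N * p' N) \<longlonglongrightarrow> c"
      using snoc.prems sparse_Suc[OF snoc.prems(3)] by (auto simp: p'_def)
    define F where "F N cs = (if hc_upd \<eta> cs = a
        then ennreal (bcoef N (length fs) (length cs) (p' N) (length cs) * factor_prob \<eta> N (p' N) (cs @ fs)) else 0)" for N cs
    let ?q = "\<lambda>n. ennreal (pmf (poisson_pmf c) n)"
    let ?W = "prod_list (map w bs) * prod_list (map (gw_op \<eta> c w) as)"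
    have "prod_list (map w bs) * prod_list (map (gw_op \<eta> c w) (as @ [a])) = ?W * gw_op \<eta> c w a"
      by (simp add: mult.assoc)
    also have "\<dots> = (\<Sum>\<^sup>+cs. ?W * (if hc_upd \<eta> cs = a then ?q (length cs) * prod_list (map w cs) else 0))"
      unfolding gw_op_def[of _ _ _ a] by (subst nn_integral_cmult) auto
    also have "\<dots> \<le> (\<Sum>\<^sup>+cs. liminf (\<lambda>N. F N cs))"
    proof (intro nn_integral_mono)
      fix cs
      show "?W * (if hc_upd \<eta> cs = a then ?q (length cs) * prod_list (map w cs) else 0) \<le> liminf (\<lambda>N. F N cs)"
      proof (cases "hc_upd \<eta> cs = a")
        case True
        have "prod_list (map w (cs @ bs)) * prod_list (map (gw_op \<eta> c w) as)
           \<le> liminf (\<lambda>N. ennreal (factor_prob \<eta> N (p' N) ((cs @ bs) @ as)))"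
          using p' by (rule snoc.IH)
        then have "?q (length cs) * (prod_list (map w (cs @ bs)) * prod_list (map (gw_op \<eta> c w) as))
           \<le> liminf (\<lambda>N. ennreal (bcoef N (length fs) (length cs) (p' N) (length cs) * factor_prob \<eta> N (p' N) ((cs @ bs) @ as)))"
          using p' by (intro liminf_mult_lower bcoef_tendsto assms(2))
             (auto simp: bcoef_def intro!: factor_prob_nonneg)
        then show ?thesis
          using True by (simp add: F_def fs_def mult_ac)
      qed simp
    qed
    also have "\<dots> \<le> liminf (\<lambda>N. \<Sum>\<^sup>+cs. F N cs)"
      by (rule nn_integral_liminf) simp
    also have "\<dots> \<le> liminf (\<lambda>N. ennreal (factor_prob \<eta> (N + 1) (p (N + 1)) (fs @ [a])))"
    proof (rule Liminf_mono)
      show "\<forall>\<^sub>F N in sequentially. (\<Sum>\<^sup>+cs. F N cs) \<le> ennreal (factor_prob \<eta> (N + 1) (p (N + 1)) (fs @ [a]))"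
        using eventually_ge_at_top[of "length fs"]
      proof eventually_elim
        case (elim N)
        then show ?case
          using factor_prob_peel_le[OF assms(1) p'(1)[of N] p'(2)[of N] elim, of a] unfolding F_def by (simp add: p'_def)
      qed
    qed
    also have "\<dots> = liminf (\<lambda>N. ennreal (factor_prob \<eta> N (p N) (fs @ [a])))"
      by (rule liminf_shift)
    finally show ?case by (simp add: fs_def)
  qed
  from this[of _ "[]"] show ?thesis
    unfolding local_lower_def by simp
qed

lemma local_lower_gw:
  assumes "0 < \<eta>" "0 < c" "c \<le> 1"
  shows "local_lower \<eta> c (gw \<eta> c)"
  unfolding local_lower_def
proof (intro allI impI)
  fix p fs
  assume p: "\<forall>N. 0 \<le> p N \<and> p N \<le> 1" "(\<lambda>N. real N * p N) \<longlonglongrightarrow> c"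
  have it: "local_lower \<eta> c (gw_iter \<eta> c r)" for r
    by (induction r) (auto simp: local_lower_0 intro: local_lower_gw_op[OF assms(1,2)])
  have lim: "(\<lambda>r. prod_list (map (gw_iter \<eta> c r) fs)) \<longlonglongrightarrow> prod_list (map (gw \<eta> c) fs) \<and> prod_list (map (gw \<eta> c) fs) \<le> 1"
  proof (induction fs)
    case (Cons f fs)
    have "(\<lambda>r. gw_iter \<eta> c r f) \<longlonglongrightarrow> gw \<eta> c f"
      unfolding gw_def using incseq_gw_iter[of \<eta> c] by (intro LIMSEQ_SUP) (auto simp: incseq_def le_fun_def)
    moreover have "gw \<eta> c f < top" "prod_list (map (gw \<eta> c) fs) < top"
      using gw_le_1[OF assms(2,3), of \<eta> f] Cons by (auto intro: order_le_less_trans)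
    moreover have "gw \<eta> c f * prod_list (map (gw \<eta> c) fs) \<le> 1 * 1"
      using gw_le_1[OF assms(2,3), of \<eta> f] Cons by (intro mult_mono) auto
    ultimately show ?case
      using Cons by (auto intro!: tendsto_mult_ennreal)
  qed simp
  show "prod_list (map (gw \<eta> c) fs) \<le> liminf (\<lambda>N. ennreal (factor_prob \<eta> N (p N) fs))"
    using lim local_lowerD[OF it] p by (intro LIMSEQ_le_const2[OF conjunct1[OF lim]]) auto
qed

text \<open>
  For each graph at most one list \<open>fs\<close> contributes to the sum on the left.
\<close>

lemma Eb_ge_nn_integral:
  assumes "0 < \<eta>" "0 \<le> p" "p \<le> 1" "k \<le> N"
    and "\<And>G. G \<subseteq> pairs {..<N} \<Longrightarrow> 0 \<le> \<phi> G"
    and "\<And>G fs. G \<subseteq> pairs {..<N} \<Longrightarrow> length fs = k \<Longrightarrow> factorizes \<eta> {..<N} G [0..<k] fs \<Longrightarrow> \<phi> G = \<psi> fs"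
  shows "(\<Sum>\<^sup>+fs. (if length fs = k then ennreal (\<psi> fs * factor_prob \<eta> N p fs) else 0))
    \<le> ennreal (Eb p (pairs {..<N}) \<phi>)"
proof -
  define I where "I = Pow (pairs {..<N})"
  define b where "b G = p ^ card G * (1 - p) ^ card (pairs {..<N} - G)" for G
  define P where "P G fs \<longleftrightarrow> length fs = k \<and> factorizes \<eta> {..<N} G [0..<k] fs" for G fs
  have b: "0 \<le> b G" for G
    using assms by (simp add: b_def)
  have fin: "finite I" by (simp add: I_def finite_pairs)
  have "(if length fs = k then ennreal (\<psi> fs * factor_prob \<eta> N p fs) else 0) =
      ennreal (\<Sum>G\<in>I. (b G * \<phi> G) * of_bool (P G fs))" for fs
  proof (cases "length fs = k")
    case True
    have "(\<Sum>G\<in>I. (b G * \<phi> G) * of_bool (P G fs)) = (\<Sum>G\<in>I. \<psi> fs * (b G * of_bool (P G fs)))"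
      using assms(6) by (intro sum.cong refl) (auto simp: P_def I_def)
    also have "\<dots> = \<psi> fs * factor_prob \<eta> N p fs"
      unfolding factor_prob_def Eb_def I_def[symmetric] b_def[symmetric] sum_distrib_left
      using True by (intro sum.cong refl) (simp add: P_def)
    finally show ?thesis using True by simp
  qed (simp add: P_def)
  then have "(\<Sum>\<^sup>+fs. (if length fs = k then ennreal (\<psi> fs * factor_prob \<eta> N p fs) else 0))
     = (\<Sum>\<^sup>+fs. ennreal (\<Sum>G\<in>I. (b G * \<phi> G) * of_bool (P G fs)))"
    by (simp only:)
  also have "\<dots> = ennreal (\<Sum>G\<in>I. (b G * \<phi> G) * of_bool (\<exists>fs. P G fs))"
  proof (rule nn_integral_sum_at_most_one[OF fin])
    fix G fs gs assume "G \<in> I" "P G fs" "P G gs"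
    then show "fs = gs"
      using assms(4) by (intro factorizes_unique[OF assms(1), of "{..<N}" G "[0..<k]"]) (auto simp: P_def I_def)
  qed (use b assms(5) in \<open>auto simp: I_def\<close>)
  also have "\<dots> \<le> ennreal (Eb p (pairs {..<N}) \<phi>)"
    unfolding Eb_def I_def[symmetric] b_def[symmetric] using b assms(5)
    by (intro ennreal_leI sum_mono) (auto simp: I_def mult_left_le)
  finally show ?thesis .
qed

text \<open>
  The mean of \<open>\<psi>\<close> over \<open>k\<close> independent densities with weight \<open>gw\<close>, where negative values count as zero.
\<close>

definition loss_density :: "real \<Rightarrow> real \<Rightarrow> nat \<Rightarrow> ((real \<Rightarrow>\<^sub>C real) list \<Rightarrow> real) \<Rightarrow> ennreal" where
  "loss_density \<eta> c k \<psi> =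
    (\<Sum>\<^sup>+fs. (if length fs = k then ennreal (\<psi> fs) * prod_list (map (gw \<eta> c) fs) else 0))"

text \<open>
  If a nonnegative functional of the graph is a function \<open>\<psi>\<close> of the densities whenever the roots are
  independent, then its limiting mean is at least that of \<open>\<psi>\<close> under independent densities with weight
  \<open>gw\<close>.
\<close>

lemma Eb_liminf:
  assumes "0 < \<eta>" "0 < c" "c \<le> 1" "\<And>N. 0 \<le> p N" "\<And>N. p N \<le> 1" "(\<lambda>N. real N * p N) \<longlonglongrightarrow> c"
    and "\<And>N G. k \<le> N \<Longrightarrow> G \<subseteq> pairs {..<N} \<Longrightarrow> 0 \<le> \<phi> N G"
    and "\<And>N G fs. k \<le> N \<Longrightarrow> G \<subseteq> pairs {..<N} \<Longrightarrow> length fs = k \<Longrightarrow> factorizes \<eta> {..<N} G [0..<k] fs \<Longrightarrow> \<phi> N G = \<psi> fs"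
  shows "loss_density \<eta> c k \<psi> \<le> liminf (\<lambda>N. ennreal (Eb (p N) (pairs {..<N}) (\<phi> N)))"
proof -
  define F where "F N fs = (if length fs = k then ennreal (\<psi> fs * factor_prob \<eta> N (p N) fs) else 0)" for N fs
  have "loss_density \<eta> c k \<psi> \<le> (\<Sum>\<^sup>+fs. liminf (\<lambda>N. F N fs))"
    unfolding loss_density_def
  proof (intro nn_integral_mono)
    fix fs
    show "(if length fs = k then ennreal (\<psi> fs) * prod_list (map (gw \<eta> c) fs) else 0) \<le> liminf (\<lambda>N. F N fs)"
    proof (cases "length fs = k \<and> 0 \<le> \<psi> fs")
      case True
      have "ennreal (\<psi> fs) * prod_list (map (gw \<eta> c) fs) \<le> liminf (\<lambda>N. ennreal (\<psi> fs * factor_prob \<eta> N (p N) fs))"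
        using True assms(4-6) factor_prob_nonneg
        by (intro liminf_mult_lower local_lowerD[OF local_lower_gw] assms) auto
      then show ?thesis using True by (simp add: F_def)
    qed (auto simp: ennreal_neg)
  qed
  also have "\<dots> \<le> liminf (\<lambda>N. \<Sum>\<^sup>+fs. F N fs)"
    by (rule nn_integral_liminf) simp
  also have "\<dots> \<le> liminf (\<lambda>N. ennreal (Eb (p N) (pairs {..<N}) (\<phi> N)))"
  proof (rule Liminf_mono)
    show "\<forall>\<^sub>F N in sequentially. (\<Sum>\<^sup>+fs. F N fs) \<le> ennreal (Eb (p N) (pairs {..<N}) (\<phi> N))"
      using eventually_ge_at_top[of k]
    proof eventually_elim
      case (elim N)
      show ?case
        unfolding F_def using assms(4,5)[of N] elim assms(7,8) by (intro Eb_ge_nn_integral assms(1)) auto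
    qed
  qed
  finally show ?thesis .
qed

lemma liminf_ennrealD:
  assumes "ennreal v \<le> liminf (\<lambda>N. ennreal (x N))" "0 < e" "\<forall>\<^sub>F N in sequentially. 0 \<le> x N"
  shows "\<forall>\<^sub>F N in sequentially. v - e < x N"
proof (cases "v - e < 0")
  case True
  from assms(3) show ?thesis
    by eventually_elim (use True in simp)
next
  case False
  then have "ennreal (v - e) < ennreal v"
    using assms(2) by (auto simp: ennreal_less_iff)
  then have "\<forall>\<^sub>F N in sequentially. ennreal (v - e) < ennreal (x N)"
    using assms(1) by (auto simp: le_Liminf_iff)
  then show ?thesis
    by eventually_elim (use False in \<open>auto simp: ennreal_less_iff\<close>)
qed

lemma hc_psi_bounds:
  assumes "0 < \<eta>" "set fs \<subseteq> X1 \<eta>"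
  shows "0 \<le> hc_psi \<eta> fs" "hc_psi \<eta> fs \<le> (real (length fs) + 1) * hc_kappa \<eta>"
proof -
  have X0: "set fs \<subseteq> X0" using assms(2) by (auto simp: X1_def)
  note u = upsilon0_pos[OF assms(1)] and n = hc_nrm_pos[OF assms(1) X0] and h = hc_half_pos[OF assms(1)]
  have "hc_nrm \<eta> fs / upsilon0 \<eta> \<le> 1"
    using u hc_nrm_le[OF assms(1) X0] by simp
  then show "0 \<le> hc_psi \<eta> fs"
    using u n by (simp add: hc_psi_def)
  have "hc_half \<eta> ^ (length fs + 1) \<le> hc_nrm \<eta> fs / upsilon0 \<eta>"
    using hc_nrm_ge[OF assms] u by (simp add: field_simps)
  then have "ln (hc_half \<eta> ^ (length fs + 1)) \<le> ln (hc_nrm \<eta> fs / upsilon0 \<eta>)"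
    using h u n by (subst ln_le_cancel_iff) auto
  also have "ln (hc_half \<eta> ^ (length fs + 1)) = - ((real (length fs) + 1) * hc_kappa \<eta>)"
    using h by (subst ln_realpow) (auto simp: hc_kappa_def)
  finally show "hc_psi \<eta> fs \<le> (real (length fs) + 1) * hc_kappa \<eta>"
    by (simp add: hc_psi_def)
qed

definition gw_loss :: "real \<Rightarrow> real \<Rightarrow> nat \<Rightarrow> real" where
  "gw_loss \<eta> c k = enn2real (loss_density \<eta> c k (hc_psi \<eta>))"

lemma prod_gw_X1:
  assumes "0 < \<eta>" "0 < c" "c \<le> 1" "prod_list (map (gw \<eta> c) fs) \<noteq> 0"
  shows "set fs \<subseteq> X1 \<eta>"
  using assms(4) gw_X1[OF assms(1-3)] by (auto simp: prod_list_eq_0_ennreal image_iff)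

lemma loss_density_split:
  assumes "0 < \<eta>" "0 < c" "c \<le> 1" "B = (real k + 1) * hc_kappa \<eta>"
  shows "loss_density \<eta> c k (hc_psi \<eta>) + loss_density \<eta> c k (\<lambda>fs. B - hc_psi \<eta> fs) = ennreal B"
proof -
  have "loss_density \<eta> c k (hc_psi \<eta>) + loss_density \<eta> c k (\<lambda>fs. B - hc_psi \<eta> fs) =
    (\<Sum>\<^sup>+fs. ennreal B * (if length fs = k then prod_list (map (gw \<eta> c) fs) else 0))"
    unfolding loss_density_def
  proof (subst nn_integral_add[symmetric], simp, simp, intro nn_integral_cong)
    fix fs :: "(real \<Rightarrow>\<^sub>C real) list"
    show "(if length fs = k then ennreal (hc_psi \<eta> fs) * prod_list (map (gw \<eta> c) fs) else 0) +
      (if length fs = k then ennreal (B - hc_psi \<eta> fs) * prod_list (map (gw \<eta> c) fs) else 0) =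
      ennreal B * (if length fs = k then prod_list (map (gw \<eta> c) fs) else 0)"
    proof (cases "length fs = k \<and> prod_list (map (gw \<eta> c) fs) \<noteq> 0")
      case True
      then have "ennreal (hc_psi \<eta> fs) + ennreal (B - hc_psi \<eta> fs) = ennreal B"
        using hc_psi_bounds[OF assms(1) prod_gw_X1[OF assms(1-3)]] assms(4)
        by (subst ennreal_plus[symmetric]) auto
      then show ?thesis
        using True by (simp flip: distrib_right)
    qed auto
  qed
  also have "\<dots> = ennreal B"
    by (subst nn_integral_cmult) (simp_all add: nn_integral_list_power mass_gw[OF assms(2,3)])
  finally show ?thesis .
qed

lemma gw_loss:
  assumes "0 < \<eta>" "0 < c" "c \<le> 1"
  shows "loss_density \<eta> c k (hc_psi \<eta>) = ennreal (gw_loss \<eta> c k)"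
    and "0 \<le> gw_loss \<eta> c k" "gw_loss \<eta> c k \<le> (real k + 1) * hc_kappa \<eta>"
    and "loss_density \<eta> c k (\<lambda>fs. (real k + 1) * hc_kappa \<eta> - hc_psi \<eta> fs) = ennreal ((real k + 1) * hc_kappa \<eta> - gw_loss \<eta> c k)"
proof -
  define B where "B = (real k + 1) * hc_kappa \<eta>"
  have B: "0 \<le> B" using hc_kappa_nonneg[OF assms(1)] by (simp add: B_def)
  note s = loss_density_split[OF assms B_def]
  have "loss_density \<eta> c k (hc_psi \<eta>) \<le> ennreal B"
    using s by (metis le_iff_add)
  then show 1: "loss_density \<eta> c k (hc_psi \<eta>) = ennreal (gw_loss \<eta> c k)"
    unfolding gw_loss_def by (intro ennreal_enn2real[symmetric]) (auto intro: order_le_less_trans)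
  show 2: "0 \<le> gw_loss \<eta> c k" by (simp add: gw_loss_def)
  show 3: "gw_loss \<eta> c k \<le> (real k + 1) * hc_kappa \<eta>"
    using \<open>loss_density \<eta> c k (hc_psi \<eta>) \<le> ennreal B\<close> B by (simp add: 1 B_def)
  have "ennreal (gw_loss \<eta> c k) + loss_density \<eta> c k (\<lambda>fs. B - hc_psi \<eta> fs) = ennreal (gw_loss \<eta> c k) + ennreal (B - gw_loss \<eta> c k)"
    using s 2 3 by (simp add: 1 B_def flip: ennreal_plus)
  then show "loss_density \<eta> c k (\<lambda>fs. (real k + 1) * hc_kappa \<eta> - hc_psi \<eta> fs) = ennreal ((real k + 1) * hc_kappa \<eta> - gw_loss \<eta> c k)"
    by (subst (asm) ennreal_add_left_cancel) (auto simp: B_def)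
qed

text \<open>
  The argument of Scheffe's lemma: \<open>Eb_liminf\<close> bounds the limit inferior of the mean of the loss and
  of \<open>B\<close> minus the loss, where \<open>B\<close> is an upper bound, and the two lower bounds add up to \<open>B\<close>.
\<close>

lemma mean_loss_tendsto:
  assumes "0 < \<eta>" "0 < c" "c \<le> 1" "\<And>N. 0 \<le> p N" "\<And>N. p N \<le> 1" "(\<lambda>N. real N * p N) \<longlonglongrightarrow> c"
  shows "(\<lambda>N. mean_loss \<eta> N (p N) k) \<longlonglongrightarrow> gw_loss \<eta> c k"
proof (rule tendstoI)
  fix e :: real assume e: "0 < e"
  define B where "B = (real k + 1) * hc_kappa \<eta>"
  define \<phi> where "\<phi> N G = hc_loss \<eta> {..<N} G {..<k}" for N and G :: "nat set set"
  have k: "set [0..<k] = {..<k}" by auto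
  have \<phi>: "0 \<le> \<phi> N G" "\<phi> N G \<le> B" if "k \<le> N" "G \<subseteq> pairs {..<N}" for N G
    using that hc_loss_bounds[OF assms(1), of "{..<N}" "{..<k}" G] by (auto simp: \<phi>_def B_def)
  have \<psi>: "\<phi> N G = hc_psi \<eta> fs" if "G \<subseteq> pairs {..<N}" "factorizes \<eta> {..<N} G [0..<k] fs" for N G fs
    using factorizes_loss[OF assms(1) _ that] by (simp add: \<phi>_def atLeast0LessThan)
  have "ennreal (gw_loss \<eta> c k) \<le> liminf (\<lambda>N. ennreal (mean_loss \<eta> N (p N) k))"
    unfolding gw_loss(1)[OF assms(1-3), symmetric] mean_loss_def \<phi>_def[symmetric]
    by (rule Eb_liminf[OF assms]) (auto intro: \<phi> \<psi>)
  moreover have "\<forall>\<^sub>F N in sequentially. 0 \<le> mean_loss \<eta> N (p N) k"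
    using eventually_ge_at_top[of k] by eventually_elim (intro mean_loss_bounds assms)
  ultimately have 1: "\<forall>\<^sub>F N in sequentially. gw_loss \<eta> c k - e < mean_loss \<eta> N (p N) k"
    using e by (intro liminf_ennrealD)
  have "ennreal (B - gw_loss \<eta> c k) \<le> liminf (\<lambda>N. ennreal (Eb (p N) (pairs {..<N}) (\<lambda>G. B - \<phi> N G)))"
    unfolding B_def gw_loss(4)[OF assms(1-3), symmetric] unfolding B_def[symmetric]
    by (rule Eb_liminf[OF assms]) (auto simp: \<phi> \<psi>)
  also have "(\<lambda>N. ennreal (Eb (p N) (pairs {..<N}) (\<lambda>G. B - \<phi> N G))) = (\<lambda>N. ennreal (B - mean_loss \<eta> N (p N) k))"
    by (simp add: Eb_diff finite_pairs mean_loss_def \<phi>_def)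
  finally have "ennreal (B - gw_loss \<eta> c k) \<le> liminf (\<lambda>N. ennreal (B - mean_loss \<eta> N (p N) k))" .
  moreover have "\<forall>\<^sub>F N in sequentially. 0 \<le> B - mean_loss \<eta> N (p N) k"
    using eventually_ge_at_top[of k] by eventually_elim (simp add: B_def mean_loss_bounds assms)
  ultimately have "\<forall>\<^sub>F N in sequentially. (B - gw_loss \<eta> c k) - e < B - mean_loss \<eta> N (p N) k"
    using e by (intro liminf_ennrealD)
  with 1 show "\<forall>\<^sub>F N in sequentially. dist (mean_loss \<eta> N (p N) k) (gw_loss \<eta> c k) < e"
    by eventually_elim (simp add: dist_real_def)
qed

section \<open>Convergence of the free energy\<close>

definition mean_lnZ :: "real \<Rightarrow> nat \<Rightarrow> real \<Rightarrow> real" where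
  "mean_lnZ \<eta> N p = Eb p (pairs {..<N}) (\<lambda>G. ln (hc_Z \<eta> {..<N} G))"

lemma Eb_lnZ_eq_mean_lnZ:
  fixes V :: "'v set"
  assumes "0 < \<eta>" "finite V"
  shows "Eb p (pairs V) (\<lambda>G. ln (hc_Z \<eta> V G)) = mean_lnZ \<eta> (card V) p"
proof -
  obtain \<pi> where \<pi>: "bij_betw \<pi> {..<card V} V"
    using relabel_roots[OF assms(2), of "[]"] by auto
  have inj: "inj_on \<pi> {..<card V}" and im: "\<pi> ` {..<card V} = V"
    using \<pi> by (auto simp: bij_betw_def)
  have "Eb p (pairs V) (\<lambda>G. ln (hc_Z \<eta> V G)) =
     Eb p (pairs {..<card V}) (\<lambda>G. ln (hc_Z \<eta> (\<pi> ` {..<card V}) ((`) \<pi> ` G)))"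
    unfolding im using Eb_pairs_image[OF _ inj, of p] im by simp
  also have "\<dots> = mean_lnZ \<eta> (card V) p"
    unfolding mean_lnZ_def using assms inj
    by (intro Eb_cong refl) (subst hc_vol_image, auto)
  finally show ?thesis .
qed

text \<open>
  The last vertex has a binomial number of neighbours, independently of the rest of the graph.
\<close>

lemma mean_lnZ_Suc:
  assumes "0 < \<eta>"
  shows "mean_lnZ \<eta> (Suc N) p = mean_lnZ \<eta> N p - (\<Sum>k\<le>N. bcoef N 0 k p k * mean_loss \<eta> N p k)"
proof -
  define V where "V = {..<N}"
  have V: "finite V" "N \<notin> V" "card V = N" "{..<Suc N} = insert N V"
    by (auto simp: V_def)
  have "mean_lnZ \<eta> (Suc N) p = Eb p (pairs V) (\<lambda>G. Eb p V (\<lambda>S. ln (hc_Z \<eta> (insert N V) (G \<union> star N S))))"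
    unfolding mean_lnZ_def V(4) by (rule Eb_pairs_insert[OF V(1,2)])
  also have "\<dots> = Eb p (pairs V) (\<lambda>G. Eb p V (\<lambda>S. ln (hc_Z \<eta> V G) - hc_loss \<eta> V G S))"
    using V assms by (intro Eb_cong refl ln_hc_Z_insert) auto
  also have "\<dots> = mean_lnZ \<eta> N p - Eb p (pairs V) (\<lambda>G. Eb p V (\<lambda>S. hc_loss \<eta> V G S))"
    using V by (simp add: Eb_diff mean_lnZ_def V_def)
  also have "Eb p (pairs V) (\<lambda>G. Eb p V (\<lambda>S. hc_loss \<eta> V G S)) = Eb p V (\<lambda>S. Eb p (pairs V) (\<lambda>G. hc_loss \<eta> V G S))"
    by (rule Eb_swap)
  also have "\<dots> = Eb p V (\<lambda>S. mean_loss \<eta> N p (card S))"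
    using V assms Eb_loss_eq_mean_loss[of \<eta> V _ p] by (intro Eb_cong refl) auto
  also have "\<dots> = (\<Sum>k\<le>N. bcoef N 0 k p k * mean_loss \<eta> N p k)"
    using Eb_card[OF V(1), of p "mean_loss \<eta> N p"] V(3) by (simp add: bcoef_def)
  finally show ?thesis .
qed

text \<open>
  The mean cost of an edge in a graph on \<open>M + 1\<close> vertices: one end \<open>v\<close> is removed, and with \<open>k\<close> further
  neighbours of \<open>v\<close> the edge raises its degree from \<open>k\<close> to \<open>k + 1\<close>.
\<close>

definition mean_edge_loss :: "real \<Rightarrow> nat \<Rightarrow> real \<Rightarrow> real" where
  "mean_edge_loss \<eta> M p = (\<Sum>k\<le>M - 1. bcoef M 1 (1 + k) p k * (mean_loss \<eta> M p (Suc k) - mean_loss \<eta> M p k))"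

lemma Eb_add_edge:
  fixes V :: "'v set"
  assumes "0 < \<eta>" "finite V" "e \<in> pairs V"
  shows "Eb p (pairs V) (\<lambda>A. ln (hc_Z \<eta> V (insert e A)) - ln (hc_Z \<eta> V (A - {e}))) = - mean_edge_loss \<eta> (card V - 1) p"
proof -
  obtain v u where e: "e = {v, u}" "v \<noteq> u"
    using assms(3) by (auto simp: pairs_def card_2_iff)
  define V' where "V' = V - {v}"
  define V'' where "V'' = V' - {u}"
  have V: "V = insert v V'" "v \<notin> V'" "finite V'" "u \<in> V'" "V' = insert u V''" "u \<notin> V''" "finite V''"
    using assms e by (auto simp: V'_def V''_def pairs_def)
  define M where "M = card V'"
  have M: "card V - 1 = M" "card V'' = M - 1"
    using V by (auto simp: M_def)
  let ?m = "mean_loss \<eta> M p"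
  have "Eb p (pairs V) (\<lambda>A. ln (hc_Z \<eta> V (insert e A)) - ln (hc_Z \<eta> V (A - {e}))) =
    Eb p (pairs V') (\<lambda>G. Eb p V' (\<lambda>S. ln (hc_Z \<eta> V (insert e (G \<union> star v S))) - ln (hc_Z \<eta> V (G \<union> star v S - {e}))))"
    unfolding V(1) by (rule Eb_pairs_insert[OF V(3,2)])
  also have "\<dots> = Eb p (pairs V') (\<lambda>G. Eb p V' (\<lambda>S. hc_loss \<eta> V' G (S - {u}) - hc_loss \<eta> V' G (insert u S)))"
  proof (intro Eb_cong refl)
    fix G S assume GS: "G \<subseteq> pairs V'" "S \<subseteq> V'"
    have 1: "insert e (G \<union> star v S) = G \<union> star v (insert u S)"
      by (simp add: e star_insert)
    have "e \<notin> G"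
      using GS(1) V(2) e by (auto simp: pairs_def)
    then have 2: "G \<union> star v S - {e} = G \<union> star v (S - {u})"
      using e by (auto simp: star_def doubleton_eq_iff)
    have "ln (hc_Z \<eta> V (G \<union> star v (insert u S))) = ln (hc_Z \<eta> V' G) - hc_loss \<eta> V' G (insert u S)"
      unfolding V(1) using GS V assms(1) by (intro ln_hc_Z_insert) auto
    moreover have "ln (hc_Z \<eta> V (G \<union> star v (S - {u}))) = ln (hc_Z \<eta> V' G) - hc_loss \<eta> V' G (S - {u})"
      unfolding V(1) using GS V assms(1) by (intro ln_hc_Z_insert) auto
    ultimately show "ln (hc_Z \<eta> V (insert e (G \<union> star v S))) - ln (hc_Z \<eta> V (G \<union> star v S - {e})) =
      hc_loss \<eta> V' G (S - {u}) - hc_loss \<eta> V' G (insert u S)"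
      unfolding 1 2 by simp
  qed
  also have "\<dots> = Eb p V' (\<lambda>S. Eb p (pairs V') (\<lambda>G. hc_loss \<eta> V' G (S - {u}) - hc_loss \<eta> V' G (insert u S)))"
    by (rule Eb_swap)
  also have "\<dots> = Eb p V' (\<lambda>S. ?m (card (S - {u})) - ?m (card (insert u S)))"
    unfolding M_def Eb_diff using V assms(1)
    by (intro arg_cong2[where f = "(-)"] Eb_cong refl Eb_loss_eq_mean_loss) auto
  also have "\<dots> = Eb p V'' (\<lambda>S. ?m (card S) - ?m (Suc (card S)))"
  proof -
    have c: "?m (card (S - {u})) - ?m (card (insert u S)) = ?m (card S) - ?m (Suc (card S))"
      "?m (card (insert u S - {u})) - ?m (card (insert u (insert u S))) = ?m (card S) - ?m (Suc (card S))" if "S \<subseteq> V''" for S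
    proof -
      have "u \<notin> S" "finite S"
        using that V(6,7) finite_subset by auto
      then show "?m (card (S - {u})) - ?m (card (insert u S)) = ?m (card S) - ?m (Suc (card S))"
        "?m (card (insert u S - {u})) - ?m (card (insert u (insert u S))) = ?m (card S) - ?m (Suc (card S))"
        by simp_all
    qed
    have "Eb p V' (\<lambda>S. ?m (card (S - {u})) - ?m (card (insert u S))) =
      (1 - p) * Eb p V'' (\<lambda>S. ?m (card (S - {u})) - ?m (card (insert u S)))
      + p * Eb p V'' (\<lambda>S. ?m (card (insert u S - {u})) - ?m (card (insert u (insert u S))))"
      unfolding V(5) by (rule Eb_insert[OF V(7,6)])
    also have "\<dots> = (1 - p) * Eb p V'' (\<lambda>S. ?m (card S) - ?m (Suc (card S)))
      + p * Eb p V'' (\<lambda>S. ?m (card S) - ?m (Suc (card S)))"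
      using c by (intro arg_cong2[where f = "(+)"] arg_cong2[where f = "(*)"] Eb_cong refl) auto
    also have "\<dots> = Eb p V'' (\<lambda>S. ?m (card S) - ?m (Suc (card S)))"
      by (simp add: left_diff_distrib)
    finally show ?thesis .
  qed
  also have "\<dots> = (\<Sum>k\<le>M - 1. real ((M - 1) choose k) * p ^ k * (1 - p) ^ (M - 1 - k) * (?m k - ?m (Suc k)))"
    using Eb_card[OF V(7), of p "\<lambda>k. ?m k - ?m (Suc k)"] M(2) by simp
  also have "\<dots> = - mean_edge_loss \<eta> M p"
    unfolding mean_edge_loss_def sum_negf[symmetric] by (intro sum.cong refl) (simp add: bcoef_def algebra_simps)
  finally show ?thesis unfolding M(1) .
qed

lemma mean_lnZ_has_derivative:
  assumes "0 < \<eta>"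
  shows "(mean_lnZ \<eta> N has_real_derivative - (real (N choose 2) * mean_edge_loss \<eta> (N - 1) p)) (at p)"
proof -
  have "((\<lambda>p. mean_lnZ \<eta> N p) has_real_derivative
     (\<Sum>e\<in>pairs {..<N}. Eb p (pairs {..<N}) (\<lambda>A. ln (hc_Z \<eta> {..<N} (insert e A)) - ln (hc_Z \<eta> {..<N} (A - {e}))))) (at p)"
    unfolding mean_lnZ_def by (rule Eb_has_derivative_Russo) (simp add: finite_pairs)
  also have "(\<Sum>e\<in>pairs {..<N}. Eb p (pairs {..<N}) (\<lambda>A. ln (hc_Z \<eta> {..<N} (insert e A)) - ln (hc_Z \<eta> {..<N} (A - {e}))))
     = (\<Sum>e\<in>pairs {..<N}. - mean_edge_loss \<eta> (N - 1) p)"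
    using assms Eb_add_edge[of \<eta> "{..<N}" _ p] by (intro sum.cong refl) simp
  finally show ?thesis
    by (simp add: card_pairs)
qed

text \<open>
  Poisson approximation for functions of linear growth, by dominated convergence: the weights
  \<open>bcoef\<close> are at most \<open>C\<^sup>k / k!\<close> with \<open>C = c + 1\<close>.
\<close>

lemma binomial_poisson_tannery:
  fixes g :: "nat \<Rightarrow> nat \<Rightarrow> real"
  assumes "0 < c" "(\<lambda>N. real N * p N) \<longlonglongrightarrow> c" "\<And>N. 0 \<le> p N" "\<And>N. p N \<le> 1"
    and g: "\<And>k. (\<lambda>N. g N k) \<longlonglongrightarrow> g0 k"
    and K: "0 \<le> K" "\<And>N k. k + n \<le> N \<Longrightarrow> \<bar>g N k\<bar> \<le> (real k + 2) * K"
  shows "summable (\<lambda>k. pmf (poisson_pmf c) k * g0 k)"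
    and "(\<lambda>N. \<Sum>k\<le>N - n. bcoef N n (n + k) (p N) k * g N k) \<longlonglongrightarrow> (\<Sum>k. pmf (poisson_pmf c) k * g0 k)"
proof -
  define a where "a k N = (if n \<le> N \<and> k \<le> N - n then bcoef N n (n + k) (p N) k * g N k else 0)" for k N
  define C where "C = c + 1"
  have C: "0 < C" using assms(1) by (simp add: C_def)
  define M where "M k = 2 * K * ((2 * C) ^ k / fact k)" for k
  have "summable M"
    unfolding M_def using summable_exp[of "2 * C"] by (intro summable_mult) (simp add: divide_inverse mult.commute)
  moreover have lim: "(\<lambda>N. a k N) \<longlonglongrightarrow> pmf (poisson_pmf c) k * g0 k" for k
  proof (rule Lim_transform_eventually)
    show "(\<lambda>N. bcoef N n (n + k) (p N) k * g N k) \<longlonglongrightarrow> pmf (poisson_pmf c) k * g0 k"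
      using assms by (intro tendsto_mult bcoef_tendsto g)
    show "\<forall>\<^sub>F N in sequentially. bcoef N n (n + k) (p N) k * g N k = a k N"
      using eventually_ge_at_top[of "n + k"] by eventually_elim (auto simp: a_def)
  qed
  moreover have "\<forall>\<^sub>F (k, N) in at_top \<times>\<^sub>F sequentially. norm (a k N) \<le> M k"
    unfolding eventually_prod_filter
  proof (intro exI conjI allI impI)
    show "\<forall>\<^sub>F k in at_top. True" by simp
    show "\<forall>\<^sub>F N in sequentially. real N * p N < C"
      using assms(2) by (rule order_tendstoD) (simp add: C_def)
    fix k N assume N: "real N * p N < C"
    show "case (k, N) of (k, N) \<Rightarrow> norm (a k N) \<le> M k"
    proof (cases "n \<le> N \<and> k \<le> N - n")
      case True
      have "real ((N - n) choose k) * fact k \<le> real (N - n) ^ k"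
        using binomial_fact_pow[of "N - n" k] by (metis of_nat_fact of_nat_le_iff of_nat_mult of_nat_power)
      also have "\<dots> \<le> real N ^ k"
        by (intro power_mono) auto
      finally have ch: "real ((N - n) choose k) \<le> real N ^ k / fact k"
        by (simp add: field_simps)
      have "bcoef N n (n + k) (p N) k \<le> (real N ^ k / fact k) * p N ^ k * 1"
        unfolding bcoef_def using ch assms(3,4)[of N] by (intro mult_mono power_le_one) auto
      also have "\<dots> = (real N * p N) ^ k / fact k"
        by (simp add: power_mult_distrib)
      also have "\<dots> \<le> C ^ k / fact k"
        using N assms(3)[of N] by (intro divide_right_mono power_mono) auto
      finally have b: "bcoef N n (n + k) (p N) k \<le> C ^ k / fact k" .
      have b0: "0 \<le> bcoef N n (n + k) (p N) k"
        using assms(3,4)[of N] by (simp add: bcoef_def)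
      \<comment> \<open>linear growth is absorbed by doubling \<open>C\<close>\<close>
      have "real k + 2 \<le> 2 * 2 ^ k"
        by (induction k) auto
      then have "\<bar>g N k\<bar> \<le> 2 * 2 ^ k * K"
        using K(2)[of k N] True K(1) by (intro order_trans[OF K(2)] mult_right_mono) auto
      then have "bcoef N n (n + k) (p N) k * \<bar>g N k\<bar> \<le> (C ^ k / fact k) * (2 * 2 ^ k * K)"
        using b b0 C by (intro mult_mono) auto
      also have "\<dots> = M k"
        by (simp add: M_def power_mult_distrib)
      finally show ?thesis
        using True b0 by (simp add: a_def abs_mult)
    qed (use C K in \<open>auto simp: a_def M_def\<close>)
  qed
  ultimately have T: "summable (\<lambda>k. norm (pmf (poisson_pmf c) k * g0 k))"
     "(\<lambda>N. suminf (\<lambda>k. a k N)) \<longlonglongrightarrow> (\<Sum>k. pmf (poisson_pmf c) k * g0 k)"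
    using tannerys_theorem[of a "\<lambda>k. pmf (poisson_pmf c) k * g0 k" sequentially M] by auto
  show "summable (\<lambda>k. pmf (poisson_pmf c) k * g0 k)"
    using T(1) by (rule summable_norm_cancel)
  show "(\<lambda>N. \<Sum>k\<le>N - n. bcoef N n (n + k) (p N) k * g N k) \<longlonglongrightarrow> (\<Sum>k. pmf (poisson_pmf c) k * g0 k)"
  proof (rule Lim_transform_eventually[OF T(2)])
    show "\<forall>\<^sub>F N in sequentially. suminf (\<lambda>k. a k N) = (\<Sum>k\<le>N - n. bcoef N n (n + k) (p N) k * g N k)"
      using eventually_ge_at_top[of n]
    proof eventually_elim
      case (elim N)
      have "suminf (\<lambda>k. a k N) = (\<Sum>k\<le>N - n. a k N)"
        by (rule suminf_finite) (auto simp: a_def)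
      also have "\<dots> = (\<Sum>k\<le>N - n. bcoef N n (n + k) (p N) k * g N k)"
        using elim by (intro sum.cong refl) (auto simp: a_def)
      finally show ?case .
    qed
  qed
qed

lemma cesaro_increments:
  fixes x :: "nat \<Rightarrow> real"
  assumes "(\<lambda>N. x (Suc N) - x N) \<longlonglongrightarrow> d"
  shows "(\<lambda>N. x N / real N) \<longlonglongrightarrow> d"
proof (rule tendstoI)
  fix e :: real assume e: "0 < e"
  \<comment> \<open>the drift is removed, so that the increments tend to \<open>0\<close>\<close>
  define y where "y N = x N - real N * d" for N
  have "(\<lambda>N. y (Suc N) - y N) \<longlonglongrightarrow> 0"
    using tendsto_diff[OF assms tendsto_const[of d]] by (simp add: y_def algebra_simps)
  then have "\<forall>\<^sub>F N in sequentially. dist (y (Suc N) - y N) 0 < e / 2"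
    using e by (intro tendstoD) auto
  then obtain N0 where N0: "\<And>N. N0 \<le> N \<Longrightarrow> \<bar>y (Suc N) - y N\<bar> < e / 2"
    by (auto simp: eventually_at_top_linorder)
  have bd: "\<bar>y N\<bar> \<le> \<bar>y N0\<bar> + real (N - N0) * (e / 2)" if "N0 \<le> N" for N
    using that
  proof (induction N rule: dec_induct)
    case (step N)
    have "\<bar>y (Suc N)\<bar> \<le> \<bar>y N\<bar> + e / 2"
      using N0[OF step.hyps(1)] by linarith
    also have "\<dots> \<le> \<bar>y N0\<bar> + real (N - N0) * (e / 2) + e / 2"
      using step by simp
    also have "\<dots> = \<bar>y N0\<bar> + real (Suc N - N0) * (e / 2)"
      using step.hyps by (simp add: Suc_diff_le distrib_right)
    finally show ?case .
  qed simp
  have "(\<lambda>N. \<bar>y N0\<bar> * inverse (real N)) \<longlonglongrightarrow> \<bar>y N0\<bar> * 0"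
    by (intro tendsto_intros lim_inverse_n)
  then have "\<forall>\<^sub>F N in sequentially. \<bar>y N0\<bar> * inverse (real N) < e / 2"
    using e by (intro order_tendstoD(2)) auto
  then show "\<forall>\<^sub>F N in sequentially. dist (x N / real N) d < e"
    using eventually_ge_at_top[of N0] eventually_gt_at_top[of 0]
  proof eventually_elim
    case (elim N)
    have "x N / real N - d = y N / real N"
      using elim by (simp add: y_def field_simps)
    moreover have "\<bar>y N / real N\<bar> \<le> (\<bar>y N0\<bar> + real N * (e / 2)) / real N"
      using bd[OF elim(2)] e elim(3)
      by (auto simp: abs_divide intro!: divide_right_mono order_trans[OF bd[OF elim(2)]] mult_right_mono)
    moreover have "(\<bar>y N0\<bar> + real N * (e / 2)) / real N = \<bar>y N0\<bar> * inverse (real N) + e / 2"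
      using elim(3) by (simp add: field_simps)
    ultimately show ?case
      using elim(1) by (simp add: dist_real_def)
  qed
qed

text \<open>
  The edge probability of the random graph. The value for \<open>N \<le> 1\<close>, where there are no pairs, only has
  to be a probability.
\<close>

definition er_prob :: "real \<Rightarrow> nat \<Rightarrow> real" where
  "er_prob \<alpha> N = (if 2 \<le> N then 1 - exp (- (2 * \<alpha> / (real N - 1))) else 0)"

lemma er_prob_bounds:
  assumes "0 < \<alpha>"
  shows "0 \<le> er_prob \<alpha> N" "er_prob \<alpha> N \<le> 1"
  using assms by (auto simp: er_prob_def)

lemma er_prob_le: "0 < \<alpha> \<Longrightarrow> 2 \<le> N \<Longrightarrow> er_prob \<alpha> N \<le> 2 * \<alpha> / (real N - 1)"
  using exp_ge_add_one_self[of "- (2 * \<alpha> / (real N - 1))"] by (simp add: er_prob_def)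

lemma er_prob_decreasing:
  assumes "0 < \<alpha>" "2 \<le> N"
  shows "er_prob \<alpha> (Suc N) < er_prob \<alpha> N"
  using assms by (simp add: er_prob_def frac_less2)

lemma er_prob_sparse:
  assumes "0 < \<alpha>"
  shows "(\<lambda>N. real N * er_prob \<alpha> N) \<longlonglongrightarrow> 2 * \<alpha>"
proof (rule Lim_transform_eventually)
  show "(\<lambda>N. real N * (1 - exp (- (2 * \<alpha> / (real N - 1))))) \<longlonglongrightarrow> 2 * \<alpha>"
    using assms by real_asymp
  show "\<forall>\<^sub>F N in sequentially. real N * (1 - exp (- (2 * \<alpha> / (real N - 1)))) = real N * er_prob \<alpha> N"
    using eventually_ge_at_top[of 2] by eventually_elim (simp add: er_prob_def)
qed

text \<open>
  With the edge probability of the larger graph, the graph on \<open>N\<close> vertices lacks \<open>\<alpha>\<close> edges on average.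
\<close>

lemma er_prob_increment:
  assumes "0 < \<alpha>"
  shows "(\<lambda>N. (er_prob \<alpha> N - er_prob \<alpha> (Suc N)) * real (N choose 2)) \<longlonglongrightarrow> \<alpha>"
proof (rule Lim_transform_eventually)
  show "(\<lambda>N. (exp (- (2 * \<alpha> / real N)) - exp (- (2 * \<alpha> / (real N - 1)))) * (real N * (real N - 1) / 2)) \<longlonglongrightarrow> \<alpha>"
    using assms by real_asymp
  show "\<forall>\<^sub>F N in sequentially. (exp (- (2 * \<alpha> / real N)) - exp (- (2 * \<alpha> / (real N - 1)))) * (real N * (real N - 1) / 2)
    = (er_prob \<alpha> N - er_prob \<alpha> (Suc N)) * real (N choose 2)"
    using eventually_ge_at_top[of 2]
    by eventually_elim (simp add: er_prob_def choose_two real_of_nat_div of_nat_diff)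
qed

text \<open>
  The limit of the increments: the cost of a vertex with a Poisson number of neighbours, corrected by
  \<open>\<alpha>\<close> times the cost of an edge.
\<close>

definition free_energy :: "real \<Rightarrow> real \<Rightarrow> real" where
  "free_energy \<eta> \<alpha> = - (\<Sum>k. pmf (poisson_pmf (2 * \<alpha>)) k * gw_loss \<eta> (2 * \<alpha>) k)
     + \<alpha> * (\<Sum>k. pmf (poisson_pmf (2 * \<alpha>)) k * (gw_loss \<eta> (2 * \<alpha>) (Suc k) - gw_loss \<eta> (2 * \<alpha>) k))"

text \<open>
  The graph on \<open>N + 1\<close> vertices minus its last vertex is a random graph on \<open>N\<close> vertices whose edge
  probability is smaller than \<open>er_prob \<alpha> N\<close>; on average \<open>\<alpha>\<close> edges are missing. The mean value theorem
  turns them into \<open>mean_edge_loss\<close> at an intermediate edge probability, which is again of order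
  \<open>2\<alpha>/N\<close>.
\<close>

lemma mean_lnZ_increment_tendsto:
  assumes "0 < \<alpha>" "\<alpha> \<le> 1/2" "0 < \<eta>"
  shows "(\<lambda>N. mean_lnZ \<eta> (Suc N) (er_prob \<alpha> (Suc N)) - mean_lnZ \<eta> N (er_prob \<alpha> N)) \<longlonglongrightarrow> free_energy \<eta> \<alpha>"
proof -
  define c where "c = 2 * \<alpha>"
  have c: "0 < c" "c \<le> 1" using assms by (auto simp: c_def)
  note \<kappa> = hc_kappa_nonneg[OF assms(3)]
  let ?p = "er_prob \<alpha>"
  note p = er_prob_bounds[OF assms(1)]
  have ps: "(\<lambda>N. real N * ?p (Suc N)) \<longlonglongrightarrow> c"
    unfolding c_def by (rule sparse_Suc[OF er_prob_sparse[OF assms(1)]])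
  have S1: "(\<lambda>N. \<Sum>k\<le>N - 0. bcoef N 0 (0 + k) (?p (Suc N)) k * mean_loss \<eta> N (?p (Suc N)) k) \<longlonglongrightarrow>
      (\<Sum>k. pmf (poisson_pmf c) k * gw_loss \<eta> c k)"
  proof (rule binomial_poisson_tannery(2)[OF c(1) ps p(1) p(2) _ \<kappa>])
    show "(\<lambda>N. mean_loss \<eta> N (?p (Suc N)) k) \<longlonglongrightarrow> gw_loss \<eta> c k" for k
      by (rule mean_loss_tendsto[OF assms(3) c p ps])
    fix N k :: nat assume "k + 0 \<le> N"
    then have "0 \<le> mean_loss \<eta> N (?p (Suc N)) k" "mean_loss \<eta> N (?p (Suc N)) k \<le> (real k + 1) * hc_kappa \<eta>"
      using mean_loss_bounds[OF assms(3) p] by auto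
    moreover have "(real k + 1) * hc_kappa \<eta> \<le> (real k + 2) * hc_kappa \<eta>"
      using \<kappa> by (intro mult_right_mono) auto
    ultimately show "\<bar>mean_loss \<eta> N (?p (Suc N)) k\<bar> \<le> (real k + 2) * hc_kappa \<eta>"
      by linarith
  qed
  have "\<exists>z. (2 \<le> N \<longrightarrow> ?p (Suc N) < z \<and> z < ?p N \<and>
      mean_lnZ \<eta> N (?p N) - mean_lnZ \<eta> N (?p (Suc N)) = (?p N - ?p (Suc N)) * - (real (N choose 2) * mean_edge_loss \<eta> (N - 1) z))" for N
    using MVT2[OF er_prob_decreasing[OF assms(1), of N] mean_lnZ_has_derivative[OF assms(3), of N]] by blast
  then obtain z where z: "\<And>N. 2 \<le> N \<Longrightarrow> ?p (Suc N) < z N" "\<And>N. 2 \<le> N \<Longrightarrow> z N < ?p N"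
     "\<And>N. 2 \<le> N \<Longrightarrow> mean_lnZ \<eta> N (?p N) - mean_lnZ \<eta> N (?p (Suc N)) = (?p N - ?p (Suc N)) * - (real (N choose 2) * mean_edge_loss \<eta> (N - 1) (z N))"
    by metis
  \<comment> \<open>\<open>mean_edge_loss\<close> is evaluated on \<open>M = N - 1\<close> vertices, so the points \<open>z\<close> are indexed by \<open>M\<close>\<close>
  define x where "x M = (if 1 \<le> M then z (Suc M) else 0)" for M
  have x: "0 \<le> x M" "x M \<le> 1" for M
  proof -
    have "1 \<le> M \<Longrightarrow> ?p (Suc (Suc M)) < z (Suc M)" "1 \<le> M \<Longrightarrow> z (Suc M) < ?p (Suc M)"
      by (auto intro!: z)
    then show "0 \<le> x M" "x M \<le> 1"
      using p[of "Suc M"] p[of "Suc (Suc M)"] by (auto simp: x_def)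
  qed
  have xs: "(\<lambda>M. real M * x M) \<longlonglongrightarrow> c"
  proof (rule tendsto_sandwich[where f = "\<lambda>M. real M * ?p (Suc (Suc M))" and h = "\<lambda>M. real M * ?p (Suc M)"])
    show "(\<lambda>M. real M * ?p (Suc (Suc M))) \<longlonglongrightarrow> c" by (rule sparse_Suc[OF ps])
    show "(\<lambda>M. real M * ?p (Suc M)) \<longlonglongrightarrow> c" by (rule ps)
    show "\<forall>\<^sub>F M in sequentially. real M * ?p (Suc (Suc M)) \<le> real M * x M"
      using eventually_ge_at_top[of 1]
      by eventually_elim (auto simp: x_def intro!: mult_left_mono less_imp_le[OF z(1)])
    show "\<forall>\<^sub>F M in sequentially. real M * x M \<le> real M * ?p (Suc M)"
      using eventually_ge_at_top[of 1]
      by eventually_elim (auto simp: x_def intro!: mult_left_mono less_imp_le[OF z(2)])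
  qed
  have S2: "(\<lambda>M. \<Sum>k\<le>M - 1. bcoef M 1 (1 + k) (x M) k * (mean_loss \<eta> M (x M) (Suc k) - mean_loss \<eta> M (x M) k)) \<longlonglongrightarrow>
      (\<Sum>k. pmf (poisson_pmf c) k * (gw_loss \<eta> c (Suc k) - gw_loss \<eta> c k))"
  proof (rule binomial_poisson_tannery(2)[OF c(1) xs x(1) x(2) _ \<kappa>])
    show "(\<lambda>M. mean_loss \<eta> M (x M) (Suc k) - mean_loss \<eta> M (x M) k) \<longlonglongrightarrow> gw_loss \<eta> c (Suc k) - gw_loss \<eta> c k" for k
      by (intro tendsto_diff mean_loss_tendsto assms c x xs)
    fix M k :: nat assume "k + 1 \<le> M"
    then have "0 \<le> mean_loss \<eta> M (x M) k" "mean_loss \<eta> M (x M) k \<le> (real k + 1) * hc_kappa \<eta>"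
      "0 \<le> mean_loss \<eta> M (x M) (Suc k)" "mean_loss \<eta> M (x M) (Suc k) \<le> (real k + 2) * hc_kappa \<eta>"
      using mean_loss_bounds[OF assms(3) x(1) x(2), of k M M] mean_loss_bounds[OF assms(3) x(1) x(2), of "Suc k" M M]
      by (auto simp: add.commute)
    moreover have "(real k + 1) * hc_kappa \<eta> \<le> (real k + 2) * hc_kappa \<eta>"
      using \<kappa> by (intro mult_right_mono) auto
    ultimately show "\<bar>mean_loss \<eta> M (x M) (Suc k) - mean_loss \<eta> M (x M) k\<bar> \<le> (real k + 2) * hc_kappa \<eta>"
      by linarith
  qed
  have S2': "(\<lambda>N. mean_edge_loss \<eta> (N - 1) (x (N - 1))) \<longlonglongrightarrow> (\<Sum>k. pmf (poisson_pmf c) k * (gw_loss \<eta> c (Suc k) - gw_loss \<eta> c k))"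
    using S2[folded mean_edge_loss_def] by (subst filterlim_sequentially_Suc[symmetric]) simp
  have "(\<lambda>N. - (\<Sum>k\<le>N. bcoef N 0 k (?p (Suc N)) k * mean_loss \<eta> N (?p (Suc N)) k)
      + ((?p N - ?p (Suc N)) * real (N choose 2)) * mean_edge_loss \<eta> (N - 1) (x (N - 1))) \<longlonglongrightarrow> free_energy \<eta> \<alpha>"
    unfolding free_energy_def using S1 S2' unfolding c_def
    by (intro tendsto_intros er_prob_increment assms) simp_all
  then show ?thesis
  proof (rule Lim_transform_eventually)
    show "\<forall>\<^sub>F N in sequentially. - (\<Sum>k\<le>N. bcoef N 0 k (?p (Suc N)) k * mean_loss \<eta> N (?p (Suc N)) k)
      + ((?p N - ?p (Suc N)) * real (N choose 2)) * mean_edge_loss \<eta> (N - 1) (x (N - 1)) =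
      mean_lnZ \<eta> (Suc N) (?p (Suc N)) - mean_lnZ \<eta> N (?p N)"
      using eventually_ge_at_top[of 2]
    proof eventually_elim
      case (elim N)
      then have "x (N - 1) = z N" by (simp add: x_def)
      then show ?case
        using z(3)[OF elim] mean_lnZ_Suc[OF assms(3), of N "?p (Suc N)"] by (simp add: algebra_simps)
    qed
  qed
qed

lemma Eb_lnZ_tendsto_L1:
  assumes "0 < \<alpha>" "\<alpha> \<le> 1/2" "0 < \<eta>"
  shows "(\<lambda>N. Eb (er_prob \<alpha> N) (pairs {1..N}) (\<lambda>G. \<bar>ln (hc_Z \<eta> {1..N} G) / real N - free_energy \<eta> \<alpha>\<bar>)) \<longlonglongrightarrow> 0"
proof -
  define K where "K = 2 * hc_kappa \<eta>"
  let ?p = "er_prob \<alpha>" and ?c = "free_energy \<eta> \<alpha>"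
  let ?m = "\<lambda>N. mean_lnZ \<eta> N (?p N)"
  note p = er_prob_bounds[OF assms(1)]
  have K: "0 \<le> K" using hc_kappa_nonneg[OF assms(3)] by (simp add: K_def)
  have ces: "(\<lambda>N. ?m N / real N) \<longlonglongrightarrow> ?c"
    by (rule cesaro_increments[OF mean_lnZ_increment_tendsto[OF assms]])
  have bound: "Eb (?p N) (pairs {1..N}) (\<lambda>G. \<bar>ln (hc_Z \<eta> {1..N} G) / real N - ?c\<bar>) \<le> sqrt (\<alpha> * real N) * K / real N + \<bar>?m N / real N - ?c\<bar>"
    if N: "2 \<le> N" for N
  proof -
    let ?V = "{1..N}" and ?f = "\<lambda>G. ln (hc_Z \<eta> {1..N} G)"
    have fin: "finite (pairs ?V)" by (simp add: finite_pairs)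
    have m: "Eb (?p N) (pairs ?V) ?f = ?m N"
      using Eb_lnZ_eq_mean_lnZ[OF assms(3), of ?V] by simp
    have "Eb (?p N) (pairs ?V) (\<lambda>G. \<bar>?f G - ?m N\<bar>) \<le> sqrt (Eb (?p N) (pairs ?V) (\<lambda>G. (?f G - ?m N)\<^sup>2))"
      by (intro Eb_abs_le_variance fin p)
    also have "\<dots> \<le> sqrt (\<alpha> * real N * K\<^sup>2)"
    proof (rule real_sqrt_le_mono)
      have "Eb (?p N) (pairs ?V) (\<lambda>G. (?f G - ?m N)\<^sup>2) \<le> real (card (pairs ?V)) * ?p N * K\<^sup>2"
        unfolding m[symmetric]
        by (intro Eb_variance_Efron_Stein fin p) (use ln_hc_Z_add_edge[OF assms(3), of ?V] in \<open>auto simp: K_def\<close>)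
      also have "\<dots> \<le> real (card (pairs ?V)) * (2 * \<alpha> / (real N - 1)) * K\<^sup>2"
        using er_prob_le[OF assms(1) N] by (intro mult_right_mono mult_left_mono) auto
      also have "real (card (pairs ?V)) * (2 * \<alpha> / (real N - 1)) = \<alpha> * real N"
        using N by (simp add: card_pairs choose_two real_of_nat_div of_nat_diff)
      finally show "Eb (?p N) (pairs ?V) (\<lambda>G. (?f G - ?m N)\<^sup>2) \<le> \<alpha> * real N * K\<^sup>2" .
    qed
    also have "\<dots> = sqrt (\<alpha> * real N) * K"
      using K by (simp add: real_sqrt_mult)
    finally have 1: "Eb (?p N) (pairs ?V) (\<lambda>G. \<bar>?f G - ?m N\<bar>) \<le> sqrt (\<alpha> * real N) * K" .
    have "Eb (?p N) (pairs ?V) (\<lambda>G. \<bar>?f G / real N - ?c\<bar>) \<le>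
       Eb (?p N) (pairs ?V) (\<lambda>G. inverse (real N) * \<bar>?f G - ?m N\<bar> + \<bar>?m N / real N - ?c\<bar>)"
    proof (intro Eb_mono p)
      fix G
      have "\<bar>?f G / real N - ?c\<bar> = \<bar>(?f G - ?m N) / real N + (?m N / real N - ?c)\<bar>"
        by (simp add: diff_divide_distrib)
      also have "\<dots> \<le> \<bar>(?f G - ?m N) / real N\<bar> + \<bar>?m N / real N - ?c\<bar>"
        by (rule abs_triangle_ineq)
      finally show "\<bar>?f G / real N - ?c\<bar> \<le> inverse (real N) * \<bar>?f G - ?m N\<bar> + \<bar>?m N / real N - ?c\<bar>"
        by (simp add: divide_inverse abs_mult mult.commute[of _ "inverse (real N)"])
    qed
    also have "\<dots> = inverse (real N) * Eb (?p N) (pairs ?V) (\<lambda>G. \<bar>?f G - ?m N\<bar>) + \<bar>?m N / real N - ?c\<bar>"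
      using fin by (simp add: Eb_add Eb_cmult)
    also have "\<dots> \<le> inverse (real N) * (sqrt (\<alpha> * real N) * K) + \<bar>?m N / real N - ?c\<bar>"
      using 1 by (intro add_right_mono mult_left_mono) auto
    finally show ?thesis by (simp add: divide_inverse mult.commute)
  qed
  have "(\<lambda>N. sqrt (\<alpha> * real N) / real N) \<longlonglongrightarrow> 0"
    using assms(1) by real_asymp
  then have "(\<lambda>N. sqrt (\<alpha> * real N) / real N * K + \<bar>?m N / real N - ?c\<bar>) \<longlonglongrightarrow> 0 * K + \<bar>?c - ?c\<bar>"
    by (intro tendsto_intros ces)
  then have lim: "(\<lambda>N. sqrt (\<alpha> * real N) * K / real N + \<bar>?m N / real N - ?c\<bar>) \<longlonglongrightarrow> 0"
    by simp
  show ?thesis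
  proof (rule tendsto_sandwich[OF _ _ tendsto_const lim])
    show "\<forall>\<^sub>F N in sequentially. 0 \<le> Eb (?p N) (pairs {1..N}) (\<lambda>G. \<bar>ln (hc_Z \<eta> {1..N} G) / real N - ?c\<bar>)"
      by (intro always_eventually allI Eb_nonneg p) auto
    show "\<forall>\<^sub>F N in sequentially. Eb (?p N) (pairs {1..N}) (\<lambda>G. \<bar>ln (hc_Z \<eta> {1..N} G) / real N - ?c\<bar>) \<le> sqrt (\<alpha> * real N) * K / real N + \<bar>?m N / real N - ?c\<bar>"
      using eventually_ge_at_top[of 2] by eventually_elim (rule bound)
  qed
qed

section \<open>Measurability of the update\<close>

lemma bounded_linear_eval: "bounded_linear (\<lambda>f :: real \<Rightarrow>\<^sub>C real. apply_bcontfun f t)"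
proof (rule bounded_linear_intro[where K = 1])
  show "norm (apply_bcontfun f t) \<le> norm f * 1" for f :: "real \<Rightarrow>\<^sub>C real"
    using norm_bounded[of f t] by simp
qed auto

lemma bounded_linear_cdf01:
  assumes "0 \<le> s"
  shows "bounded_linear (\<lambda>f. cdf01 f s)"
proof (rule bounded_linear_intro[where K = s])
  show "cdf01 (f + g) s = cdf01 f s + cdf01 g s" for f g
    by (simp add: cdf01_def integral_add bcontfun_integrable)
  show "cdf01 (r *\<^sub>R f) s = r *\<^sub>R cdf01 f s" for r f
    by (simp add: cdf01_def)
  show "norm (cdf01 f s) \<le> norm f * s" for f
    using integral_bound[of 0 s "apply_bcontfun f" "norm f"] norm_bounded[of f] assms by (simp add: cdf01_def)
qed

lemma bounded_linear_borel:
  fixes g :: "(real \<Rightarrow>\<^sub>C real) \<Rightarrow> real"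
  assumes "bounded_linear g"
  shows "g \<in> borel_measurable borel"
  by (intro borel_measurable_continuous_onI linear_continuous_on assms)

lemma to_C01_Bernstein: "apply_bcontfun (to_C01 (Bernstein j i)) x = Bernstein j i (clamp 0 1 x)"
  by (rule apply_to_C01) (auto simp: Bernstein_def[abs_def] intro!: continuous_intros)

text \<open>
  Integrals and, in \<open>Bernstein_C01_LIMSEQ\<close>, functions are limits of expressions in finitely many
  point evaluations, which reduces measurability to that of real random variables. The Borel sets of
  the nonseparable space of bounded continuous functions need not be generated by balls.
\<close>

lemma Bernstein_integral_LIMSEQ:
  assumes "continuous_on {0..1} g"
  shows "(\<lambda>j. \<Sum>i\<le>j. g (real i / real j) * integral {0..1} (Bernstein j i)) \<longlonglongrightarrow> integral {0..1} g"
proof (rule tendstoI)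
  fix e :: real assume e: "0 < e"
  have c: "continuous_on {0..1} (Bernstein j i)" for j i
    by (auto simp: Bernstein_def[abs_def] intro!: continuous_intros)
  obtain N where N: "\<And>n x. N \<le> n \<Longrightarrow> x \<in> {0..1} \<Longrightarrow> \<bar>g x - (\<Sum>k\<le>n. g (k / n) * Bernstein n k x)\<bar> < e / 2"
    using Bernstein_Weierstrass[OF assms, of "e/2"] e by auto
  show "\<forall>\<^sub>F j in sequentially. dist (\<Sum>i\<le>j. g (real i / real j) * integral {0..1} (Bernstein j i)) (integral {0..1} g) < e"
    using eventually_ge_at_top[of N]
  proof eventually_elim
    case (elim j)
    have cs: "continuous_on {0..1} (\<lambda>x. \<Sum>i\<le>j. g (real i / real j) * Bernstein j i x)"
      by (intro continuous_intros c)
    have "(\<Sum>i\<le>j. g (real i / real j) * integral {0..1} (Bernstein j i)) = integral {0..1} (\<lambda>x. \<Sum>i\<le>j. g (real i / real j) * Bernstein j i x)"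
      by (subst integral_sum) (auto intro!: integrable_continuous_interval continuous_intros c)
    then have "integral {0..1} g - (\<Sum>i\<le>j. g (real i / real j) * integral {0..1} (Bernstein j i)) =
        integral {0..1} (\<lambda>x. g x - (\<Sum>i\<le>j. g (real i / real j) * Bernstein j i x))"
      using assms cs by (simp add: integral_diff integrable_continuous_interval)
    also have "norm \<dots> \<le> e / 2 * (1 - 0)"
      using N[OF elim] assms cs by (intro integral_bound continuous_on_diff) (auto intro: less_imp_le)
    finally show ?case
      using e by (simp add: dist_real_def abs_minus_commute)
  qed
qed

lemma Bernstein_C01_LIMSEQ:
  assumes "f \<in> C01"
  shows "(\<lambda>j. \<Sum>i\<le>j. apply_bcontfun f (real i / real j) *\<^sub>R to_C01 (Bernstein j i)) \<longlonglongrightarrow> f"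
proof (rule tendstoI)
  fix e :: real assume e: "0 < e"
  let ?g = "apply_bcontfun f"
  obtain N where N: "\<And>n x. N \<le> n \<Longrightarrow> x \<in> {0..1} \<Longrightarrow> \<bar>?g x - (\<Sum>k\<le>n. ?g (k / n) * Bernstein n k x)\<bar> < e / 2"
    using Bernstein_Weierstrass[of ?g "e/2"] e by auto
  show "\<forall>\<^sub>F j in sequentially. dist (\<Sum>i\<le>j. ?g (real i / real j) *\<^sub>R to_C01 (Bernstein j i)) f < e"
    using eventually_ge_at_top[of N]
  proof eventually_elim
    case (elim j)
    let ?s = "\<Sum>i\<le>j. ?g (real i / real j) *\<^sub>R to_C01 (Bernstein j i)"
    have "norm (f - ?s) \<le> e / 2"
    proof (rule norm_bound)
      fix x :: real
      have "apply_bcontfun ?s x = (\<Sum>i\<le>j. apply_bcontfun (?g (real i / real j) *\<^sub>R to_C01 (Bernstein j i)) x)"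
        by (rule linear_sum[OF bounded_linear.linear[OF bounded_linear_eval]])
      also have "\<dots> = (\<Sum>i\<le>j. ?g (real i / real j) * Bernstein j i (clamp 0 1 x))"
        by (simp add: to_C01_Bernstein)
      finally have "apply_bcontfun (f - ?s) x = ?g (clamp 0 1 x) - (\<Sum>i\<le>j. ?g (real i / real j) * Bernstein j i (clamp 0 1 x))"
        using assms by (simp add: C01_def)
      then show "norm (apply_bcontfun (f - ?s) x) \<le> e / 2"
        using N[OF elim, of "clamp 0 1 x"] clamp01_bounds[of x] by simp
    qed
    then show ?case
      using e by (simp add: dist_norm norm_minus_commute)
  qed
qed

text \<open>
  A random sequence of densities, indexed from \<open>1\<close> as in \<open>hc_space\<close>.
\<close>

locale message_family =
  fixes N :: "'a measure" and F :: "'a \<Rightarrow> nat \<Rightarrow> (real \<Rightarrow>\<^sub>C real)"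
  assumes F_measurable: "\<And>k. 1 \<le> k \<Longrightarrow> (\<lambda>x. F x k) \<in> borel_measurable N"
    and F_X0: "\<And>x k. x \<in> space N \<Longrightarrow> 1 \<le> k \<Longrightarrow> F x k \<in> X0"
begin

lemma cdf_measurable: "1 \<le> k \<Longrightarrow> 0 \<le> s \<Longrightarrow> (\<lambda>x. cdf01 (F x k) s) \<in> borel_measurable N"
  by (rule measurable_compose[OF F_measurable bounded_linear_borel[OF bounded_linear_cdf01]])

lemma eval_measurable: "1 \<le> k \<Longrightarrow> (\<lambda>x. apply_bcontfun (F x k) s) \<in> borel_measurable N"
  by (rule measurable_compose[OF F_measurable bounded_linear_borel[OF bounded_linear_eval]])

lemma weight_measurable: "t \<le> 1 \<Longrightarrow> (\<lambda>x. hc_weight \<eta> n (F x) t) \<in> borel_measurable N"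
  unfolding hc_weight_def by (intro borel_measurable_times borel_measurable_prod cdf_measurable) auto

lemma integral_measurable:
  fixes g :: "'a \<Rightarrow> real \<Rightarrow> real"
  assumes "\<And>t. 0 \<le> t \<Longrightarrow> t \<le> 1 \<Longrightarrow> (\<lambda>x. g x t) \<in> borel_measurable N" "\<And>x. continuous_on {0..1} (g x)"
  shows "(\<lambda>x. integral {0..1} (g x)) \<in> borel_measurable N"
proof (rule borel_measurable_LIMSEQ_metric)
  show "(\<lambda>j. \<Sum>i\<le>j. g x (real i / real j) * integral {0..1} (Bernstein j i)) \<longlonglongrightarrow> integral {0..1} (g x)" for x
    by (rule Bernstein_integral_LIMSEQ[OF assms(2)])
  show "(\<lambda>x. \<Sum>i\<le>j. g x (real i / real j) * integral {0..1} (Bernstein j i)) \<in> borel_measurable N" for j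
    by (intro borel_measurable_sum borel_measurable_times assms(1)) (auto simp: divide_le_eq_1)
qed

lemma norm_const_measurable: "0 < \<eta> \<Longrightarrow> (\<lambda>x. hc_norm_const \<eta> n (F x)) \<in> borel_measurable N"
  unfolding hc_norm_const_def by (intro integral_measurable weight_measurable continuous_on_hc_weight) auto

lemma edge_integral_measurable: "(\<lambda>x. edge_integral (F x)) \<in> borel_measurable N"
  unfolding edge_integral_def
  by (intro integral_measurable borel_measurable_times cdf_measurable eval_measurable
      continuous_on_mult continuous_on_cdf01_flip) auto

lemma update_list:
  assumes "x \<in> space N"
  shows "hc_update \<eta> n (F x) = hc_upd \<eta> (map (F x) [1..<Suc n])" "set (map (F x) [1..<Suc n]) \<subseteq> X0"
proof -
  show "hc_update \<eta> n (F x) = hc_upd \<eta> (map (F x) [1..<Suc n])"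
    using hc_update_list[of "map (F x) [1..<Suc n]" "F x" \<eta>] by (simp del: upt_Suc)
  show "set (map (F x) [1..<Suc n]) \<subseteq> X0"
    using F_X0[OF assms] by auto
qed

lemma update_X0: "0 < \<eta> \<Longrightarrow> x \<in> space N \<Longrightarrow> hc_update \<eta> n (F x) \<in> X0"
  unfolding update_list(1) by (rule hc_upd_X0, assumption, rule update_list(2))

lemma update_measurable:
  assumes "0 < \<eta>"
  shows "(\<lambda>x. hc_update \<eta> n (F x)) \<in> borel_measurable N"
proof (rule borel_measurable_LIMSEQ_metric)
  fix x assume x: "x \<in> space N"
  show "(\<lambda>j. \<Sum>i\<le>j. apply_bcontfun (hc_update \<eta> n (F x)) (real i / real j) *\<^sub>R to_C01 (Bernstein j i)) \<longlonglongrightarrow> hc_update \<eta> n (F x)"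
    using update_X0[OF assms x] by (intro Bernstein_C01_LIMSEQ) (auto simp: X0_def)
next
  fix j
  let ?h = "\<lambda>a. \<Sum>i\<le>j. a i *\<^sub>R to_C01 (Bernstein j i)"
  have h: "?h \<in> borel_measurable borel"
    by (intro borel_measurable_continuous_onI continuous_on_sum continuous_on_scaleR continuous_on_product_coordinates continuous_on_const)
  have ev: "(\<lambda>x. apply_bcontfun (hc_update \<eta> n (F x)) (real i / real j)) \<in> borel_measurable N" if "i \<le> j" for i
  proof -
    define t where "t = real i / real j"
    have t: "0 \<le> t" "t \<le> 1" using that by (auto simp: t_def divide_le_eq_1)
    have "(\<lambda>x. hc_weight \<eta> n (F x) t / hc_norm_const \<eta> n (F x)) \<in> borel_measurable N"
      using assms t by (intro borel_measurable_divide weight_measurable norm_const_measurable)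
    also have "?this \<longleftrightarrow> (\<lambda>x. apply_bcontfun (hc_update \<eta> n (F x)) t) \<in> borel_measurable N"
      using assms t F_X0
      by (intro measurable_cong) (subst hc_update_apply, auto simp: hc_weight_def[abs_def] hc_norm_const_def)
    finally show ?thesis by (simp add: t_def)
  qed
  have "(\<lambda>x i. if i \<le> j then apply_bcontfun (hc_update \<eta> n (F x)) (real i / real j) else 0) \<in> borel_measurable N"
  proof (rule measurable_coordinatewise_then_product)
    fix i
    show "(\<lambda>x. if i \<le> j then apply_bcontfun (hc_update \<eta> n (F x)) (real i / real j) else 0) \<in> borel_measurable N"
      by (cases "i \<le> j") (simp_all add: ev)
  qed
  from measurable_compose[OF this h]
  have "(\<lambda>x. ?h (\<lambda>i. if i \<le> j then apply_bcontfun (hc_update \<eta> n (F x)) (real i / real j) else 0)) \<in> borel_measurable N" .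
  moreover have "?h (\<lambda>i. if i \<le> j then apply_bcontfun (hc_update \<eta> n (F x)) (real i / real j) else 0) =
      (\<Sum>i\<le>j. apply_bcontfun (hc_update \<eta> n (F x)) (real i / real j) *\<^sub>R to_C01 (Bernstein j i))" for x
    by (intro sum.cong refl) simp
  ultimately show "(\<lambda>x. \<Sum>i\<le>j. apply_bcontfun (hc_update \<eta> n (F x)) (real i / real j) *\<^sub>R to_C01 (Bernstein j i)) \<in> borel_measurable N"
    by (simp only:)
qed

end

abbreviation "RX0 \<equiv> restrict_space (borel :: (real \<Rightarrow>\<^sub>C real) measure) X0"

section \<open>The operator on atoms\<close>

locale message_law = prob_space \<mu> for \<mu> :: "(real \<Rightarrow>\<^sub>C real) measure" +
  fixes \<eta> \<alpha> :: real
  assumes sets_mu: "sets \<mu> = sets RX0" and eta: "0 < \<eta>" and alpha: "0 < \<alpha>"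
begin

lemma space_mu: "space \<mu> = X0"
  using sets_eq_imp_space_eq[OF sets_mu] by (simp add: space_restrict_space)

abbreviation "S \<equiv> hc_space \<alpha> \<mu>"

sublocale prodS: product_prob_space "\<lambda>_. \<mu>" "{1::nat..}"
  by (simp add: product_prob_space_def product_prob_space_axioms_def product_sigma_finite_def prob_space_axioms prob_space_imp_sigma_finite)

sublocale S: prob_space S
  unfolding hc_space_def by (intro prob_space_pair measure_pmf.prob_space_axioms prob_space_PiM prob_space_axioms)

lemma sets_S: "sets S = sets (count_space UNIV \<Otimes>\<^sub>M (\<Pi>\<^sub>M k\<in>{1..}. \<mu>))"
  unfolding hc_space_def by (intro sets_pair_measure_cong) auto

lemma space_S: "space S = UNIV \<times> space (\<Pi>\<^sub>M k\<in>{1::nat..}. \<mu>)"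
  by (simp add: hc_space_def space_pair_measure)

sublocale PF: message_family "\<Pi>\<^sub>M k\<in>{1..}. \<mu>" "\<lambda>f. f"
proof
  have *: "(\<lambda>f. f) \<in> borel_measurable \<mu>"
    unfolding measurable_cong_sets[OF sets_mu refl] by (rule measurable_restrict_space1) simp
  show "(\<lambda>f. f k) \<in> borel_measurable (\<Pi>\<^sub>M k\<in>{1..}. \<mu>)" if "1 \<le> k" for k
  proof -
    have "(\<lambda>f. f k) \<in> measurable (\<Pi>\<^sub>M k\<in>{1..}. \<mu>) \<mu>"
      by (rule measurable_component_singleton) (use that in auto)
    from measurable_compose[OF this, of "\<lambda>f. f" borel] * show ?thesis by simp
  qed
  show "f k \<in> X0" if "f \<in> space (\<Pi>\<^sub>M k\<in>{1..}. \<mu>)" "1 \<le> k" for f k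
    using that space_mu by (auto simp: space_PiM PiE_iff)
qed

lemma measurable_S:
  assumes "\<And>n. (\<lambda>f. g n f) \<in> measurable (\<Pi>\<^sub>M k\<in>{1..}. \<mu>) K"
  shows "(\<lambda>(n, f). g n f) \<in> measurable S K"
  unfolding measurable_cong_sets[OF sets_S refl]
  using assms by (intro measurable_pair_measure_countable1) auto

lemma update_measurable_S: "(\<lambda>(n, f). hc_update \<eta> n f) \<in> measurable S RX0"
  by (intro measurable_S measurable_restrict_space2 PF.update_measurable eta)
     (auto intro!: PF.update_X0 eta)

lemma T_prob: "prob_space (T_hc \<eta> \<alpha> \<mu>)"
  unfolding T_hc_def by (rule S.prob_space_distr[OF update_measurable_S])

lemma sets_T: "sets (T_hc \<eta> \<alpha> \<mu>) = sets RX0"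
  by (simp add: T_hc_def)

lemma singleton_sets: "f \<in> X0 \<Longrightarrow> {f} \<in> sets \<mu>"
  unfolding sets_mu sets_restrict_space by (intro image_eqI[of _ _ "{f}"]) auto

lemma atom_off_X0: "f \<notin> X0 \<Longrightarrow> emeasure \<mu> {f} = 0"
  using sets.sets_into_space[of "{f}" \<mu>] by (intro emeasure_notin_sets) (auto simp: space_mu)

text \<open>
  With \<open>D = {length cs}\<close> the whole input of an update is prescribed, with \<open>D = UNIV\<close> only the first
  densities of the sequence, as the edge term requires.
\<close>

definition cylinder :: "nat set \<Rightarrow> (real \<Rightarrow>\<^sub>C real) list \<Rightarrow> (nat \<times> (nat \<Rightarrow> (real \<Rightarrow>\<^sub>C real))) set" where
  "cylinder D cs = D \<times> {f \<in> space (\<Pi>\<^sub>M k\<in>{1..}. \<mu>). \<forall>i\<in>{1..length cs}. f i \<in> {cs ! (i - 1)}}"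

lemma cylinder_measurable:
  assumes "set cs \<subseteq> X0"
  shows "{f \<in> space (\<Pi>\<^sub>M k\<in>{1..}. \<mu>). \<forall>i\<in>{1..length cs}. f i \<in> {cs ! (i - 1)}} \<in> sets (\<Pi>\<^sub>M k\<in>{1..}. \<mu>)"
    "cylinder D cs \<in> sets S"
proof -
  have X0: "cs ! (i - 1) \<in> X0" if "i \<in> {1..length cs}" for i
    using assms that by (auto intro!: subsetD[OF assms] nth_mem)
  show 1: "{f \<in> space (\<Pi>\<^sub>M k\<in>{1..}. \<mu>). \<forall>i\<in>{1..length cs}. f i \<in> {cs ! (i - 1)}} \<in> sets (\<Pi>\<^sub>M k\<in>{1..}. \<mu>)"
  proof (intro sets.sets_Collect_finite_All)
    fix i assume i: "i \<in> {1..length cs}"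
    have "(\<lambda>f. f i) -` {cs ! (i - 1)} \<inter> space (\<Pi>\<^sub>M k\<in>{1..}. \<mu>) \<in> sets (\<Pi>\<^sub>M k\<in>{1..}. \<mu>)"
      using i X0[OF i] by (intro measurable_sets[OF measurable_component_singleton] singleton_sets) auto
    also have "(\<lambda>f. f i) -` {cs ! (i - 1)} \<inter> space (\<Pi>\<^sub>M k\<in>{1..}. \<mu>) = {f \<in> space (\<Pi>\<^sub>M k\<in>{1..}. \<mu>). f i \<in> {cs ! (i - 1)}}"
      by auto
    finally show "{f \<in> space (\<Pi>\<^sub>M k\<in>{1..}. \<mu>). f i \<in> {cs ! (i - 1)}} \<in> sets (\<Pi>\<^sub>M k\<in>{1..}. \<mu>)" .
  qed auto
  show "cylinder D cs \<in> sets S"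
    unfolding cylinder_def sets_S using 1 by (intro pair_measureI) auto
qed

lemma emeasure_cylinder:
  assumes "set cs \<subseteq> X0"
  shows "emeasure S (cylinder D cs) = emeasure (poisson_pmf (2 * \<alpha>)) D * (\<Prod>c\<leftarrow>cs. emeasure \<mu> {c})"
proof -
  have P: "sigma_finite_measure (\<Pi>\<^sub>M k\<in>{1::nat..}. \<mu>)"
    by (intro prob_space_imp_sigma_finite prob_space_PiM prob_space_axioms)
  have "emeasure S (cylinder D cs) = emeasure (poisson_pmf (2 * \<alpha>)) D *
      emeasure (\<Pi>\<^sub>M k\<in>{1..}. \<mu>) {f \<in> space (\<Pi>\<^sub>M k\<in>{1..}. \<mu>). \<forall>i\<in>{1..length cs}. f i \<in> {cs ! (i - 1)}}"
    unfolding cylinder_def hc_space_def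
    by (intro sigma_finite_measure.emeasure_pair_measure_Times P cylinder_measurable(1)[OF assms]) simp
  also have "emeasure (\<Pi>\<^sub>M k\<in>{1..}. \<mu>) {f \<in> space (\<Pi>\<^sub>M k\<in>{1..}. \<mu>). \<forall>i\<in>{1..length cs}. f i \<in> {cs ! (i - 1)}} =
      (\<Prod>i\<in>{1..length cs}. emeasure \<mu> {cs ! (i - 1)})"
    using assms by (intro prodS.emeasure_PiM_Collect) (auto intro!: singleton_sets subsetD[OF assms] nth_mem)
  also have "\<dots> = (\<Prod>c\<leftarrow>cs. emeasure \<mu> {c})"
    by (simp add: prod.atLeast1_atMost_eq prod.list_conv_set_nth atLeast0LessThan)
  finally show ?thesis .
qed

lemma cylinder_update:
  assumes "x \<in> cylinder {length cs} cs"
  shows "(case x of (n, f) \<Rightarrow> hc_update \<eta> n f) = hc_upd \<eta> cs" "(case x of (n, f) \<Rightarrow> hc_norm_const \<eta> n f) = hc_nrm \<eta> cs"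
proof -
  obtain f where f: "x = (length cs, f)" "\<And>i. i < length cs \<Longrightarrow> f (Suc i) = cs ! i"
    using assms by (auto simp: cylinder_def)
  show "(case x of (n, f) \<Rightarrow> hc_update \<eta> n f) = hc_upd \<eta> cs" "(case x of (n, f) \<Rightarrow> hc_norm_const \<eta> n f) = hc_nrm \<eta> cs"
    using f by (auto intro!: hc_update_list hc_norm_const_list)
qed

lemma cylinder_disjoint:
  assumes "x \<in> cylinder D cs" "x \<in> cylinder D' ds" "length cs = length ds"
  shows "cs = ds"
proof (rule nth_equalityI[OF assms(3)])
  fix i assume "i < length cs"
  then show "cs ! i = ds ! i"
    using assms by (auto simp: cylinder_def dest!: bspec[of _ _ "Suc i"])
qed

text \<open>
  The cylinders of the lists of atoms that are updated to \<open>f\<close> are disjoint and contained in the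
  preimage of \<open>f\<close>. Only countably many lists carry mass.
\<close>

lemma T_atoms:
  assumes "\<And>f. w f \<le> emeasure \<mu> {f}"
  shows "gw_op \<eta> (2 * \<alpha>) w f \<le> emeasure (T_hc \<eta> \<alpha> \<mu>) {f}"
proof -
  define C where "C = {f. measure \<mu> {f} \<noteq> 0}"
  have wC: "f \<in> C" if "w f \<noteq> 0" for f
    using assms[of f] that by (auto simp: C_def emeasure_eq_measure)
  have CX0: "C \<subseteq> X0"
  proof
    fix f assume "f \<in> C"
    then have "emeasure \<mu> {f} \<noteq> 0" by (auto simp: C_def measure_def)
    then show "f \<in> X0" using atom_off_X0 by blast
  qed
  have "countable C" unfolding C_def by (rule countable_support)
  define L where "L = {cs \<in> lists C. hc_upd \<eta> cs = f}"
  have L: "countable L" "\<And>cs. cs \<in> L \<Longrightarrow> set cs \<subseteq> X0"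
    using \<open>countable C\<close> CX0 by (auto simp: L_def intro: countable_subset[OF _ countable_lists])
  have L1: "\<And>cs. cs \<in> L \<Longrightarrow> hc_upd \<eta> cs = f" by (auto simp: L_def)
  let ?A = "\<lambda>cs. cylinder {length cs} cs"
  have "gw_op \<eta> (2 * \<alpha>) w f \<le> (\<Sum>\<^sup>+cs. emeasure S (?A cs) * indicator L cs)"
    unfolding gw_op_def
  proof (intro nn_integral_mono)
    fix cs
    show "(if hc_upd \<eta> cs = f then ennreal (pmf (poisson_pmf (2 * \<alpha>)) (length cs)) * prod_list (map w cs) else 0)
       \<le> emeasure S (?A cs) * indicator L cs"
    proof (cases "hc_upd \<eta> cs = f \<and> prod_list (map w cs) \<noteq> 0")
      case True
      then have "cs \<in> L"
        using wC by (auto simp: L_def prod_list_eq_0_ennreal image_iff)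
      then show ?thesis
        using True assms L by (auto simp: emeasure_cylinder emeasure_pmf_single intro!: mult_left_mono prod_list_mono_ennreal)
    qed auto
  qed
  also have "\<dots> = (\<integral>\<^sup>+cs. emeasure S (?A cs) \<partial>count_space L)"
    by (subst nn_integral_count_space_indicator) auto
  also have "\<dots> = emeasure S (\<Union>cs\<in>L. ?A cs)"
  proof (intro emeasure_UN_countable[symmetric] L cylinder_measurable)
    show "disjoint_family_on ?A L"
      unfolding disjoint_family_on_def
    proof (intro ballI impI)
      fix cs ds assume "cs \<in> L" "ds \<in> L" "cs \<noteq> ds"
      have "x \<notin> ?A ds" if x: "x \<in> ?A cs" for x
      proof
        assume "x \<in> ?A ds"
        moreover from this x have "length cs = length ds" by (auto simp: cylinder_def)
        ultimately show False using cylinder_disjoint[OF x] \<open>cs \<noteq> ds\<close> by blast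
      qed
      then show "?A cs \<inter> ?A ds = {}" by blast
    qed
  qed
  also have "\<dots> \<le> emeasure (T_hc \<eta> \<alpha> \<mu>) {f}"
  proof (cases "f \<in> X0")
    case True
    then have f: "{f} \<in> sets RX0"
      using singleton_sets by (simp add: sets_mu)
    have "(\<Union>cs\<in>L. ?A cs) \<subseteq> (\<lambda>(n, f). hc_update \<eta> n f) -` {f} \<inter> space S"
    proof
      fix x assume "x \<in> (\<Union>cs\<in>L. ?A cs)"
      then obtain cs where cs: "cs \<in> L" "x \<in> ?A cs" by blast
      have "(case x of (n, f) \<Rightarrow> hc_update \<eta> n f) = f"
        using cylinder_update(1)[OF cs(2)] L1[OF cs(1)] by simp
      moreover have "x \<in> space S"
        using cs(2) by (auto simp: space_S cylinder_def)
      ultimately show "x \<in> (\<lambda>(n, f). hc_update \<eta> n f) -` {f} \<inter> space S"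
        by simp
    qed
    then show ?thesis
      unfolding T_hc_def emeasure_distr[OF update_measurable_S f]
      by (intro emeasure_mono measurable_sets[OF update_measurable_S] f)
  next
    case False
    then have "L = {}"
      using L hc_upd_X0[OF eta] L1 by blast
    then show ?thesis by simp
  qed
  finally show ?thesis .
qed

end

text \<open>
  Countably many disjoint events of total mass one turn an expectation into a sum.
\<close>

lemma (in prob_space) countable_partition:
  fixes A :: "'i \<Rightarrow> 'a set"
  assumes "countable I" "\<And>i. i \<in> I \<Longrightarrow> A i \<in> events" "disjoint_family_on A I"
    and "(\<integral>\<^sup>+i. emeasure M (A i) \<partial>count_space I) = 1"
  shows "AE x in M. \<exists>i\<in>I. x \<in> A i"
    and "\<And>\<psi>. (\<And>i x. i \<in> I \<Longrightarrow> x \<in> A i \<Longrightarrow> \<Psi> x = \<psi> i) \<Longrightarrow>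
       (\<integral>\<^sup>+x. \<Psi> x \<partial>M) = (\<integral>\<^sup>+i. \<psi> i * emeasure M (A i) \<partial>count_space I)"
proof -
  have "emeasure M (\<Union>i\<in>I. A i) = 1"
    using assms by (simp add: emeasure_UN_countable)
  then have "prob (\<Union>i\<in>I. A i) = 1"
    by (simp add: emeasure_eq_measure)
  from AE_prob_1[OF this] show ae: "AE x in M. \<exists>i\<in>I. x \<in> A i" by simp
  fix \<psi> assume \<psi>: "\<And>i x. i \<in> I \<Longrightarrow> x \<in> A i \<Longrightarrow> \<Psi> x = \<psi> i"
  have "(\<integral>\<^sup>+x. \<Psi> x \<partial>M) = (\<integral>\<^sup>+x. (\<integral>\<^sup>+i. \<psi> i * indicator (A i) x \<partial>count_space I) \<partial>M)"
  proof (rule nn_integral_cong_AE, use ae in eventually_elim)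
    fix x assume "\<exists>i\<in>I. x \<in> A i"
    then obtain i where i: "i \<in> I" "x \<in> A i" by blast
    have only: "x \<in> A j \<longleftrightarrow> j = i" if "j \<in> I" for j
      using disjoint_family_onD[OF assms(3) that i(1)] i(2) by blast
    have "(\<integral>\<^sup>+j. \<psi> j * indicator (A j) x \<partial>count_space I) = (\<integral>\<^sup>+j. \<psi> i * indicator {i} j \<partial>count_space I)"
      by (intro nn_integral_cong) (simp add: only indicator_def)
    also have "\<dots> = \<psi> i"
      using i by (simp add: nn_integral_cmult)
    finally show "\<Psi> x = (\<integral>\<^sup>+j. \<psi> j * indicator (A j) x \<partial>count_space I)"
      using \<psi>[OF i] by simp
  qed
  also have "\<dots> = (\<integral>\<^sup>+i. (\<integral>\<^sup>+x. \<psi> i * indicator (A i) x \<partial>M) \<partial>count_space I)"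
    using assms by (intro nn_integral_count_space_nn_integral) auto
  also have "\<dots> = (\<integral>\<^sup>+i. \<psi> i * emeasure M (A i) \<partial>count_space I)"
    using assms by (intro nn_integral_cong) (simp add: nn_integral_cmult)
  finally show "(\<integral>\<^sup>+x. \<Psi> x \<partial>M) = (\<integral>\<^sup>+i. \<psi> i * emeasure M (A i) \<partial>count_space I)" .
qed

section \<open>Existence and uniqueness of the fixed point\<close>

text \<open>
  The weights vanish outside \<open>X0\<close>. The counting measure on the discrete \<open>\<sigma>\<close>-algebra is transported to
  the Borel sets, where the operator is defined.
\<close>

definition gw_law :: "real \<Rightarrow> real \<Rightarrow> (real \<Rightarrow>\<^sub>C real) measure" where
  "gw_law \<eta> c = distr (density (count_space X0) (gw \<eta> c)) RX0 (\<lambda>f. f)"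

lemma id_measurable_count_X0: "(\<lambda>f. f) \<in> measurable (density (count_space X0) w) RX0"
  by (subst measurable_cong_sets[OF sets_density refl]) (auto simp: space_restrict_space)

lemma gw_off_X0: "0 < \<eta> \<Longrightarrow> 0 < c \<Longrightarrow> c \<le> 1 \<Longrightarrow> f \<notin> X0 \<Longrightarrow> gw \<eta> c f = 0"
  using gw_X1[of \<eta> c f] by (auto simp: X1_def)

lemma nn_integral_gw_law:
  assumes "0 < \<eta>" "0 < c" "c \<le> 1" "h \<in> borel_measurable RX0"
  shows "(\<integral>\<^sup>+f. h f \<partial>gw_law \<eta> c) = (\<Sum>\<^sup>+f. gw \<eta> c f * h f)"
proof -
  have "(\<integral>\<^sup>+f. h f \<partial>gw_law \<eta> c) = (\<integral>\<^sup>+f. h f \<partial>density (count_space X0) (gw \<eta> c))"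
    unfolding gw_law_def using assms(4) by (intro nn_integral_distr id_measurable_count_X0) simp
  also have "\<dots> = (\<integral>\<^sup>+f. gw \<eta> c f * h f \<partial>count_space X0)"
    by (rule nn_integral_density) auto
  also have "\<dots> = (\<Sum>\<^sup>+f. gw \<eta> c f * h f * indicator X0 f)"
    by (subst nn_integral_count_space_indicator) auto
  also have "\<dots> = (\<Sum>\<^sup>+f. gw \<eta> c f * h f)"
    using gw_off_X0[OF assms(1-3)] by (intro nn_integral_cong) (auto simp: indicator_def)
  finally show ?thesis .
qed

lemma sets_gw_law: "sets (gw_law \<eta> c) = sets RX0"
  by (simp add: gw_law_def)

lemma emeasure_gw_law:
  assumes "0 < \<eta>" "0 < c" "c \<le> 1" "A \<in> sets RX0"
  shows "emeasure (gw_law \<eta> c) A = (\<Sum>\<^sup>+f. gw \<eta> c f * indicator A f)"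
proof -
  have "emeasure (gw_law \<eta> c) A = (\<integral>\<^sup>+f. indicator A f \<partial>gw_law \<eta> c)"
    using assms(4) by (simp add: sets_gw_law)
  also have "\<dots> = (\<Sum>\<^sup>+f. gw \<eta> c f * indicator A f)"
    using assms by (intro nn_integral_gw_law) auto
  finally show ?thesis .
qed

lemma prob_space_gw_law:
  assumes "0 < \<eta>" "0 < c" "c \<le> 1"
  shows "prob_space (gw_law \<eta> c)"
proof
  have "emeasure (gw_law \<eta> c) (space (gw_law \<eta> c)) = (\<integral>\<^sup>+f. 1 \<partial>gw_law \<eta> c)"
    by simp
  also have "\<dots> = (\<Sum>\<^sup>+f. gw \<eta> c f)"
    using nn_integral_gw_law[OF assms, of "\<lambda>_. 1"] by simp
  finally show "emeasure (gw_law \<eta> c) (space (gw_law \<eta> c)) = 1"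
    by (simp add: mass_gw[OF assms(2,3)])
qed

text \<open>
  Domination of the atoms gives domination on all measurable sets, and for two probability measures
  domination on a set and on its complement is equality.
\<close>

lemma gw_law_unique:
  assumes "0 < \<eta>" "0 < c" "c \<le> 1" "prob_space \<mu>" "sets \<mu> = sets RX0" "\<And>f. gw \<eta> c f \<le> emeasure \<mu> {f}"
  shows "\<mu> = gw_law \<eta> c"
proof -
  interpret M: prob_space \<mu> by fact
  interpret G: prob_space "gw_law \<eta> c" using assms(1-3) by (rule prob_space_gw_law)
  define C where "C = {f. measure \<mu> {f} \<noteq> 0}"
  have C: "countable C" unfolding C_def by (rule M.countable_support)
  have CX0: "{f} \<in> sets \<mu>" if "f \<in> C" for f
    using that measure_notin_sets by (auto simp: C_def)
  have le: "measure (gw_law \<eta> c) A \<le> measure \<mu> A" if A: "A \<in> sets RX0" for A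
  proof -
    have "emeasure (gw_law \<eta> c) A \<le> (\<Sum>\<^sup>+f. emeasure \<mu> {f} * indicator (C \<inter> A) f)"
      unfolding emeasure_gw_law[OF assms(1-3) A]
    proof (intro nn_integral_mono)
      fix f
      show "gw \<eta> c f * indicator A f \<le> emeasure \<mu> {f} * indicator (C \<inter> A) f"
        using assms(6)[of f] by (cases "f \<in> C") (auto simp: C_def M.emeasure_eq_measure indicator_def)
    qed
    also have "\<dots> = (\<integral>\<^sup>+f. emeasure \<mu> {f} \<partial>count_space (C \<inter> A))"
      by (subst nn_integral_count_space_indicator) auto
    also have "\<dots> = emeasure \<mu> (\<Union>f\<in>C \<inter> A. {f})"
      using C CX0 by (intro emeasure_UN_countable[symmetric]) (auto simp: disjoint_family_on_def)
    also have "\<dots> \<le> emeasure \<mu> A"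
      using A assms(5) by (intro emeasure_mono) auto
    finally show ?thesis
      by (simp add: M.emeasure_eq_measure G.emeasure_eq_measure)
  qed
  have spaces: "space (gw_law \<eta> c) = space RX0" "space \<mu> = space RX0"
    using sets_eq_imp_space_eq[OF sets_gw_law] sets_eq_imp_space_eq[OF assms(5)] by auto
  show ?thesis
  proof (rule measure_eqI)
    show "sets \<mu> = sets (gw_law \<eta> c)" by (simp add: assms(5) sets_gw_law)
    fix A assume "A \<in> sets \<mu>"
    then have A: "A \<in> sets RX0" by (simp add: assms(5))
    then have "space RX0 - A \<in> sets RX0" by (rule sets.compl_sets)
    from le[OF this] have "1 - measure (gw_law \<eta> c) A \<le> 1 - measure \<mu> A"
      using M.prob_compl[of A] G.prob_compl[of A] A by (simp add: assms(5) sets_gw_law spaces)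
    then show "emeasure \<mu> A = emeasure (gw_law \<eta> c) A"
      using le[OF A] by (simp add: M.emeasure_eq_measure G.emeasure_eq_measure)
  qed
qed

lemma gw_atom:
  assumes "0 < \<eta>" "0 < c" "c \<le> 1"
  shows "emeasure (gw_law \<eta> c) {f} = gw \<eta> c f"
proof (cases "f \<in> X0")
  case True
  then have "{f} \<in> sets RX0"
    unfolding sets_restrict_space by (intro image_eqI[of _ _ "{f}"]) auto
  then have "emeasure (gw_law \<eta> c) {f} = (\<Sum>\<^sup>+g. gw \<eta> c g * indicator {f} g)"
    using assms by (intro emeasure_gw_law)
  also have "\<dots> = (\<Sum>\<^sup>+g. gw \<eta> c f * indicator {f} g)"
    by (intro nn_integral_cong) (auto simp: indicator_def)
  finally show ?thesis
    by (simp add: nn_integral_cmult)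
next
  case False
  have "{f} \<notin> sets (gw_law \<eta> c)"
    using False sets.sets_into_space[of "{f}" RX0] by (auto simp: sets_gw_law space_restrict_space)
  then show ?thesis
    using gw_off_X0[OF assms False] by (simp add: emeasure_notin_sets)
qed

context
  fixes \<eta> \<alpha> c :: real
  assumes eta: "0 < \<eta>" and alpha: "0 < \<alpha>" and c_def: "c = 2 * \<alpha>" and c: "0 < c" "c \<le> 1"
begin

lemma message_law_gw: "message_law (gw_law \<eta> c) \<eta> \<alpha>"
  using prob_space_gw_law[OF eta c] sets_gw_law[of \<eta> c] eta alpha
  by (simp add: message_law_def message_law_axioms_def)

lemma T_gw_law: "T_hc \<eta> \<alpha> (gw_law \<eta> c) = gw_law \<eta> c"
proof -
  interpret message_law "gw_law \<eta> c" \<eta> \<alpha> by (rule message_law_gw)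
  have "gw \<eta> c f \<le> emeasure (T_hc \<eta> \<alpha> (gw_law \<eta> c)) {f}" for f
    using T_atoms[of "gw \<eta> c" f] gw_op_gw[OF c, of \<eta>] gw_atom[OF eta c] by (simp add: c_def)
  then show ?thesis
    by (intro gw_law_unique eta c T_prob sets_T)
qed

lemma fixed_point_eq_gw_law:
  assumes "\<mu> \<in> Pr1_X0" "T_hc \<eta> \<alpha> \<mu> = \<mu>"
  shows "\<mu> = gw_law \<eta> c"
proof -
  interpret message_law \<mu> \<eta> \<alpha>
    using assms(1) eta alpha by (simp add: message_law_def message_law_axioms_def Pr1_X0_def)
  have it: "gw_iter \<eta> c r f \<le> emeasure \<mu> {f}" for r f
  proof (induction r arbitrary: f)
    case (Suc r)
    then show ?case
      using T_atoms[of "gw_iter \<eta> c r" f] assms(2) by (simp add: c_def)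
  qed simp
  have "gw \<eta> c f \<le> emeasure \<mu> {f}" for f
    unfolding gw_def by (rule SUP_least) (rule it)
  then show ?thesis
    by (intro gw_law_unique eta c prob_space_axioms sets_mu)
qed

lemma gw_push:
  "(\<Sum>\<^sup>+f. h f * gw \<eta> c f) =
   (\<Sum>\<^sup>+cs. h (hc_upd \<eta> cs) * (ennreal (pmf (poisson_pmf c) (length cs)) * prod_list (map (gw \<eta> c) cs)))"
  by (subst gw_op_gw[OF c, symmetric]) (simp only: gw_op_def nn_integral_push)

lemma poisson_list_sum:
  "(\<Sum>\<^sup>+cs. h cs * (ennreal (pmf (poisson_pmf c) (length cs)) * prod_list (map (gw \<eta> c) cs))) =
   (\<Sum>k. ennreal (pmf (poisson_pmf c) k) * (\<Sum>\<^sup>+cs. (if length cs = k then h cs * prod_list (map (gw \<eta> c) cs) else 0)))"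
  by (subst nn_integral_list_length, subst nn_integral_cmult[symmetric])
     (auto intro!: suminf_cong nn_integral_cong simp: mult_ac)

text \<open>
  An updated density with \<open>k\<close> incoming densities from \<open>X1\<close> has norm at most \<open>K h\<^sup>-\<^sup>k\<close>, where \<open>h\<close> is
  \<open>hc_half\<close>, and the Poisson law has exponential moments.
\<close>

lemma gw_law_Pr1: "gw_law \<eta> c \<in> Pr1_X0"
proof -
  define K where "K = max 1 \<eta> / (upsilon0 \<eta> * hc_half \<eta>)"
  define h where "h = hc_half \<eta>"
  have h: "0 < h" and K: "0 \<le> K"
    using hc_half_pos[OF eta] upsilon0_pos[OF eta] by (auto simp: h_def K_def)
  have nm: "(\<lambda>f. ennreal (norm f)) \<in> borel_measurable RX0"
    by (intro measurable_restrict_space1) simp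
  have "(\<integral>\<^sup>+f. ennreal (norm f) \<partial>gw_law \<eta> c) = (\<Sum>\<^sup>+f. ennreal (norm f) * gw \<eta> c f)"
    by (simp add: nn_integral_gw_law[OF eta c nm] mult.commute)
  also have "\<dots> = (\<Sum>\<^sup>+cs. ennreal (norm (hc_upd \<eta> cs)) * (ennreal (pmf (poisson_pmf c) (length cs)) * prod_list (map (gw \<eta> c) cs)))"
    by (rule gw_push)
  also have "\<dots> \<le> (\<Sum>\<^sup>+cs. ennreal (K * (1 / h) ^ length cs) * (ennreal (pmf (poisson_pmf c) (length cs)) * prod_list (map (gw \<eta> c) cs)))"
  proof (intro nn_integral_mono)
    fix cs
    show "ennreal (norm (hc_upd \<eta> cs)) * (ennreal (pmf (poisson_pmf c) (length cs)) * prod_list (map (gw \<eta> c) cs))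
       \<le> ennreal (K * (1 / h) ^ length cs) * (ennreal (pmf (poisson_pmf c) (length cs)) * prod_list (map (gw \<eta> c) cs))"
    proof (cases "prod_list (map (gw \<eta> c) cs) = 0")
      case False
      then have X1: "set cs \<subseteq> X1 \<eta>" by (rule prod_gw_X1[OF eta c])
      then have X0: "set cs \<subseteq> X0" by (auto simp: X1_def)
      have "norm (hc_upd \<eta> cs) \<le> max 1 \<eta> / hc_nrm \<eta> cs"
        by (rule norm_hc_upd_le[OF eta X0])
      also have "\<dots> \<le> max 1 \<eta> / (upsilon0 \<eta> * h ^ (length cs + 1))"
        using hc_nrm_ge[OF eta X1] h upsilon0_pos[OF eta] unfolding h_def[symmetric]
        by (intro divide_left_mono mult_pos_pos hc_nrm_pos[OF eta X0]) auto
      also have "\<dots> = K * (1 / h) ^ length cs"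
        by (simp add: K_def h_def power_divide)
      finally show ?thesis
        by (intro mult_right_mono ennreal_leI) auto
    qed simp
  qed
  also have "\<dots> = (\<Sum>k. ennreal (pmf (poisson_pmf c) k) * (ennreal (K * (1 / h) ^ k)))"
  proof (subst poisson_list_sum, intro suminf_cong arg_cong2[where f = "(*)"] refl)
    fix k
    have "(\<Sum>\<^sup>+cs. (if length cs = k then ennreal (K * (1 / h) ^ length cs) * prod_list (map (gw \<eta> c) cs) else 0)) =
      (\<Sum>\<^sup>+cs. ennreal (K * (1 / h) ^ k) * (if length cs = k then prod_list (map (gw \<eta> c) cs) else 0))"
      by (intro nn_integral_cong) auto
    also have "\<dots> = ennreal (K * (1 / h) ^ k)"
      by (subst nn_integral_cmult) (simp_all add: nn_integral_list_power mass_gw[OF c])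
    finally show "(\<Sum>\<^sup>+cs. (if length cs = k then ennreal (K * (1 / h) ^ length cs) * prod_list (map (gw \<eta> c) cs) else 0)) = ennreal (K * (1 / h) ^ k)" .
  qed
  also have "\<dots> = (\<Sum>k. ennreal K * (ennreal (pmf (poisson_pmf c) k) * ennreal (1 / h) ^ k))"
    using K h by (intro suminf_cong) (simp add: ennreal_mult ennreal_power mult_ac)
  also have "\<dots> = ennreal K * ennreal (exp (c * (1 / h - 1)))"
    using h by (subst ennreal_suminf_cmult) (simp add: poisson_generating_function[OF c(1)])
  also have "\<dots> < \<infinity>"
    by (simp add: ennreal_mult_less_top)
  finally show ?thesis
    using prob_space_gw_law[OF eta c] by (simp add: Pr1_X0_def sets_gw_law)
qed

end

section \<open>The functional at the fixed point\<close>

definition edge_pair :: "(real \<Rightarrow>\<^sub>C real) \<Rightarrow> (real \<Rightarrow>\<^sub>C real) \<Rightarrow> real" where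
  "edge_pair a b = integral {0..1} (\<lambda>t. cdf01 a (1 - t) * apply_bcontfun b t)"

text \<open>
  Pairing \<open>a\<close> with an updated density is the same as adding \<open>a\<close> to the incoming densities, up to
  normalisation. So the edge term is a difference of vertex terms.
\<close>

lemma edge_pair_upd:
  assumes "0 < \<eta>" "a \<in> X0" "set ds \<subseteq> X0"
  shows "edge_pair a (hc_upd \<eta> ds) = hc_nrm \<eta> (a # ds) / hc_nrm \<eta> ds"
    and "0 < edge_pair a (hc_upd \<eta> ds)"
    and "- ln (edge_pair a (hc_upd \<eta> ds)) = hc_psi \<eta> (a # ds) - hc_psi \<eta> ds"
    and "hc_psi \<eta> ds \<le> hc_psi \<eta> (a # ds)"
proof -
  note pos = hc_nrm_pos[OF assms(1,3)] hc_nrm_pos[OF assms(1), of "a # ds"] upsilon0_pos[OF assms(1)]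
  have "edge_pair a (hc_upd \<eta> ds) = integral {0..1} (\<lambda>t. \<eta> powr t * cdf_prod (a # ds) (1 - t) / hc_nrm \<eta> ds)"
    unfolding edge_pair_def
    by (intro integral_cong) (simp add: hc_upd_apply[OF assms(1,3)] clamp01)
  then show eq: "edge_pair a (hc_upd \<eta> ds) = hc_nrm \<eta> (a # ds) / hc_nrm \<eta> ds"
    unfolding hc_nrm_eq[of \<eta> "a # ds"] by simp
  show "0 < edge_pair a (hc_upd \<eta> ds)"
    "- ln (edge_pair a (hc_upd \<eta> ds)) = hc_psi \<eta> (a # ds) - hc_psi \<eta> ds"
    using pos assms(2,3) unfolding eq hc_psi_def by (auto simp: ln_div)
  have "hc_nrm \<eta> (a # ds) \<le> hc_nrm \<eta> ds"
    unfolding hc_nrm_eq using assms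
    by (intro integral_le integrable_continuous_interval continuous_on_weight mult_left_mono)
       (auto intro!: mult_left_le_one_le cdf_prod_ge_0 cdf01_ge_0 cdf01_le_1)
  then show "hc_psi \<eta> ds \<le> hc_psi \<eta> (a # ds)"
    using pos assms(2,3) by (simp add: hc_psi_def ln_div)
qed

lemma nn_integral_list_2:
  "(\<Sum>\<^sup>+cs. (if length cs = 2 then F cs else 0)) =
   (\<Sum>\<^sup>+a. \<Sum>\<^sup>+b. F [a, b])"
  for F :: "'a list \<Rightarrow> ennreal"
proof -
  have 0: "(\<Sum>\<^sup>+cs. (if length cs = 0 then G cs else 0)) = G []" for G :: "'a list \<Rightarrow> ennreal"
    by (subst nn_integral_list_split) simp
  have 1: "(\<Sum>\<^sup>+cs. (if length cs = Suc n then G cs else 0)) =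
    (\<Sum>\<^sup>+b. \<Sum>\<^sup>+bs. (if length bs = n then G (b # bs) else 0))"
    for n and G :: "'a list \<Rightarrow> ennreal"
    by (subst nn_integral_list_split) simp
  show ?thesis
    unfolding numeral_2_eq_2 1 0 ..
qed

context
  fixes \<eta> \<alpha> c :: real
  assumes eta: "0 < \<eta>" and alpha: "0 < \<alpha>" and c_def: "c = 2 * \<alpha>" and c: "0 < c" "c \<le> 1"
begin

interpretation message_law "gw_law \<eta> c" \<eta> \<alpha>
  by (rule message_law_gw[OF eta alpha c_def c])

definition gw_supp :: "(real \<Rightarrow>\<^sub>C real) set" where
  "gw_supp = {f. gw \<eta> c f \<noteq> 0}"

lemma countable_gw_supp: "countable gw_supp"
proof -
  have "gw_supp = {f. measure (gw_law \<eta> c) {f} \<noteq> 0}"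
    using gw_le_1[OF c, of \<eta>]
    by (auto simp: gw_supp_def measure_def gw_atom[OF eta c] enn2real_eq_0_iff) (metis ennreal_top_neq_one top.extremum_uniqueI)
  then show ?thesis using countable_support by simp
qed

lemma gw_supp_X1: "gw_supp \<subseteq> X1 \<eta>"
  using gw_X1[OF eta c] by (auto simp: gw_supp_def)

lemma gw_supp_X0: "gw_supp \<subseteq> X0"
  using gw_supp_X1 by (auto simp: X1_def)

lemma gw_supp_updE:
  assumes "b \<in> gw_supp"
  obtains ds where "b = hc_upd \<eta> ds" "set ds \<subseteq> gw_supp"
proof -
  have "gw_op \<eta> c (gw \<eta> c) b \<noteq> 0"
    using assms gw_op_gw[OF c, of \<eta>] by (simp add: gw_supp_def)
  then show ?thesis
    by (rule gw_op_nonzeroE) (auto intro!: that simp: gw_supp_def)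
qed

abbreviation "wt cs \<equiv> prod_list (map (gw \<eta> c) cs)"
abbreviation "pp k \<equiv> ennreal (pmf (poisson_pmf c) k)"

lemma wt_off: "cs \<notin> lists gw_supp \<Longrightarrow> wt cs = 0"
  by (auto simp: gw_supp_def prod_list_eq_0_ennreal image_iff)

lemma nn_integral_lists_gw_supp:
  assumes "\<And>cs. wt cs = 0 \<Longrightarrow> h cs = 0"
  shows "(\<integral>\<^sup>+cs. h cs \<partial>count_space {cs \<in> lists gw_supp. P cs}) = (\<Sum>\<^sup>+cs. (if P cs then h cs else 0))"
proof -
  have "(\<integral>\<^sup>+cs. h cs \<partial>count_space {cs \<in> lists gw_supp. P cs}) =
      (\<Sum>\<^sup>+cs. h cs * indicator {cs \<in> lists gw_supp. P cs} cs)"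
    by (subst nn_integral_count_space_indicator) auto
  also have "\<dots> = (\<Sum>\<^sup>+cs. (if P cs then h cs else 0))"
    using wt_off assms by (intro nn_integral_cong) (auto simp: indicator_def)
  finally show ?thesis .
qed

lemma gw_atom_prod: "set cs \<subseteq> X0 \<Longrightarrow> (\<Prod>f\<leftarrow>cs. emeasure (gw_law \<eta> c) {f}) = wt cs"
  by (simp add: gw_atom[OF eta c])

text \<open>
  Almost surely the first incoming densities are atoms of the fixed point, so expectations over
  \<open>hc_space\<close> are sums over lists of atoms.
\<close>

lemma gw_supp_partition:
  fixes D :: "(real \<Rightarrow>\<^sub>C real) list \<Rightarrow> nat set" and P :: "(real \<Rightarrow>\<^sub>C real) list \<Rightarrow> bool"
  defines "q cs \<equiv> emeasure (poisson_pmf c) (D cs)"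
  assumes disj: "\<And>cs ds. P cs \<Longrightarrow> P ds \<Longrightarrow> length cs \<noteq> length ds \<Longrightarrow> D cs \<inter> D ds = {}"
    and total: "(\<Sum>\<^sup>+cs. (if P cs then q cs * wt cs else 0)) = 1"
  shows "AE x in S. \<exists>cs\<in>{cs \<in> lists gw_supp. P cs}. x \<in> cylinder (D cs) cs"
    and "(\<And>cs x. cs \<in> lists gw_supp \<Longrightarrow> P cs \<Longrightarrow> x \<in> cylinder (D cs) cs \<Longrightarrow> \<Psi> x = \<psi> cs) \<Longrightarrow>
      (\<integral>\<^sup>+x. \<Psi> x \<partial>S) = (\<Sum>\<^sup>+cs. (if P cs then \<psi> cs * (q cs * wt cs) else 0))"
proof -
  let ?I = "{cs \<in> lists gw_supp. P cs}" and ?A = "\<lambda>cs. cylinder (D cs) cs"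
  have X0: "set cs \<subseteq> X0" if "cs \<in> ?I" for cs
    using that gw_supp_X0 by auto
  have em: "emeasure S (?A cs) = q cs * wt cs" if "cs \<in> ?I" for cs
    using emeasure_cylinder[OF X0[OF that]] gw_atom_prod[OF X0[OF that]] by (simp add: q_def c_def)
  have 1: "countable ?I"
    by (rule countable_subset[of _ "lists gw_supp"]) (auto simp: countable_gw_supp)
  have 2: "?A cs \<in> S.events" if "cs \<in> ?I" for cs
    by (rule cylinder_measurable(2)[OF X0[OF that]])
  have 3: "disjoint_family_on ?A ?I"
    unfolding disjoint_family_on_def
  proof (intro ballI impI)
    fix cs ds assume I: "cs \<in> ?I" "ds \<in> ?I" "cs \<noteq> ds"
    have "x \<notin> ?A ds" if x: "x \<in> ?A cs" for x
    proof (cases "length cs = length ds")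
      case True
      then show ?thesis using cylinder_disjoint[OF x, of _ ds] I(3) by blast
    next
      case False
      then show ?thesis using disj[of cs ds] I x by (auto simp: cylinder_def)
    qed
    then show "?A cs \<inter> ?A ds = {}" by blast
  qed
  have "(\<integral>\<^sup>+cs. emeasure S (?A cs) \<partial>count_space ?I) = (\<integral>\<^sup>+cs. q cs * wt cs \<partial>count_space ?I)"
    by (intro nn_integral_cong em) simp
  also have "\<dots> = 1"
    by (subst nn_integral_lists_gw_supp) (auto simp: total)
  finally have 4: "(\<integral>\<^sup>+cs. emeasure S (?A cs) \<partial>count_space ?I) = 1" .
  show "AE x in S. \<exists>cs\<in>?I. x \<in> ?A cs"
    by (rule S.countable_partition(1)[OF 1 2 3 4])
  assume \<Psi>: "\<And>cs x. cs \<in> lists gw_supp \<Longrightarrow> P cs \<Longrightarrow> x \<in> cylinder (D cs) cs \<Longrightarrow> \<Psi> x = \<psi> cs"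
  have "(\<integral>\<^sup>+x. \<Psi> x \<partial>S) = (\<integral>\<^sup>+cs. \<psi> cs * emeasure S (?A cs) \<partial>count_space ?I)"
    by (rule S.countable_partition(2)[OF 1 2 3 4]) (use \<Psi> in auto)
  also have "\<dots> = (\<integral>\<^sup>+cs. \<psi> cs * (q cs * wt cs) \<partial>count_space ?I)"
    by (intro nn_integral_cong) (simp add: em)
  also have "\<dots> = (\<Sum>\<^sup>+cs. (if P cs then \<psi> cs * (q cs * wt cs) else 0))"
    by (subst nn_integral_lists_gw_supp) auto
  finally show "(\<integral>\<^sup>+x. \<Psi> x \<partial>S) = (\<Sum>\<^sup>+cs. (if P cs then \<psi> cs * (q cs * wt cs) else 0))" .
qed

lemma vertex_partition:
  shows "AE x in S. \<exists>cs\<in>{cs \<in> lists gw_supp. True}. x \<in> cylinder {length cs} cs"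
    and "(\<And>cs x. cs \<in> lists gw_supp \<Longrightarrow> x \<in> cylinder {length cs} cs \<Longrightarrow> \<Psi> x = \<psi> cs) \<Longrightarrow>
      (\<integral>\<^sup>+x. \<Psi> x \<partial>S) = (\<Sum>\<^sup>+cs. \<psi> cs * (pp (length cs) * wt cs))"
proof -
  have "(\<Sum>\<^sup>+cs. 1 * (pp (length cs) * wt cs)) = (\<Sum>k. pp k * ennreal 1 ^ k)"
    by (subst poisson_list_sum[OF eta alpha c_def c]) (simp add: nn_integral_list_power mass_gw[OF c] cong: if_cong)
  also have "\<dots> = 1"
    by (subst poisson_generating_function[OF c(1)]) auto
  finally have total: "(\<Sum>\<^sup>+cs. (if True then emeasure (poisson_pmf c) {length cs} * wt cs else 0)) = 1"
    by (simp add: emeasure_pmf_single)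
  note * = gw_supp_partition[of "\<lambda>_. True" "\<lambda>cs. {length cs}", OF _ total]
  show "AE x in S. \<exists>cs\<in>{cs \<in> lists gw_supp. True}. x \<in> cylinder {length cs} cs"
    by (rule *(1)) simp
  show "(\<And>cs x. cs \<in> lists gw_supp \<Longrightarrow> x \<in> cylinder {length cs} cs \<Longrightarrow> \<Psi> x = \<psi> cs) \<Longrightarrow>
      (\<integral>\<^sup>+x. \<Psi> x \<partial>S) = (\<Sum>\<^sup>+cs. \<psi> cs * (pp (length cs) * wt cs))"
    using *(2)[of \<Psi> \<psi>] by (simp add: emeasure_pmf_single)
qed

lemma edge_partition:
  shows "AE x in S. \<exists>cs\<in>{cs \<in> lists gw_supp. length cs = 2}. x \<in> cylinder UNIV cs"
    and "(\<And>cs x. cs \<in> lists gw_supp \<Longrightarrow> length cs = 2 \<Longrightarrow> x \<in> cylinder UNIV cs \<Longrightarrow> \<Psi> x = \<psi> cs) \<Longrightarrow>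
      (\<integral>\<^sup>+x. \<Psi> x \<partial>S) = (\<Sum>\<^sup>+cs. (if length cs = 2 then \<psi> cs * wt cs else 0))"
proof -
  have one: "emeasure (poisson_pmf c) UNIV = 1"
    using measure_pmf.emeasure_space_1[of "poisson_pmf c"] by simp
  have total: "(\<Sum>\<^sup>+cs. (if length cs = 2 then emeasure (poisson_pmf c) UNIV * wt cs else 0)) = 1"
    by (simp add: one nn_integral_list_power mass_gw[OF c] cong: if_cong)
  note * = gw_supp_partition[of "\<lambda>cs. length cs = 2" "\<lambda>_. UNIV", OF _ total]
  show "AE x in S. \<exists>cs\<in>{cs \<in> lists gw_supp. length cs = 2}. x \<in> cylinder UNIV cs"
    by (rule *(1)) simp
  show "(\<And>cs x. cs \<in> lists gw_supp \<Longrightarrow> length cs = 2 \<Longrightarrow> x \<in> cylinder UNIV cs \<Longrightarrow> \<Psi> x = \<psi> cs) \<Longrightarrow>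
      (\<integral>\<^sup>+x. \<Psi> x \<partial>S) = (\<Sum>\<^sup>+cs. (if length cs = 2 then \<psi> cs * wt cs else 0))"
    using *(2)[of \<Psi> \<psi>] by (simp add: one cong: if_cong)
qed

definition vertex_sum :: real where
  "vertex_sum = (\<Sum>k. pmf (poisson_pmf c) k * gw_loss \<eta> c k)"

definition vertex_sum_Suc :: real where
  "vertex_sum_Suc = (\<Sum>k. pmf (poisson_pmf c) k * gw_loss \<eta> c (Suc k))"

lemma summable_gw_loss:
  "summable (\<lambda>k. pmf (poisson_pmf c) k * gw_loss \<eta> c k)"
  "summable (\<lambda>k. pmf (poisson_pmf c) k * gw_loss \<eta> c (Suc k))"
proof -
  note \<kappa> = hc_kappa_nonneg[OF eta]
  \<comment> \<open>summability is part of the Poisson approximation; any admissible sequence will do\<close>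
  have p: "(\<lambda>N. real N * (c / real N)) \<longlonglongrightarrow> c"
  proof (rule tendsto_eventually)
    show "\<forall>\<^sub>F N in sequentially. real N * (c / real N) = c"
      using eventually_gt_at_top[of 0] by eventually_elim simp
  qed
  have p1: "c / real N \<le> 1" for N
    using c by (cases "N = 0") (auto simp: divide_le_eq)
  have b: "\<bar>gw_loss \<eta> c k\<bar> \<le> (real k + 2) * hc_kappa \<eta>" "\<bar>gw_loss \<eta> c (Suc k)\<bar> \<le> (real k + 2) * hc_kappa \<eta>" for k
  proof -
    have "(real k + 1) * hc_kappa \<eta> \<le> (real k + 2) * hc_kappa \<eta>"
      using \<kappa> by (intro mult_right_mono) auto
    then show "\<bar>gw_loss \<eta> c k\<bar> \<le> (real k + 2) * hc_kappa \<eta>"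
      using gw_loss(2,3)[OF eta c, of k] by linarith
    have "gw_loss \<eta> c (Suc k) \<le> (real k + 2) * hc_kappa \<eta>"
      using gw_loss(3)[OF eta c, of "Suc k"] by (simp add: add.commute)
    then show "\<bar>gw_loss \<eta> c (Suc k)\<bar> \<le> (real k + 2) * hc_kappa \<eta>"
      using gw_loss(2)[OF eta c, of "Suc k"] by linarith
  qed
  show "summable (\<lambda>k. pmf (poisson_pmf c) k * gw_loss \<eta> c k)"
    by (rule binomial_poisson_tannery(1)[OF c(1) p _ p1 tendsto_const \<kappa>, where n = 0]) (use b c in auto)
  show "summable (\<lambda>k. pmf (poisson_pmf c) k * gw_loss \<eta> c (Suc k))"
    by (rule binomial_poisson_tannery(1)[OF c(1) p _ p1 tendsto_const \<kappa>, where n = 0]) (use b c in auto)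
qed

lemma vertex_sum_ennreal:
  "(\<Sum>k. pp k * loss_density \<eta> c k (hc_psi \<eta>)) = ennreal vertex_sum"
  "(\<Sum>k. pp k * loss_density \<eta> c (Suc k) (hc_psi \<eta>)) = ennreal vertex_sum_Suc"
proof -
  have "(\<Sum>k. pp k * ennreal (gw_loss \<eta> c k)) = (\<Sum>k. ennreal (pmf (poisson_pmf c) k * gw_loss \<eta> c k))"
    using gw_loss(2)[OF eta c] by (simp add: ennreal_mult)
  also have "\<dots> = ennreal vertex_sum"
    unfolding vertex_sum_def using gw_loss(2)[OF eta c] summable_gw_loss(1) by (intro suminf_ennreal2) auto
  finally show "(\<Sum>k. pp k * loss_density \<eta> c k (hc_psi \<eta>)) = ennreal vertex_sum"
    by (simp only: gw_loss(1)[OF eta c])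
  have "(\<Sum>k. pp k * ennreal (gw_loss \<eta> c (Suc k))) = (\<Sum>k. ennreal (pmf (poisson_pmf c) k * gw_loss \<eta> c (Suc k)))"
    using gw_loss(2)[OF eta c] by (simp add: ennreal_mult)
  also have "\<dots> = ennreal vertex_sum_Suc"
    unfolding vertex_sum_Suc_def using gw_loss(2)[OF eta c] summable_gw_loss(2) by (intro suminf_ennreal2) auto
  finally show "(\<Sum>k. pp k * loss_density \<eta> c (Suc k) (hc_psi \<eta>)) = ennreal vertex_sum_Suc"
    by (simp only: gw_loss(1)[OF eta c])
qed

lemma vertex_sum_nonneg: "0 \<le> vertex_sum" "0 \<le> vertex_sum_Suc"
  unfolding vertex_sum_def vertex_sum_Suc_def
  using summable_gw_loss gw_loss(2)[OF eta c] by (auto intro!: suminf_nonneg)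

lemma nn_integral_psi:
  "(\<Sum>\<^sup>+cs. ennreal (hc_psi \<eta> cs) * (pp (length cs) * wt cs)) = ennreal vertex_sum"
  unfolding poisson_list_sum[OF eta alpha c_def c] vertex_sum_ennreal(1)[symmetric] loss_density_def ..

lemma nn_integral_psi_Suc:
  "(\<Sum>\<^sup>+a. gw \<eta> c a * (\<Sum>\<^sup>+cs. ennreal (hc_psi \<eta> (a # cs)) * (pp (length cs) * wt cs)))
    = ennreal vertex_sum_Suc"
proof -
  have ld: "loss_density \<eta> c (Suc k) (hc_psi \<eta>) =
      (\<Sum>\<^sup>+a. gw \<eta> c a * (\<Sum>\<^sup>+cs. (if length cs = k then ennreal (hc_psi \<eta> (a # cs)) * wt cs else 0)))" for k
    unfolding loss_density_def
    by (subst nn_integral_list_split, subst nn_integral_cmult[symmetric])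
       (auto intro!: nn_integral_cong simp: mult_ac)
  have "(\<Sum>\<^sup>+a. gw \<eta> c a * (\<Sum>\<^sup>+cs. ennreal (hc_psi \<eta> (a # cs)) * (pp (length cs) * wt cs))) =
    (\<Sum>\<^sup>+a. (\<Sum>k. pp k * (gw \<eta> c a * (\<Sum>\<^sup>+cs. (if length cs = k then ennreal (hc_psi \<eta> (a # cs)) * wt cs else 0)))))"
    by (intro nn_integral_cong) (simp add: poisson_list_sum[OF eta alpha c_def c] mult.left_commute[of "pp _"] flip: ennreal_suminf_cmult)
  also have "\<dots> = (\<Sum>k. pp k * loss_density \<eta> c (Suc k) (hc_psi \<eta>))"
    by (subst nn_integral_suminf) (simp_all add: nn_integral_cmult ld)
  also have "\<dots> = ennreal vertex_sum_Suc"
    by (rule vertex_sum_ennreal)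
  finally show ?thesis .
qed

text \<open>
  The second density is replaced by the update of a Poisson number of densities. To stay with
  nonnegative terms, \<open>hc_psi \<eta> (a # cs) - hc_psi \<eta> cs\<close> is integrated by adding the integral of
  \<open>hc_psi \<eta> cs\<close> to both sides.
\<close>

lemma nn_integral_edge:
  "(\<Sum>\<^sup>+cs. (if length cs = 2 then ennreal (- ln (edge_pair (cs ! 0) (cs ! 1))) * wt cs else 0))
    = ennreal (vertex_sum_Suc - vertex_sum)"
  "vertex_sum \<le> vertex_sum_Suc"
proof -
  let ?h = "\<lambda>a b. ennreal (- ln (edge_pair a b))"
  let ?P = "\<lambda>cs. pp (length cs) * wt cs"
  have "(\<Sum>\<^sup>+cs. (if length cs = 2 then ?h (cs ! 0) (cs ! 1) * wt cs else 0))
     = (\<Sum>\<^sup>+a. \<Sum>\<^sup>+b. gw \<eta> c a * (?h a b * gw \<eta> c b))"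
    by (subst nn_integral_list_2) (auto intro!: nn_integral_cong simp: mult_ac)
  also have "\<dots> = (\<Sum>\<^sup>+a. gw \<eta> c a * (\<Sum>\<^sup>+cs. ?h a (hc_upd \<eta> cs) * ?P cs))"
    by (simp add: nn_integral_cmult gw_push[OF eta alpha c_def c])
  finally have 1: "(\<Sum>\<^sup>+cs. (if length cs = 2 then ?h (cs ! 0) (cs ! 1) * wt cs else 0)) =
      (\<Sum>\<^sup>+a. gw \<eta> c a * (\<Sum>\<^sup>+cs. ?h a (hc_upd \<eta> cs) * ?P cs))" (is "?E = ?E'") .
  have "?E' + ennreal vertex_sum = ?E' + (\<Sum>\<^sup>+a. gw \<eta> c a * (\<Sum>\<^sup>+cs. ennreal (hc_psi \<eta> cs) * ?P cs))"
    by (simp add: nn_integral_psi nn_integral_multc mass_gw[OF c])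
  also have "\<dots> = (\<Sum>\<^sup>+a. gw \<eta> c a * (\<Sum>\<^sup>+cs. ennreal (hc_psi \<eta> (a # cs)) * ?P cs))"
  proof (subst nn_integral_add[symmetric], simp, simp, intro nn_integral_cong)
    fix a
    show "gw \<eta> c a * (\<Sum>\<^sup>+cs. ?h a (hc_upd \<eta> cs) * ?P cs) +
        gw \<eta> c a * (\<Sum>\<^sup>+cs. ennreal (hc_psi \<eta> cs) * ?P cs) =
        gw \<eta> c a * (\<Sum>\<^sup>+cs. ennreal (hc_psi \<eta> (a # cs)) * ?P cs)"
    proof (cases "gw \<eta> c a = 0")
      case False
      then have a: "a \<in> X0" using gw_supp_X0 by (auto simp: gw_supp_def)
      have "(\<Sum>\<^sup>+cs. ?h a (hc_upd \<eta> cs) * ?P cs) + (\<Sum>\<^sup>+cs. ennreal (hc_psi \<eta> cs) * ?P cs) =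
        (\<Sum>\<^sup>+cs. ennreal (hc_psi \<eta> (a # cs)) * ?P cs)"
      proof (subst nn_integral_add[symmetric], simp, simp, intro nn_integral_cong)
        fix cs
        show "?h a (hc_upd \<eta> cs) * ?P cs + ennreal (hc_psi \<eta> cs) * ?P cs = ennreal (hc_psi \<eta> (a # cs)) * ?P cs"
        proof (cases "wt cs = 0")
          case False
          then have X1: "set cs \<subseteq> X1 \<eta>" by (rule prod_gw_X1[OF eta c])
          then have X0: "set cs \<subseteq> X0" by (auto simp: X1_def)
          have "?h a (hc_upd \<eta> cs) + ennreal (hc_psi \<eta> cs) = ennreal (hc_psi \<eta> (a # cs))"
            unfolding edge_pair_upd(3)[OF eta a X0]
            using edge_pair_upd(4)[OF eta a X0] hc_psi_bounds(1)[OF eta X1]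
            by (subst ennreal_plus[symmetric]) auto
          then show ?thesis by (simp flip: distrib_right)
        qed simp
      qed
      then show ?thesis by (simp flip: distrib_left)
    qed simp
  qed
  also have "\<dots> = ennreal vertex_sum_Suc"
    by (rule nn_integral_psi_Suc)
  finally have 2: "?E' + ennreal vertex_sum = ennreal vertex_sum_Suc" .
  have cancel: "s \<le> t \<and> X = ennreal (t - s)" if "X + ennreal s = ennreal t" "0 \<le> s" "0 \<le> t" for X s t
  proof -
    have "ennreal s \<le> ennreal t"
      unfolding that(1)[symmetric] by simp
    then have le: "s \<le> t"
      using that by simp
    then have "ennreal s + X = ennreal s + ennreal (t - s)"
      using that by (simp add: add.commute flip: ennreal_plus)
    then have "X = ennreal (t - s)"
      by (subst (asm) ennreal_add_left_cancel) auto
    with le show ?thesis by blast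
  qed
  from cancel[OF 2 vertex_sum_nonneg]
  show "?E = ennreal (vertex_sum_Suc - vertex_sum)" "vertex_sum \<le> vertex_sum_Suc"
    unfolding 1 by blast+
qed

lemma vertex_term_measurable: "vertex_term \<eta> \<in> borel_measurable S"
  unfolding vertex_term_def
  by (intro measurable_S borel_measurable_ln PF.norm_const_measurable eta)

lemma edge_term_measurable: "edge_term \<in> borel_measurable S"
  unfolding edge_term_def
  by (intro measurable_S borel_measurable_ln PF.edge_integral_measurable)

lemma vertex_integral:
  "integrable S (vertex_term \<eta>)" "(\<integral>x. vertex_term \<eta> x \<partial>S) = ln (upsilon0 \<eta>) - vertex_sum"
proof -
  define X where "X x = ln (upsilon0 \<eta>) - vertex_term \<eta> x" for x
  have X: "X x = hc_psi \<eta> cs" if "cs \<in> lists gw_supp" "x \<in> cylinder {length cs} cs" for cs x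
  proof -
    have "set cs \<subseteq> X0" using that(1) gw_supp_X0 by auto
    note hc_nrm_pos[OF eta this] upsilon0_pos[OF eta]
    moreover have "vertex_term \<eta> x = ln (hc_nrm \<eta> cs)"
      using cylinder_update(2)[OF that(2)] by (simp add: vertex_term_def case_prod_unfold)
    ultimately show ?thesis
      by (simp add: X_def hc_psi_def ln_div)
  qed
  have m: "X \<in> borel_measurable S"
    unfolding X_def[abs_def] by (intro borel_measurable_diff vertex_term_measurable) simp
  have "AE x in S. 0 \<le> X x"
    using vertex_partition(1)
  proof eventually_elim
    fix x assume "\<exists>cs\<in>{cs \<in> lists gw_supp. True}. x \<in> cylinder {length cs} cs"
    then obtain cs where cs: "cs \<in> lists gw_supp" "x \<in> cylinder {length cs} cs" by blast
    then show "0 \<le> X x"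
      using X[OF cs] hc_psi_bounds(1)[OF eta, of cs] gw_supp_X1 by auto
  qed
  moreover have "(\<integral>\<^sup>+x. ennreal (X x) \<partial>S) = ennreal vertex_sum"
    using vertex_partition(2)[of "\<lambda>x. ennreal (X x)" "\<lambda>cs. ennreal (hc_psi \<eta> cs)"] X nn_integral_psi by simp
  ultimately have "integrable S X" "(\<integral>x. X x \<partial>S) = vertex_sum"
    using nn_integral_eq_integrable[OF m _ vertex_sum_nonneg(1)] by auto
  then have "integrable S (\<lambda>x. ln (upsilon0 \<eta>) - X x)" "(\<integral>x. ln (upsilon0 \<eta>) - X x \<partial>S) = ln (upsilon0 \<eta>) - vertex_sum"
    by (auto simp: S.prob_space)
  then show "integrable S (vertex_term \<eta>)" "(\<integral>x. vertex_term \<eta> x \<partial>S) = ln (upsilon0 \<eta>) - vertex_sum"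
    by (simp_all add: X_def)
qed

lemma cylinder_edge:
  assumes "length cs = 2" "x \<in> cylinder UNIV cs"
  shows "edge_integral (snd x) = edge_pair (cs ! 0) (cs ! 1)"
proof -
  have "\<forall>i\<in>{1..length cs}. snd x i = cs ! (i - 1)"
    using assms(2) by (auto simp: cylinder_def)
  from bspec[OF this, of 1] bspec[OF this, of 2] have "snd x 1 = cs ! 0" "snd x 2 = cs ! 1"
    using assms(1) by simp_all
  then show ?thesis
    by (simp add: edge_integral_def edge_pair_def)
qed

lemma edge_pair_gw_supp:
  assumes "a \<in> gw_supp" "b \<in> gw_supp"
  shows "0 < edge_pair a b" "0 \<le> - ln (edge_pair a b)"
proof -
  obtain ds where ds: "b = hc_upd \<eta> ds" "set ds \<subseteq> gw_supp"
    using gw_supp_updE[OF assms(2)] .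
  have a: "a \<in> X0" and d: "set ds \<subseteq> X0"
    using assms ds gw_supp_X0 by auto
  show "0 < edge_pair a b" "0 \<le> - ln (edge_pair a b)"
    unfolding ds(1) using edge_pair_upd(2,3,4)[OF eta a d] by auto
qed

lemma edge_positive: "AE x in S. 0 < edge_integral (snd x) \<and> edge_term x \<le> 0"
  using edge_partition(1)
proof eventually_elim
  fix x assume "\<exists>cs\<in>{cs \<in> lists gw_supp. length cs = 2}. x \<in> cylinder UNIV cs"
  then obtain cs where cs: "cs \<in> lists gw_supp" "length cs = 2" "x \<in> cylinder UNIV cs" by blast
  have "cs ! 0 \<in> gw_supp" "cs ! 1 \<in> gw_supp"
    using cs(1,2) nth_mem[of 0 cs] nth_mem[of 1 cs] by auto
  then show "0 < edge_integral (snd x) \<and> edge_term x \<le> 0"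
    using edge_pair_gw_supp[of "cs ! 0" "cs ! 1"] cylinder_edge[OF cs(2,3)] by (simp add: edge_term_def case_prod_unfold)
qed

lemma edge_expectation:
  "integrable S edge_term" "(\<integral>x. edge_term x \<partial>S) = - (vertex_sum_Suc - vertex_sum)"
proof -
  have m: "(\<lambda>x. - edge_term x) \<in> borel_measurable S"
    by (intro borel_measurable_uminus edge_term_measurable)
  have ae: "AE x in S. 0 \<le> - edge_term x"
    using edge_positive by eventually_elim simp
  have nn: "(\<integral>\<^sup>+x. ennreal (- edge_term x) \<partial>S) = ennreal (vertex_sum_Suc - vertex_sum)"
    unfolding nn_integral_edge(1)[symmetric]
    by (rule edge_partition(2)) (simp add: edge_term_def case_prod_unfold cylinder_edge)
  have "0 \<le> vertex_sum_Suc - vertex_sum"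
    using nn_integral_edge(2) by simp
  note iffD1[OF nn_integral_eq_integrable[OF m ae this] nn]
  then show "integrable S edge_term" "(\<integral>x. edge_term x \<partial>S) = - (vertex_sum_Suc - vertex_sum)"
    by auto
qed

lemma P_hc_gw_law:
  "P_hc_well_defined \<eta> \<alpha> (gw_law \<eta> c)" "P_hc \<eta> \<alpha> (gw_law \<eta> c) = free_energy \<eta> \<alpha>"
proof -
  have "AE x in S. x \<in> space S" by simp
  with edge_positive have "AE x in S. (case x of (n, f) \<Rightarrow> 0 < hc_norm_const \<eta> n f \<and> 0 < edge_integral f)"
  proof eventually_elim
    case (elim x)
    obtain n f where x: "x = (n, f)" by force
    then have f: "f \<in> space (\<Pi>\<^sub>M k\<in>{1..}. gw_law \<eta> c)"
      using elim by (simp add: space_S)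
    have "0 < hc_norm_const \<eta> n f"
      by (intro hc_norm_const_pos eta PF.F_X0 f) simp
    then show ?case
      using elim x by simp
  qed
  then show "P_hc_well_defined \<eta> \<alpha> (gw_law \<eta> c)"
    unfolding P_hc_well_defined_def using vertex_integral(1) edge_expectation(1) by simp
  have "(\<Sum>k. pmf (poisson_pmf c) k * (gw_loss \<eta> c (Suc k) - gw_loss \<eta> c k)) = vertex_sum_Suc - vertex_sum"
    unfolding vertex_sum_def vertex_sum_Suc_def right_diff_distrib
    by (rule suminf_diff[OF summable_gw_loss(2,1), symmetric])
  note diff = this
  show "P_hc \<eta> \<alpha> (gw_law \<eta> c) = free_energy \<eta> \<alpha>"
    unfolding P_hc_def free_energy_def c_def[symmetric] vertex_integral(2) edge_expectation(2)
      diff vertex_sum_def[symmetric]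
    by (simp add: right_diff_distrib)
qed

end

lemma hc_log_volume_eq: "hc_log_volume \<eta> N G = ln (hc_Z \<eta> {1..N} G) / real N"
proof -
  have "hc_polytope N G = {\<sigma> \<in> {1..N} \<rightarrow>\<^sub>E {0..1}. (\<forall>u\<in>{1..N}. \<forall>w\<in>{1..N}. {u, w} \<in> G \<longrightarrow> \<sigma> u + \<sigma> w \<le> 1) \<and> (\<forall>u\<in>{1..N}. \<sigma> u \<le> 1)}"
  proof -
    have "\<forall>u\<in>{1..N}. \<sigma> u \<le> 1" if "\<sigma> \<in> {1..N} \<rightarrow>\<^sub>E {0..1::real}" for \<sigma>
      using PiE_mem[OF that] by simp
    then show ?thesis
      unfolding hc_polytope_def by blast
  qed
  then show ?thesis
    by (simp add: hc_log_volume_def hc_vol_def)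
qed

lemma hc_log_volume_tendsto_L1:
  assumes "0 < \<alpha>" "\<alpha> \<le> 1/2" "0 < \<eta>"
  shows "tendsto_L1 (\<lambda>N. measure_pmf (random_graph \<alpha> N)) (\<lambda>N. hc_log_volume \<eta> N) (free_energy \<eta> \<alpha>)"
  unfolding tendsto_L1_def
proof
  show "\<forall>\<^sub>F N in sequentially. integrable (random_graph \<alpha> N) (hc_log_volume \<eta> N)"
    using eventually_ge_at_top[of 2]
  proof eventually_elim
    case (elim N)
    have "finite (vertex_pairs N)"
      unfolding vertex_pairs_def by (rule finite_subset[of _ "Pow {1..N}"]) auto
    then have "finite (set_pmf (random_graph \<alpha> N))"
      using expectation_random_graph(2)[OF assms(1) elim] finite_subset by blast
    then show ?case by (rule integrable_measure_pmf_finite)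
  qed
  show "(\<lambda>N. \<integral>G. \<bar>hc_log_volume \<eta> N G - free_energy \<eta> \<alpha>\<bar> \<partial>random_graph \<alpha> N) \<longlonglongrightarrow> 0"
  proof (rule Lim_transform_eventually[OF Eb_lnZ_tendsto_L1[OF assms]])
    show "\<forall>\<^sub>F N in sequentially. Eb (er_prob \<alpha> N) (pairs {1..N}) (\<lambda>G. \<bar>ln (hc_Z \<eta> {1..N} G) / real N - free_energy \<eta> \<alpha>\<bar>) =
      (\<integral>G. \<bar>hc_log_volume \<eta> N G - free_energy \<eta> \<alpha>\<bar> \<partial>random_graph \<alpha> N)"
      using eventually_ge_at_top[of 2]
    proof eventually_elim
      case (elim N)
      have "er_prob \<alpha> N = 1 - exp (- (2 * \<alpha> / (real N - 1)))"
        using elim by (simp add: er_prob_def)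
      moreover have "vertex_pairs N = pairs {1..N}"
        by (simp only: vertex_pairs_def pairs_def)
      ultimately show ?case
        by (simp only: expectation_random_graph(1)[OF assms(1) elim] hc_log_volume_eq)
    qed
  qed
qed

theorem theorem2p3:
  fixes \<alpha> \<eta> :: real
  assumes "0 < \<alpha>" and "\<alpha> \<le> 1 / 2" and "0 < \<eta>"
  shows "(\<exists>!\<mu>. \<mu> \<in> Pr1_X0 \<and> T_hc \<eta> \<alpha> \<mu> = \<mu>) \<and>
         (\<forall>\<mu>. \<mu> \<in> Pr1_X0 \<and> T_hc \<eta> \<alpha> \<mu> = \<mu> \<longrightarrow>
            P_hc_well_defined \<eta> \<alpha> \<mu> \<and>
            tendsto_L1 (\<lambda>N. measure_pmf (random_graph \<alpha> N)) (\<lambda>N. hc_log_volume \<eta> N) (P_hc \<eta> \<alpha> \<mu>))"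
proof -
  have c: "0 < 2 * \<alpha>" "2 * \<alpha> \<le> 1" using assms by auto
  have fp: "\<mu> \<in> Pr1_X0 \<and> T_hc \<eta> \<alpha> \<mu> = \<mu> \<longleftrightarrow> \<mu> = gw_law \<eta> (2 * \<alpha>)" for \<mu>
    using fixed_point_eq_gw_law[OF assms(3,1) refl c] gw_law_Pr1[OF assms(3,1) refl c] T_gw_law[OF assms(3,1) refl c]
    by blast
  show ?thesis
    unfolding fp using P_hc_gw_law[OF assms(3,1) refl c] hc_log_volume_tendsto_L1[OF assms] by simp
qed

end
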